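(* Let $\mathcal G$ be a finite planar graph with positive edge weights and with nodes $1,2,\dots,2n$ on its outer face, numbered counterclockwise. Suppose each node is given exactly one of the colors red, green, blue, so that, with $R$, $G$, $B$ denoting the sets of red, green and blue nodes, the nodes of $R$ come first in the numbering, then those of $G$, then those of $B$ (a color class may be empty). Suppose $|R|,|G|,|B|$ satisfy the (non-strict) triangle inequality, i.e. each is at most the sum of the other two. Let $\sigma$ be the tripartite pairing partition defined by $R,G,B$, i.e. the unique non-crossing partition of the nodes into parts of size two in which no part contains two nodes of the same color. Then $$\frac{\Pr(\sigma)}{\Pr(1|2|\cdots|2n)} = \operatorname{Pf} \begin{bmatrix} 0 & L_{R,G} & L_{R,B}\\ -L_{G,R} & 0 & L_{G,B}\\ -L_{B,R} & -L_{B,G} & 0 \end{bmatrix}.$$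
   Context: The edge weights are regarded as conductances. Every connected component of $\mathcal G$ contains at least one node. Vertices that are not nodes are called internal. Grove: a spanning forest of $\mathcal G$ in which every component tree contains at least one node. Each grove determines a partition of the nodes (two nodes are in the same part iff they are in the same component tree). The probability of a grove is proportional to the product of the weights of its edges, and $\Pr(\pi)$ is the probability that a random grove induces the partition $\pi$ of the nodes. The partition $1|2|\cdots|2n$ has all parts singletons. Response matrix $L=(L_{i,j})$, indexed by the nodes: given potentials $v$ on the nodes, let $V$ be the extension of $v$ to all vertices that is harmonic at internal vertices (no current loss there); then $(Lv)_i=\sum_{w} c_{i,w}(V(w)-V(i))$, the sum being over edges from $i$ to neighbours $w$ with conductance $c_{i,w}$. Thus $L$ is symmetric, its off-diagonal entries are non-negative, and its rows sum to zero. For sets $S,T$ of nodes, $L_{S,T}$ is the submatrix of $L$ with rows indexed by $S$ and columns indexed by $T$, each in increasing order. A partition of the nodes is crossing if there are $a<b<c<d$ with $a,c$ in one part and $b,d$ in a different part; otherwise it is non-crossing (planar). The Pfaffian of an antisymmetric $2n\times 2n$ matrix $M$ is $$\operatorname{Pf} M=\sum_{\pi}(-1)^{\pi}M_{\pi_1,\pi_2}M_{\pi_3,\pi_4}\cdots M_{\pi_{2n-1},\pi_{2n}},$$ summed over permutations $\pi$ of $\{1,\dots,2n\}$ with $\pi_1<\pi_2,\ \dots,\ \pi_{2n-1}<\pi_{2n}$ and $\pi_1<\pi_3<\cdots<\pi_{2n-1}$, where $(-1)^\pi$ is the sign of $\pi$. *)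

theory Defs
  imports
    "HOL-Library.Disjoint_Sets"
    "HOL-Combinatorics.Permutations"
    "HOL-Complex_Analysis.Complex_Analysis"
begin

section \<open>Weighted graphs with nodes\<close>

text \<open>
  Multigraphs: parallel edges and loops are allowed. An edge with two distinct ends \<open>u\<close>, \<open>v\<close>
  has \<open>ends e = {u, v}\<close>, a loop at \<open>v\<close> has \<open>ends e = {v}\<close>. Node number \<open>i\<close>, for
  \<open>1 \<le> i \<le> num_nodes\<close>, is the vertex \<open>node i\<close>; sets and partitions of nodes are represented by
  sets and partitions of the node numbers.
\<close>

record ('v, 'e) network =
  verts :: "'v set"
  edges :: "'e set"
  ends :: "'e \<Rightarrow> 'v set"
  weight :: "'e \<Rightarrow> real"
  num_nodes :: nat
  node :: "nat \<Rightarrow> 'v"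

definition node_labels :: "('v, 'e) network \<Rightarrow> nat set" where
  "node_labels G = {1..num_nodes G}"

definition internal_verts :: "('v, 'e) network \<Rightarrow> 'v set" where
  "internal_verts G = verts G - node G ` node_labels G"

definition linked :: "('v, 'e) network \<Rightarrow> 'e set \<Rightarrow> 'v \<Rightarrow> 'v \<Rightarrow> bool" where
  "linked G F u v \<longleftrightarrow> (u, v) \<in> {(x, y). \<exists>e\<in>F. ends G e = {x, y}}\<^sup>*"

definition components_have_nodes :: "('v, 'e) network \<Rightarrow> 'e set \<Rightarrow> bool" where
  "components_have_nodes G F \<longleftrightarrow> (\<forall>v\<in>verts G. \<exists>i\<in>node_labels G. linked G F v (node G i))"

definition valid_network :: "('v, 'e) network \<Rightarrow> bool" where
  "valid_network G \<longleftrightarrow>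
     finite (verts G) \<and> finite (edges G) \<and>
     (\<forall>e\<in>edges G. ends G e \<subseteq> verts G \<and> card (ends G e) \<in> {1, 2}) \<and>
     (\<forall>e\<in>edges G. weight G e > 0) \<and>
     inj_on (node G) (node_labels G) \<and> node G ` node_labels G \<subseteq> verts G \<and>
     components_have_nodes G (edges G)"

section \<open>Groves\<close>

text \<open>
  A loop is a cycle of length 1 and a pair of parallel edges is a cycle of length 2.
\<close>

definition is_cycle :: "('v, 'e) network \<Rightarrow> 'v list \<Rightarrow> 'e list \<Rightarrow> bool" where
  "is_cycle G vs es \<longleftrightarrow>
     es \<noteq> [] \<and> length vs = length es \<and> distinct vs \<and> distinct es \<and>
     (\<forall>i<length es. ends G (es ! i) = {vs ! i, vs ! (Suc i mod length es)})"

definition forest :: "('v, 'e) network \<Rightarrow> 'e set \<Rightarrow> bool" where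
  "forest G F \<longleftrightarrow> F \<subseteq> edges G \<and> (\<nexists>vs es. is_cycle G vs es \<and> set es \<subseteq> F)"

text \<open>
  A spanning subgraph is given by its edge set; vertices that meet no edge of \<open>F\<close> are
  single-vertex components.
\<close>

definition groves :: "('v, 'e) network \<Rightarrow> 'e set set" where
  "groves G = {F. forest G F \<and> components_have_nodes G F}"

definition grove_weight :: "('v, 'e) network \<Rightarrow> 'e set \<Rightarrow> real" where
  "grove_weight G F = (\<Prod>e\<in>F. weight G e)"

definition node_partition :: "('v, 'e) network \<Rightarrow> 'e set \<Rightarrow> nat set set" where
  "node_partition G F =
     (\<lambda>i. {j \<in> node_labels G. linked G F (node G i) (node G j)}) ` node_labels G"

definition grove_prob :: "('v, 'e) network \<Rightarrow> nat set set \<Rightarrow> real" where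
  "grove_prob G \<pi> =
     (\<Sum>F\<in>{F \<in> groves G. node_partition G F = \<pi>}. grove_weight G F) /
     (\<Sum>F\<in>groves G. grove_weight G F)"

section \<open>Response matrix\<close>

text \<open>
  In the inner sum the term \<open>w = u\<close> vanishes, so a non-loop edge contributes its other end only
  and a loop contributes nothing.
\<close>

definition current :: "('v, 'e) network \<Rightarrow> ('v \<Rightarrow> real) \<Rightarrow> 'v \<Rightarrow> real" where
  "current G V u =
     (\<Sum>e\<in>{e \<in> edges G. u \<in> ends G e}. \<Sum>w\<in>ends G e. weight G e * (V w - V u))"

definition is_harmonic_extension ::
    "('v, 'e) network \<Rightarrow> (nat \<Rightarrow> real) \<Rightarrow> ('v \<Rightarrow> real) \<Rightarrow> bool" where
  "is_harmonic_extension G v V \<longleftrightarrow>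
     (\<forall>i\<in>node_labels G. V (node G i) = v i) \<and> (\<forall>u\<in>internal_verts G. current G V u = 0)"

text \<open>
  For a valid network the extension exists and its values on the vertices are unique; the
  choice only concerns the irrelevant values off \<open>verts G\<close>.
\<close>

definition harmonic_extension :: "('v, 'e) network \<Rightarrow> (nat \<Rightarrow> real) \<Rightarrow> 'v \<Rightarrow> real" where
  "harmonic_extension G v = (SOME V. is_harmonic_extension G v V)"

definition response_map :: "('v, 'e) network \<Rightarrow> (nat \<Rightarrow> real) \<Rightarrow> nat \<Rightarrow> real" where
  "response_map G v i = current G (harmonic_extension G v) (node G i)"

text \<open>The matrix of the linear map \<open>response_map G\<close> in the standard basis.\<close>

definition response_matrix :: "('v, 'e) network \<Rightarrow> nat \<Rightarrow> nat \<Rightarrow> real" where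
  "response_matrix G i j = response_map G (\<lambda>k. if k = j then 1 else 0) i"

section \<open>Planar embeddings with nodes on the outer face\<close>

definition drawing ::
    "('v, 'e) network \<Rightarrow> ('v \<Rightarrow> complex) \<Rightarrow> ('e \<Rightarrow> real \<Rightarrow> complex) \<Rightarrow> complex set" where
  "drawing G pos crv = pos ` verts G \<union> (\<Union>e\<in>edges G. path_image (crv e))"

text \<open>
  Since \<open>pos\<close> is injective on the vertices, the curve of a non-loop edge is an arc and the
  curve of a loop is a simple closed curve.
\<close>

definition plane_embedding ::
    "('v, 'e) network \<Rightarrow> ('v \<Rightarrow> complex) \<Rightarrow> ('e \<Rightarrow> real \<Rightarrow> complex) \<Rightarrow> bool" where
  "plane_embedding G pos crv \<longleftrightarrow>
     inj_on pos (verts G) \<and>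
     (\<forall>e\<in>edges G. simple_path (crv e) \<and>
        {pathstart (crv e), pathfinish (crv e)} = pos ` ends G e \<and>
        path_image (crv e) \<inter> pos ` verts G = pos ` ends G e) \<and>
     (\<forall>e\<in>edges G. \<forall>f\<in>edges G. e \<noteq> f \<longrightarrow>
        path_image (crv e) \<inter> path_image (crv f) \<subseteq> pos ` verts G)"

definition nodes_on_outer_face ::
    "('v, 'e) network \<Rightarrow> ('v \<Rightarrow> complex) \<Rightarrow> ('e \<Rightarrow> real \<Rightarrow> complex) \<Rightarrow> bool" where
  "nodes_on_outer_face G pos crv \<longleftrightarrow>
     (\<forall>i\<in>node_labels G. pos (node G i) \<in> frontier (outside (drawing G pos crv)))"

text \<open>
  The boundary of the outer face need not be a simple closed curve: the graph may have cut
  vertices and may be disconnected. The counterclockwise order of the nodes is therefore read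
  off a positively oriented simple closed curve that surrounds the graph and touches it exactly
  at the nodes (such a curve runs in the outer face between consecutive nodes).
\<close>

definition nodes_counterclockwise ::
    "('v, 'e) network \<Rightarrow> ('v \<Rightarrow> complex) \<Rightarrow> ('e \<Rightarrow> real \<Rightarrow> complex) \<Rightarrow> bool" where
  "nodes_counterclockwise G pos crv \<longleftrightarrow>
     (\<exists>\<gamma> t. simple_path \<gamma> \<and> pathfinish \<gamma> = pathstart \<gamma> \<and>
        (\<forall>z\<in>inside (path_image \<gamma>). winding_number \<gamma> z = 1) \<and>
        drawing G pos crv \<subseteq> path_image \<gamma> \<union> inside (path_image \<gamma>) \<and>
        path_image \<gamma> \<inter> drawing G pos crv = pos ` node G ` node_labels G \<and>
        strict_mono_on (node_labels G) t \<and>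
        (\<forall>i\<in>node_labels G. t i \<in> {0..<1} \<and> \<gamma> (t i) = pos (node G i)))"

section \<open>Tripartite pairings\<close>

definition crossing :: "nat set set \<Rightarrow> bool" where
  "crossing \<pi> \<longleftrightarrow>
     (\<exists>P\<in>\<pi>. \<exists>Q\<in>\<pi>. P \<noteq> Q \<and>
        (\<exists>a b c d. a < b \<and> b < c \<and> c < d \<and> a \<in> P \<and> c \<in> P \<and> b \<in> Q \<and> d \<in> Q))"

definition is_tripartite_pairing ::
    "nat \<Rightarrow> nat set \<Rightarrow> nat set \<Rightarrow> nat set \<Rightarrow> nat set set \<Rightarrow> bool" where
  "is_tripartite_pairing n R Gr B \<sigma> \<longleftrightarrow>
     partition_on {1..2 * n} \<sigma> \<and> \<not> crossing \<sigma> \<and> (\<forall>P\<in>\<sigma>. card P = 2) \<and>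
     (\<forall>P\<in>\<sigma>. \<forall>C\<in>{R, Gr, B}. \<forall>i\<in>P. \<forall>j\<in>P. i \<in> C \<and> j \<in> C \<longrightarrow> i = j)"

definition tripartite_pairing ::
    "nat \<Rightarrow> nat set \<Rightarrow> nat set \<Rightarrow> nat set \<Rightarrow> nat set set" where
  "tripartite_pairing n R Gr B = (THE \<sigma>. is_tripartite_pairing n R Gr B \<sigma>)"

definition singletons :: "nat \<Rightarrow> nat set set" where
  "singletons m = (\<lambda>i. {i}) ` {1..m}"

section \<open>Pfaffians\<close>

definition pfaffian :: "nat \<Rightarrow> (nat \<Rightarrow> nat \<Rightarrow> real) \<Rightarrow> real" where
  "pfaffian n M =
     (\<Sum>p\<in>{p. p permutes {1..2 * n} \<and>
              (\<forall>i\<in>{1..n}. p (2 * i - 1) < p (2 * i)) \<and>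
              (\<forall>i\<in>{1..<n}. p (2 * i - 1) < p (2 * i + 1))}.
        of_int (sign p) * (\<Prod>i\<in>{1..n}. M (p (2 * i - 1)) (p (2 * i))))"

text \<open>
  The block matrix with block rows and columns \<open>R\<close>, \<open>Gr\<close>, \<open>B\<close>. Its rows and columns are
  indexed by node numbers; this agrees with positional indexing when the elements of \<open>R\<close> precede
  those of \<open>Gr\<close>, which precede those of \<open>B\<close>.
\<close>

definition tripartite_matrix ::
    "(nat \<Rightarrow> nat \<Rightarrow> real) \<Rightarrow> nat set \<Rightarrow> nat set \<Rightarrow> nat set \<Rightarrow> nat \<Rightarrow> nat \<Rightarrow> real" where
  "tripartite_matrix L R Gr B i j =
     (if (i \<in> R \<and> j \<in> Gr) \<or> (i \<in> R \<and> j \<in> B) \<or> (i \<in> Gr \<and> j \<in> B) then L i j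
      else if (i \<in> Gr \<and> j \<in> R) \<or> (i \<in> B \<and> j \<in> R) \<or> (i \<in> B \<and> j \<in> Gr) then - L i j
      else 0)"

end

theory Submission
  imports Defs
begin

text \<open>
  Give a pairing the coefficient 1 or -1, by the parity of its number of crossings, if no pair is
  monochromatic, and the coefficient 0 otherwise. For four points in a fixed surrounding pairing the three coefficients
  add up to zero. Now fix the first node \<open>a\<close> of a node set \<open>A\<close> and let \<open>F u\<close> be the signed sum of the
  groves in which \<open>a\<close> and some \<open>j\<close> are separate singletons, \<open>u\<close> lies in the tree of \<open>j\<close>, and the
  remaining nodes of \<open>A\<close> are paired; the coefficient is that of the pairing completed by \<open>{a, j}\<close>. Moving an
  edge at \<open>u\<close> from one tree to another shows, by the three-term relation, that \<open>F\<close> is harmonic at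
  internal vertices. Its value at the node \<open>j\<close> is, up to sign, the signed sum for \<open>A - {a, j}\<close>, and its
  current at \<open>a\<close> is the signed sum for \<open>A\<close>. So the signed sums satisfy the row expansion of the
  Pfaffian in the entries of the response matrix. In a planar network no grove induces a crossing
  pairing, and the tripartite pairing is the only term that remains.
\<close>

section \<open>Connectivity, forests and branches\<close>

text \<open>The recursion keeps the network fixed and shrinks only the node set \<open>A\<close>;
  the nodes outside \<open>A\<close> are forced to be singletons. At \<open>A = {}\<close> only the
  groves with singleton parts remain, and their weight is the denominator of the ratio. Signs are
  products over points and chords rather than counts of crossings, so that the sign of a pairing
  splits into a factor seen by four given points and a factor independent of how these are paired.
  The three-term relation then asks that among four points in increasing order two neighbours have
  equal color, which three consecutive color classes guarantee; four different colors would leave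
  the sum 1. The potentials that are 1 at one node and 0 at the others are themselves grove sums, by
  the same cancellation with a simpler mark, so harmonic extensions and the entries of the response
  matrix come from one mechanism. Planarity enters when crossing pairings are excluded, and the
  triangle inequalities when the color counts are turned into numbers of pairs of each kind.\<close>

lemma linked_refl [simp]: "linked G F x x"
  by (simp add: linked_def)

lemma linked_trans: "linked G F x y \<Longrightarrow> linked G F y z \<Longrightarrow> linked G F x z"
  by (auto simp: linked_def)

lemma linked_sym: "linked G F x y \<Longrightarrow> linked G F y x"
proof -
  have "sym {(x, y). \<exists>e\<in>F. ends G e = {x, y}}"
    by (auto simp: sym_def insert_commute)
  then show "linked G F x y \<Longrightarrow> linked G F y x"
    unfolding linked_def by (meson sym_rtrancl symD)
qed

lemma linked_cong: "linked G F x y \<Longrightarrow> linked G F x z \<longleftrightarrow> linked G F y z"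
  using linked_trans[of G F x y z] linked_trans[of G F y x z] linked_sym[of G F x y] by blast

lemma linked_cong_right: "linked G F x y \<Longrightarrow> linked G F z x \<longleftrightarrow> linked G F z y"
  using linked_trans[of G F z x y] linked_trans[of G F z y x] linked_sym[of G F x y] by blast

lemma linked_mono: "linked G F x y \<Longrightarrow> F \<subseteq> F' \<Longrightarrow> linked G F' x y"
proof -
  assume "linked G F x y" "F \<subseteq> F'"
  moreover have "{(x, y). \<exists>e\<in>F. ends G e = {x, y}} \<subseteq> {(x, y). \<exists>e\<in>F'. ends G e = {x, y}}"
    using \<open>F \<subseteq> F'\<close> by auto
  ultimately show ?thesis
    unfolding linked_def using rtrancl_mono by blast
qed

lemma linked_edge: "e \<in> F \<Longrightarrow> ends G e = {x, y} \<Longrightarrow> linked G F x y"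
  unfolding linked_def by (rule r_into_rtrancl) auto

lemma linked_induct [consumes 1, case_names refl step]:
  assumes "linked G F x y" "P x"
    and "\<And>y z e. linked G F x y \<Longrightarrow> e \<in> F \<Longrightarrow> ends G e = {y, z} \<Longrightarrow> P y \<Longrightarrow> P z"
  shows "P y"
  using assms(1) unfolding linked_def
proof (induction rule: rtrancl_induct)
  case (step y z)
  then obtain e where "e \<in> F" "ends G e = {y, z}" by blast
  then show ?case using assms(3) step unfolding linked_def by blast
qed (rule assms(2))

text \<open>A connection that uses the new edge several times can be shortened to one that uses it
  at most once, in one of two directions. This reduces linkage after adding or deleting an edge to
  linkage in the smaller set.\<close>

lemma linked_insert:
  assumes e: "ends G e = {u, w}"
  shows "linked G (insert e F) x y \<longleftrightarrow>
    linked G F x y \<or> linked G F x u \<and> linked G F w y \<or> linked G F x w \<and> linked G F u y"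
    (is "_ \<longleftrightarrow> ?R y")
proof
  assume "linked G (insert e F) x y"
  then show "?R y"
  proof (induction rule: linked_induct)
    case (step y z f)
    show ?case
    proof (cases "f \<in> F")
      case True
      then have "linked G F y z" using step(3) by (rule linked_edge)
      then show ?thesis using step(4) linked_trans[of G F _ y z] by blast
    next
      case False
      then have "y = u \<and> z = w \<or> y = w \<and> z = u"
        using step(2,3) e by (auto simp: doubleton_eq_iff)
      then show ?thesis using step(4) by auto
    qed
  qed simp
next
  have 1: "linked G (insert e F) u w" "linked G (insert e F) w u"
    using e linked_edge linked_sym by (metis insertI1)+
  have 2: "linked G F a b \<Longrightarrow> linked G (insert e F) a b" for a b
    by (erule linked_mono) auto
  assume "?R y"
  then show "linked G (insert e F) x y"
    using 2 linked_trans[OF linked_trans[OF 2 1(1)] 2] linked_trans[OF linked_trans[OF 2 1(2)] 2]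
    by blast
qed

text \<open>The vertex list runs backwards, from \<open>y\<close> to \<open>x\<close>, so that a
  further step of the walk is a cons. If the new vertex already occurs, the prefix before it is
  dropped, which keeps the vertices distinct.\<close>

lemma linked_imp_path:
  assumes "linked G F x y"
  shows "\<exists>vs es. length vs = Suc (length es) \<and> distinct vs \<and> vs ! 0 = y \<and>
    vs ! length es = x \<and> (\<forall>i<length es. es ! i \<in> F \<and> ends G (es ! i) = {vs ! i, vs ! Suc i})"
  using assms
proof (induction rule: linked_induct)
  case refl
  show ?case by (rule exI[of _ "[x]"], rule exI[of _ "[]"]) simp
next
  case (step y z f)
  then obtain vs es where p: "length vs = Suc (length es)" "distinct vs" "vs ! 0 = y"
    "vs ! length es = x" "\<forall>i<length es. es ! i \<in> F \<and> ends G (es ! i) = {vs ! i, vs ! Suc i}"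
    by blast
  show ?case
  proof (cases "z \<in> set vs")
    case True
    then obtain k where k: "k < length vs" "vs ! k = z" by (meson in_set_conv_nth)
    show ?thesis
    proof (intro exI[of _ "drop k vs"] exI[of _ "drop k es"] conjI allI impI)
      fix i assume "i < length (drop k es)"
      then have "i + k < length es" by simp
      then show "drop k es ! i \<in> F" "ends G (drop k es ! i) = {drop k vs ! i, drop k vs ! Suc i}"
        using p k by (auto simp: add.commute)
    qed (use p k in auto)
  next
    case False
    show ?thesis
    proof (intro exI[of _ "z # vs"] exI[of _ "f # es"] conjI allI impI)
      fix i assume "i < length (f # es)"
      then show "(f # es) ! i \<in> F" "ends G ((f # es) ! i) = {(z # vs) ! i, (z # vs) ! Suc i}"
        using p step by (cases i; auto simp: insert_commute)+
    qed (use p False in auto)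
  qed
qed

text \<open>Acyclicity edge by edge. A simple path joining the ends of \<open>e\<close> without
  \<open>e\<close> closes up to a cycle with \<open>e\<close>, and going round a cycle from its
  first to its last vertex avoids the last edge. Loops are covered because every vertex is linked to
  itself.\<close>

lemma forest_iff:
  "forest G F \<longleftrightarrow> F \<subseteq> edges G \<and>
    (\<forall>e\<in>F. \<forall>x y. ends G e = {x, y} \<longrightarrow> \<not> linked G (F - {e}) x y)"
proof (intro iffI conjI ballI allI impI notI)
  show "forest G F \<Longrightarrow> F \<subseteq> edges G" by (simp add: forest_def)
next
  fix e x y
  assume F: "forest G F" and e: "e \<in> F" "ends G e = {x, y}" and "linked G (F - {e}) x y"
  then obtain vs es where p: "length vs = Suc (length es)" "distinct vs" "vs ! 0 = y"
    "vs ! length es = x"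
    "\<forall>i<length es. es ! i \<in> F - {e} \<and> ends G (es ! i) = {vs ! i, vs ! Suc i}"
    by (meson linked_imp_path)
  have "es ! i \<noteq> es ! j" if "i < j" "j < length es" for i j
  proof
    assume "es ! i = es ! j"
    then have "{vs ! i, vs ! Suc i} = {vs ! j, vs ! Suc j}"
      using p(5) that by (metis order.strict_trans)
    moreover have "vs ! i \<noteq> vs ! j" "vs ! i \<noteq> vs ! Suc j"
      using p(1,2) that by (simp_all add: nth_eq_iff_index_eq)
    ultimately show False by (auto simp: doubleton_eq_iff)
  qed
  then have "distinct es"
    unfolding distinct_conv_nth by (metis nat_neq_iff)
  moreover have "set es \<subseteq> F - {e}"
    using p(5) by (auto simp: set_conv_nth)
  moreover have "ends G ((es @ [e]) ! i) = {vs ! i, vs ! (Suc i mod Suc (length es))}"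
    if "i < Suc (length es)" for i
    using that p(3,4,5) e by (cases "i = length es") (auto simp: nth_append insert_commute)
  ultimately have "is_cycle G vs (es @ [e])" "set (es @ [e]) \<subseteq> F"
    using p e unfolding is_cycle_def by auto
  then show False using F unfolding forest_def by blast
next
  assume *: "F \<subseteq> edges G \<and>
    (\<forall>e\<in>F. \<forall>x y. ends G e = {x, y} \<longrightarrow> \<not> linked G (F - {e}) x y)"
  have "False" if c: "is_cycle G vs es" and F: "set es \<subseteq> F" for vs es
  proof -
    define m where "m = length es - 1"
    have m: "length es = Suc m" using c unfolding is_cycle_def m_def by (cases es) auto
    note c = c[unfolded is_cycle_def m]
    have "linked G (F - {es ! m}) (vs ! 0) (vs ! k)" if "k \<le> m" for k
      using that
    proof (induction k)
      case (Suc k)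
      have "es ! k \<in> F - {es ! m}"
        using F m c Suc.prems by (auto simp: nth_eq_iff_index_eq)
      moreover have "ends G (es ! k) = {vs ! k, vs ! Suc k}"
        using c Suc.prems by auto
      ultimately show ?case using Suc linked_edge linked_trans
        by (metis Suc_leD)
    qed simp
    then have "linked G (F - {es ! m}) (vs ! m) (vs ! 0)" by (simp add: linked_sym)
    moreover have "ends G (es ! m) = {vs ! m, vs ! 0}" using c by auto
    moreover have "es ! m \<in> F" using F m by auto
    ultimately show False using * by blast
  qed
  then show "forest G F" using * unfolding forest_def by blast
qed

lemma forest_subset: "forest G F \<Longrightarrow> F' \<subseteq> F \<Longrightarrow> forest G F'"
  unfolding forest_def by blast

text \<open>If another edge \<open>f\<close> became redundant, the connection of its ends that
  avoids \<open>f\<close> would have to use \<open>e\<close>; together with \<open>f\<close> it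
  would then link \<open>u\<close> and \<open>w\<close> inside \<open>F\<close>.\<close>

lemma forest_insert:
  assumes F: "forest G F" and e: "e \<in> edges G" "ends G e = {u, w}" "\<not> linked G F u w"
  shows "forest G (insert e F)"
  unfolding forest_iff
proof (intro conjI ballI allI impI)
  show "insert e F \<subseteq> edges G" using F e by (auto simp: forest_def)
next
  fix f x y assume f: "f \<in> insert e F" and xy: "ends G f = {x, y}"
  have "linked G (F - {f}) a b \<Longrightarrow> linked G F a b" for a b by (erule linked_mono) auto
  note mono = this
  show "\<not> linked G (insert e F - {f}) x y"
  proof (cases "f = e")
    case True
    have "linked G F u w" if "linked G (insert e F - {f}) x y"
    proof -
      have "linked G F x y" using that True by (auto elim: linked_mono)
      moreover have "{x, y} = {u, w}" using True xy e by simp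
      ultimately show ?thesis by (metis doubleton_eq_iff linked_sym)
    qed
    then show ?thesis using e by blast
  next
    case False
    then have f: "f \<in> F" using f by simp
    have n: "\<not> linked G (F - {f}) x y" using F f xy unfolding forest_iff by blast
    have l: "linked G F x y" "linked G F y x" using f xy linked_edge linked_sym by metis+
    have "insert e F - {f} = insert e (F - {f})" using False by auto
    then show ?thesis
      using n l e(3) mono linked_insert[OF e(2)] linked_trans linked_sym by metis
  qed
qed

lemma linked_in_verts:
  assumes "valid_network G" "F \<subseteq> edges G" "linked G F x y" "x \<in> verts G"
  shows "y \<in> verts G"
  using assms(3)
proof (induction rule: linked_induct)
  case (step y z e)
  then show ?case using assms unfolding valid_network_def by blast
qed (use assms in simp)

section \<open>Node sets of trees and the partition they form\<close>

definition nodes_in :: "('v, 'e) network \<Rightarrow> 'e set \<Rightarrow> 'v \<Rightarrow> nat set" where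
  "nodes_in G F x = {i \<in> node_labels G. linked G F x (node G i)}"

lemma finite_node_labels [simp]: "finite (node_labels G)"
  by (simp add: node_labels_def)

lemma finite_nodes_in [simp]: "finite (nodes_in G F x)"
  by (simp add: nodes_in_def)

lemma nodes_in_cong: "linked G F x y \<Longrightarrow> nodes_in G F x = nodes_in G F y"
  by (simp add: nodes_in_def linked_cong[of G F x y])

lemma node_partition_altdef: "node_partition G F = (\<lambda>i. nodes_in G F (node G i)) ` node_labels G"
  unfolding node_partition_def nodes_in_def ..

lemma components_have_nodes_altdef:
  "components_have_nodes G F \<longleftrightarrow> (\<forall>v\<in>verts G. nodes_in G F v \<noteq> {})"
  unfolding components_have_nodes_def nodes_in_def by blast

lemma nodes_in_node_mem: "i \<in> node_labels G \<Longrightarrow> i \<in> nodes_in G F (node G i)"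
  by (simp add: nodes_in_def)

lemma nodes_in_disjoint:
  "\<not> linked G F x y \<Longrightarrow> nodes_in G F x \<inter> nodes_in G F y = {}"
  using linked_trans[of G F x _ y] linked_sym[of G F y] by (auto simp: nodes_in_def)

lemma partition_on_node_partition: "partition_on (node_labels G) (node_partition G F)"
proof (rule partition_onI)
  show "{} \<notin> node_partition G F"
    using nodes_in_node_mem unfolding node_partition_altdef by fastforce
  show "\<Union> (node_partition G F) = node_labels G"
    using nodes_in_node_mem unfolding node_partition_altdef by (fastforce simp: nodes_in_def)
  show "disjnt p q" if pq: "p \<in> node_partition G F" "q \<in> node_partition G F" "p \<noteq> q" for p q
  proof -
    obtain i j where "p = nodes_in G F (node G i)" "q = nodes_in G F (node G j)"
      using pq(1,2) by (auto simp: node_partition_altdef)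
    then show ?thesis
      using pq(3) nodes_in_disjoint[of G F "node G i" "node G j"]
        nodes_in_cong[of G F "node G i" "node G j"] by (auto simp: disjnt_def)
  qed
qed

lemma nodes_in_mem_partition:
  assumes "nodes_in G F x \<noteq> {}"
  shows "nodes_in G F x \<in> node_partition G F"
proof -
  obtain i where "i \<in> node_labels G" "linked G F x (node G i)"
    using assms by (auto simp: nodes_in_def)
  then show ?thesis using nodes_in_cong[of G F x "node G i"] by (auto simp: node_partition_altdef)
qed

lemma node_partition_eqI:
  assumes "P \<in> node_partition G F" "i \<in> P"
  shows "nodes_in G F (node G i) = P"
proof -
  obtain j where "j \<in> node_labels G" "P = nodes_in G F (node G j)"
    using assms by (auto simp: node_partition_altdef)
  moreover from this have "linked G F (node G j) (node G i)" using assms by (simp add: nodes_in_def)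
  ultimately show ?thesis using nodes_in_cong by metis
qed

text \<open>For a loop at \<open>u\<close> the chosen end is \<open>u\<close> itself, so every edge
  at \<open>u\<close> has the form \<open>{u, opp_end G u e}\<close> without a case split. The
  choice is meaningful only when \<open>u\<close> is an end of \<open>e\<close>.\<close>

definition opp_end :: "('v, 'e) network \<Rightarrow> 'v \<Rightarrow> 'e \<Rightarrow> 'v" where
  "opp_end G u e = (SOME w. ends G e = {u, w})"

locale conductance_network =
  fixes G :: "('v, 'e) network"
  assumes valid: "valid_network G"
begin

lemma finite_edges: "finite (edges G)" and finite_verts: "finite (verts G)"
  using valid by (auto simp: valid_network_def)

lemma ends_opp: "e \<in> edges G \<Longrightarrow> u \<in> ends G e \<Longrightarrow> ends G e = {u, opp_end G u e}"
proof -
  assume e: "e \<in> edges G" "u \<in> ends G e"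
  then have "card (ends G e) = 1 \<or> card (ends G e) = 2" using valid by (auto simp: valid_network_def)
  then have "\<exists>w. ends G e = {u, w}"
    using e(2) by (auto simp: card_1_singleton_iff card_2_iff)
  then show ?thesis unfolding opp_end_def by (rule someI_ex)
qed

lemma ends_verts: "e \<in> edges G \<Longrightarrow> ends G e \<subseteq> verts G"
  using valid by (simp add: valid_network_def)

lemma weight_pos: "e \<in> edges G \<Longrightarrow> weight G e > 0"
  using valid by (simp add: valid_network_def)

lemma node_verts: "i \<in> node_labels G \<Longrightarrow> node G i \<in> verts G"
  using valid by (auto simp: valid_network_def)

lemma node_inj: "i \<in> node_labels G \<Longrightarrow> j \<in> node_labels G \<Longrightarrow> node G i = node G j \<longleftrightarrow> i = j"
  using valid by (auto simp: valid_network_def inj_on_def)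

lemma groves_subset: "K \<in> groves G \<Longrightarrow> K \<subseteq> edges G"
  by (simp add: groves_def forest_def)

lemma finite_groves: "finite (groves G)"
  using finite_subset[of "groves G" "Pow (edges G)"] groves_subset finite_edges by blast

section \<open>Deleting one edge from a forest\<close>

context
  fixes K e u w
  assumes K: "forest G K" and e: "e \<in> K" and ends_e: "ends G e = {u, w}"
begin

lemma not_linked_removed: "\<not> linked G (K - {e}) u w"
  using K e ends_e unfolding forest_iff by blast

lemma linked_remove:
  "linked G K x y \<longleftrightarrow> linked G (K - {e}) x y \<or>
    linked G (K - {e}) x u \<and> linked G (K - {e}) w y \<or>
    linked G (K - {e}) x w \<and> linked G (K - {e}) u y"
  using linked_insert[OF ends_e, of "K - {e}" x y] e by (simp add: insert_absorb)

lemma nodes_in_remove_Un: "nodes_in G K u = nodes_in G (K - {e}) u \<union> nodes_in G (K - {e}) w"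
  unfolding nodes_in_def using linked_remove[of u] not_linked_removed by auto

lemma nodes_in_remove_disjoint: "nodes_in G (K - {e}) u \<inter> nodes_in G (K - {e}) w = {}"
  using not_linked_removed by (rule nodes_in_disjoint)

lemma nodes_in_remove_other:
  assumes "\<not> linked G K x u"
  shows "nodes_in G (K - {e}) x = nodes_in G K x"
proof -
  have "linked G (K - {e}) x u \<Longrightarrow> False" "linked G (K - {e}) x w \<Longrightarrow> False"
    using assms linked_remove by auto
  then show ?thesis unfolding nodes_in_def linked_remove by auto
qed

text \<open>Trees not containing \<open>e\<close> are untouched, so only the two halves of the cut
  tree can lose all their nodes.\<close>

lemma grove_remove_iff:
  assumes "K \<in> groves G"
  shows "K - {e} \<in> groves G \<longleftrightarrow> nodes_in G (K - {e}) u \<noteq> {} \<and> nodes_in G (K - {e}) w \<noteq> {}"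
proof
  have "u \<in> verts G" "w \<in> verts G"
    using ends_verts[of e] ends_e groves_subset[OF assms] e by auto
  then show "K - {e} \<in> groves G \<Longrightarrow> nodes_in G (K - {e}) u \<noteq> {} \<and> nodes_in G (K - {e}) w \<noteq> {}"
    by (simp add: groves_def components_have_nodes_altdef)
next
  assume *: "nodes_in G (K - {e}) u \<noteq> {} \<and> nodes_in G (K - {e}) w \<noteq> {}"
  have "nodes_in G (K - {e}) v \<noteq> {}" if v: "v \<in> verts G" for v
  proof (cases "linked G K v u")
    case True
    then have "linked G (K - {e}) v u \<or> linked G (K - {e}) v w"
      using linked_remove by auto
    then show ?thesis using * nodes_in_cong by metis
  next
    case False
    then show ?thesis
      using nodes_in_remove_other v assms by (simp add: groves_def components_have_nodes_altdef)
  qed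
  then show "K - {e} \<in> groves G"
    using forest_subset[OF K, of "K - {e}"] by (simp add: groves_def components_have_nodes_altdef Diff_subset)
qed

text \<open>The cut replaces one block by two and keeps the others. Both halves must contain nodes,
  since the empty set is never a block.\<close>

lemma node_partition_remove:
  assumes "nodes_in G (K - {e}) u \<noteq> {}" "nodes_in G (K - {e}) w \<noteq> {}"
  shows "node_partition G (K - {e}) = (node_partition G K - {nodes_in G K u}) \<union>
    {nodes_in G (K - {e}) w, nodes_in G (K - {e}) u}"
proof (intro equalityI subsetI)
  fix P assume "P \<in> node_partition G (K - {e})"
  then obtain i where i: "i \<in> node_labels G" "P = nodes_in G (K - {e}) (node G i)"
    by (auto simp: node_partition_altdef)
  show "P \<in> (node_partition G K - {nodes_in G K u}) \<union>
    {nodes_in G (K - {e}) w, nodes_in G (K - {e}) u}"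
  proof (cases "linked G K (node G i) u")
    case True
    then have "linked G (K - {e}) (node G i) u \<or> linked G (K - {e}) (node G i) w"
      using linked_remove by auto
    then show ?thesis using nodes_in_cong i by fast
  next
    case False
    then have "P = nodes_in G K (node G i)" using nodes_in_remove_other i by simp
    moreover have "i \<in> nodes_in G K (node G i)" "i \<notin> nodes_in G K u"
      using False i nodes_in_node_mem linked_sym[of G K u "node G i"] by (auto simp: nodes_in_def)
    ultimately show ?thesis using i by (auto simp: node_partition_altdef)
  qed
next
  fix P assume "P \<in> (node_partition G K - {nodes_in G K u}) \<union>
    {nodes_in G (K - {e}) w, nodes_in G (K - {e}) u}"
  then consider "P \<in> node_partition G K" "P \<noteq> nodes_in G K u"
    | "P = nodes_in G (K - {e}) w" | "P = nodes_in G (K - {e}) u" by blast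
  then show "P \<in> node_partition G (K - {e})"
  proof cases
    case 1
    then obtain i where i: "i \<in> node_labels G" "P = nodes_in G K (node G i)"
      by (auto simp: node_partition_altdef)
    then have "\<not> linked G K (node G i) u" using 1 nodes_in_cong by metis
    then have "P = nodes_in G (K - {e}) (node G i)" using nodes_in_remove_other i by simp
    then show ?thesis using i by (auto simp: node_partition_altdef)
  next
    case 2
    then show ?thesis using nodes_in_mem_partition[OF assms(2)] by simp
  next
    case 3
    then show ?thesis using nodes_in_mem_partition[OF assms(1)] by simp
  qed
qed

end

section \<open>Branches of a tree at a vertex\<close>

definition branch :: "'e set \<Rightarrow> 'v \<Rightarrow> 'e \<Rightarrow> nat set" where
  "branch K u e = nodes_in G (K - {e}) (opp_end G u e)"

text \<open>A branch cannot return to \<open>u\<close>: that would link the ends of \<open>f\<close>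
  without \<open>f\<close>. Hence it uses no edge at \<open>u\<close>, in particular not
  \<open>e\<close>. The case \<open>e = f\<close> is included and shows that a branch misses
  \<open>u\<close>.\<close>

lemma branch_linked_avoids:
  assumes K: "forest G K" and e: "e \<in> K" "u \<in> ends G e" and f: "f \<in> K" "u \<in> ends G f"
    and x: "linked G (K - {f}) (opp_end G u f) x"
  shows "x \<noteq> u \<and> linked G (K - {f} - {e}) (opp_end G u f) x"
  using x
proof (induction rule: linked_induct)
  have ef: "ends G f = {u, opp_end G u f}" using f K ends_opp by (auto simp: forest_def)
  have n: "\<not> linked G (K - {f}) (opp_end G u f) u"
    using not_linked_removed[OF K f(1) ef] linked_sym[of G "K - {f}" "opp_end G u f" u] by blast
  case (step y z g)
  have "linked G (K - {f}) (opp_end G u f) z"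
    using step(1) linked_edge[OF step(2,3)] by (rule linked_trans)
  then have z: "z \<noteq> u" using n by blast
  then have "g \<noteq> e" using step e by auto
  then have "linked G (K - {f} - {e}) y z"
    using step by (intro linked_edge[of g]) auto
  then show ?case using z step(4) linked_trans by auto
next
  case refl
  have "ends G f = {u, opp_end G u f}" using f K ends_opp by (auto simp: forest_def)
  then show ?case using not_linked_removed[OF K f(1)] by fastforce
qed

text \<open>A common node would give a way from \<open>u\<close> through \<open>f\<close> and its
  branch into the branch of \<open>e\<close>, avoiding \<open>e\<close>, and so make
  \<open>e\<close> redundant.\<close>

lemma branch_disjoint:
  assumes K: "forest G K" and e: "e \<in> K" "u \<in> ends G e" and f: "f \<in> K" "u \<in> ends G f"
    and ef: "e \<noteq> f"
  shows "branch K u e \<inter> branch K u f = {}"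
proof (rule ccontr)
  assume "branch K u e \<inter> branch K u f \<noteq> {}"
  then obtain x where x: "linked G (K - {e}) (opp_end G u e) x" "linked G (K - {f}) (opp_end G u f) x"
    by (auto simp: branch_def nodes_in_def)
  have "linked G (K - {f} - {e}) (opp_end G u f) x"
    using branch_linked_avoids[OF K e f x(2)] by simp
  then have "linked G (K - {e}) (opp_end G u f) x" by (rule linked_mono) auto
  moreover have "linked G (K - {e}) u (opp_end G u f)"
    using f ef K ends_opp by (intro linked_edge[of f]) (auto simp: forest_def)
  ultimately have "linked G (K - {e}) u (opp_end G u e)"
    using x(1) by (metis linked_cong linked_cong_right)
  moreover have "ends G e = {u, opp_end G u e}" using e K ends_opp by (auto simp: forest_def)
  ultimately show False using not_linked_removed[OF K e(1)] by blast
qed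

lemma linked_imp_branch:
  assumes K: "forest G K" and x: "linked G K u x"
  shows "x = u \<or> (\<exists>e\<in>K. u \<in> ends G e \<and> linked G (K - {e}) (opp_end G u e) x)"
  using x
proof (induction rule: linked_induct)
  case (step y z f)
  show ?case
  proof (cases "y = u")
    case True
    then have "f \<in> edges G" "u \<in> ends G f" using step K by (auto simp: forest_def)
    then have "ends G f = {u, opp_end G u f}" by (rule ends_opp)
    then have "z = u \<or> z = opp_end G u f" using step by auto
    then show ?thesis using step True by auto
  next
    case False
    then obtain e where e: "e \<in> K" "u \<in> ends G e" "linked G (K - {e}) (opp_end G u e) y"
      using step by blast
    show ?thesis
    proof (cases "f = e")
      case True
      then show ?thesis using e step False by auto
    next
      case False
      then have "linked G (K - {e}) y z" using step by (intro linked_edge[of f]) auto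
      then show ?thesis using e linked_trans[OF e(3)] by blast
    qed
  qed
qed simp

lemma nodes_in_branches:
  assumes K: "forest G K"
  shows "nodes_in G K u = {i \<in> node_labels G. node G i = u} \<union>
    (\<Union>e\<in>{e\<in>K. u \<in> ends G e}. branch K u e)"
proof (intro equalityI subsetI)
  fix i assume "i \<in> nodes_in G K u"
  then show "i \<in> {i \<in> node_labels G. node G i = u} \<union> (\<Union>e\<in>{e\<in>K. u \<in> ends G e}. branch K u e)"
    using linked_imp_branch[OF K] by (auto simp: nodes_in_def branch_def)
next
  fix i assume i: "i \<in> {i \<in> node_labels G. node G i = u} \<union> (\<Union>e\<in>{e\<in>K. u \<in> ends G e}. branch K u e)"
  show "i \<in> nodes_in G K u"
  proof (cases "node G i = u")
    case True
    then show ?thesis using i by (auto simp: nodes_in_def branch_def)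
  next
    case False
    then obtain e where e: "e \<in> K" "u \<in> ends G e" "i \<in> branch K u e" using i by auto
    then have "linked G K u (opp_end G u e)"
      using K ends_opp by (intro linked_edge[of e]) (auto simp: forest_def)
    moreover have "linked G K (opp_end G u e) (node G i)"
      using e linked_mono[of G "K - {e}" _ _ K] by (auto simp: branch_def nodes_in_def)
    ultimately have "linked G K u (node G i)" by (rule linked_trans)
    then show ?thesis using e by (auto simp: nodes_in_def branch_def)
  qed
qed

lemma branch_not_self:
  assumes "forest G K" "e \<in> K" "u \<in> ends G e" "i \<in> branch K u e"
  shows "node G i \<noteq> u"
  using branch_linked_avoids[OF assms(1,2,3,2,3)] assms(4) by (auto simp: branch_def nodes_in_def)

end

section \<open>Marked grove sums as harmonic functions\<close>

text \<open>\<open>\<phi> \<tau> P\<close> weighs a node partition \<open>\<tau>\<close> together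
  with the block \<open>P\<close> of the tree that contains the vertex under consideration. The
  second clause comes from a tree in which three branches at a vertex lead to single nodes
  \<open>i\<close>, \<open>j\<close>, \<open>k\<close>: cutting off one branch leaves one of them
  alone and the other two together. There \<open>\<tau>\<close> is the rest of the
  partition.\<close>

definition admissible_mark :: "(nat set set \<Rightarrow> nat set \<Rightarrow> real) \<Rightarrow> bool" where
  "admissible_mark \<phi> \<longleftrightarrow>
    (\<forall>\<tau> P. \<phi> \<tau> P \<noteq> 0 \<longrightarrow> card P = 1 \<and> (\<forall>Q\<in>\<tau>. card Q \<le> 2)) \<and>
    (\<forall>\<tau> i j k. distinct [i, j, k] \<and> \<Union>\<tau> \<inter> {i, j, k} = {} \<longrightarrow>
      \<phi> (\<tau> \<union> {{i}, {j, k}}) {i} + \<phi> (\<tau> \<union> {{j}, {i, k}}) {j} + \<phi> (\<tau> \<union> {{k}, {i, j}}) {k} = 0)"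

lemma admissible_mark_three_term:
  assumes "admissible_mark \<phi>" "distinct [i, j, k]" "\<Union>\<tau> \<inter> {i, j, k} = {}"
  shows "\<phi> (\<tau> \<union> {{i}, {j, k}}) {i} + \<phi> (\<tau> \<union> {{j}, {i, k}}) {j} + \<phi> (\<tau> \<union> {{k}, {i, j}}) {k} = 0"
  using assms unfolding admissible_mark_def by meson

text \<open>
  Two non-empty branches cancel each other. With more branches, admissibility leaves only the case
  of three branches carrying one node each, where the sum is the three-term relation.
\<close>

lemma branch_sum_zero:
  fixes B :: "'e \<Rightarrow> nat set"
  assumes \<phi>: "admissible_mark \<phi>" and E: "finite E"
    and disj: "\<And>e f. e \<in> E \<Longrightarrow> f \<in> E \<Longrightarrow> e \<noteq> f \<Longrightarrow> B e \<inter> B f = {}"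
    and U: "U = (\<Union>e\<in>E. B e)" "finite U" and \<tau>: "\<Union>\<tau> \<inter> U = {}"
  shows "(\<Sum>e\<in>{e\<in>E. B e \<noteq> {} \<and> U - B e \<noteq> {}}.
    \<phi> (\<tau> \<union> {B e, U - B e}) (B e) - \<phi> (\<tau> \<union> {B e, U - B e}) (U - B e)) = 0"
    (is "sum ?t ?E = 0")
proof -
  define N where "N = {e \<in> E. B e \<noteq> {}}"
  have N: "finite N" "N \<subseteq> E" using E by (auto simp: N_def)
  have UN: "U = (\<Union>e\<in>N. B e)" using U by (auto simp: N_def)
  have diff: "U - B e = (\<Union>f\<in>N - {e}. B f)" if "e \<in> N" for e
  proof -
    have "B e \<inter> B f = {}" if "f \<in> N - {e}" for f
      using disj[of e f] that \<open>e \<in> N\<close> N(2) by auto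
    then show ?thesis using that unfolding UN by auto
  qed
  have EN: "?E = {e \<in> N. N - {e} \<noteq> {}}"
  proof -
    have "U - B e \<noteq> {} \<longleftrightarrow> N - {e} \<noteq> {}" if "e \<in> N" for e
      unfolding diff[OF that] by (auto simp: N_def)
    moreover have "?E = {e \<in> N. U - B e \<noteq> {}}" by (auto simp: N_def)
    ultimately show ?thesis by auto
  qed
  consider "N = {}" | e where "N = {e}" | e f where "e \<noteq> f" "N = {e, f}"
    | "\<forall>e\<in>N. \<forall>f\<in>N. \<exists>g\<in>N. g \<noteq> e \<and> g \<noteq> f" "N \<noteq> {}"
  proof (cases "\<forall>e\<in>N. \<forall>f\<in>N. \<exists>g\<in>N. g \<noteq> e \<and> g \<noteq> f")
    case True
    then show thesis using that(1,4) by blast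
  next
    case False
    then obtain e f where "N = {e, f}" by auto
    then show thesis using that(2)[of e] that(3)[of e f] by (cases "e = f") simp_all
  qed
  then show ?thesis
  proof cases
    case (3 e f)
    then have "?E = {e, f}" unfolding EN by auto
    moreover have "U - B e = B f" "U - B f = B e" using diff[of e] diff[of f] 3 by auto
    ultimately show ?thesis using 3(1) by (simp add: insert_commute)
  next
    case 4
    then have "?E = N" unfolding EN by blast
    have two: "card (U - B e) \<ge> 2" if e: "e \<in> N" for e
    proof -
      obtain f where f: "f \<in> N" "f \<noteq> e" using 4(1) e by blast
      obtain g where g: "g \<in> N" "g \<noteq> e" "g \<noteq> f" using 4(1) e f by blast
      obtain x y where xy: "x \<in> B f" "y \<in> B g" using f g by (auto simp: N_def)
      then have "x \<noteq> y" using disj[of f g] f g N by auto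
      moreover have "{x, y} \<subseteq> U - B e" using xy f g diff[OF e] by auto
      ultimately show ?thesis using card_mono[of "U - B e" "{x, y}"] U(2) by simp
    qed
    \<comment> \<open>With three or more non-empty branches the complement of any one has at least
      two nodes, so it is never a singleton and the subtracted terms vanish.\<close>
    have z: "\<phi> (\<tau> \<union> {B e, U - B e}) (U - B e) = 0" if "e \<in> N" for e
      using \<phi> two[OF that] unfolding admissible_mark_def by fastforce
    show ?thesis
    proof (cases "\<exists>e\<in>N. \<phi> (\<tau> \<union> {B e, U - B e}) (B e) \<noteq> 0")
      case False
      then show ?thesis using z unfolding \<open>?E = N\<close> by (intro sum.neutral) auto
    next
      case True
      then obtain e where e: "e \<in> N" "\<phi> (\<tau> \<union> {B e, U - B e}) (B e) \<noteq> 0" by blast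
      then have "card (B e) = 1" "card (U - B e) \<le> 2"
        using \<phi> unfolding admissible_mark_def by blast+
      then have ce: "card (B e) = 1" "card (U - B e) = 2" using two[OF e(1)] by auto
      obtain f where f: "f \<in> N" "f \<noteq> e" using 4(1) e by blast
      obtain g where g: "g \<in> N" "g \<noteq> e" "g \<noteq> f" using 4(1) e f by blast
      obtain x where x: "B e = {x}" using ce by (auto simp: card_1_singleton_iff)
      obtain y z where yz: "y \<in> B f" "z \<in> B g" using f g by (auto simp: N_def)
      have "y \<noteq> z" using yz disj[of f g] f g N by auto
      moreover have "{y, z} \<subseteq> U - B e" using yz f g diff[OF e(1)] by auto
      ultimately have Ue: "U - B e = {y, z}" using ce(2) U(2)
        by (metis card_2_iff card_seteq card.infinite finite_Diff order_refl)
      have N3: "N = {e, f, g}"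
      proof (rule ccontr)
        assume "N \<noteq> {e, f, g}"
        then obtain h where h: "h \<in> N" "h \<noteq> e" "h \<noteq> f" "h \<noteq> g" using e f g by blast
        then obtain v where v: "v \<in> B h" by (auto simp: N_def)
        then have "v \<in> {y, z}" using h diff[OF e(1)] Ue by blast
        then show False using v yz h f g disj[of h f] disj[of h g] N by auto
      qed
      have U3: "U = {x, y, z}" using Ue x UN e by auto
      have fg: "B f \<subseteq> {y, z}" "B g \<subseteq> {y, z}" using f g diff[OF e(1)] Ue by blast+
      have "B f \<inter> B g = {}" using disj[of f g] f g N by auto
      then have B: "B f = {y}" "B g = {z}" using fg yz by auto
      have d: "distinct [x, y, z]" using Ue x \<open>y \<noteq> z\<close> by auto
      then have D: "U - {x} = {y, z}" "U - {y} = {x, z}" "U - {z} = {x, y}" using U3 by auto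
      have "sum ?t ?E = (\<Sum>e\<in>N. \<phi> (\<tau> \<union> {B e, U - B e}) (B e))"
        unfolding \<open>?E = N\<close> by (intro sum.cong refl) (simp only: z diff_zero)
      also have "\<dots> = \<phi> (\<tau> \<union> {{x}, {y, z}}) {x} + \<phi> (\<tau> \<union> {{y}, {x, z}}) {y}
          + \<phi> (\<tau> \<union> {{z}, {x, y}}) {z}"
        unfolding N3 using f g by (simp add: x B D add.assoc)
      also have "\<dots> = 0"
        using \<tau> unfolding U3 by (rule admissible_mark_three_term[OF \<phi> d])
      finally show ?thesis .
    qed
  next
    case 1
    then have "?E = {}" unfolding EN by auto
    then show ?thesis by (simp only: sum.empty)
  next
    case (2 e)
    then have "?E = {}" unfolding EN by auto
    then show ?thesis by (simp only: sum.empty)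
  qed
qed

context conductance_network
begin

section \<open>The current and the maximum principle\<close>

lemma current_cong:
  assumes "\<And>x. x \<in> verts G \<Longrightarrow> V x = W x" "u \<in> verts G"
  shows "current G V u = current G W u"
  unfolding current_def using assms ends_verts by (intro sum.cong) (auto simp: subset_iff)

lemma current_scale: "current G (\<lambda>x. c * V x) u = c * current G V u"
  unfolding current_def by (simp add: sum_distrib_left algebra_simps)

lemma current_sum: "current G (\<lambda>x. \<Sum>i\<in>I. V i x) u = (\<Sum>i\<in>I. current G (V i) u)"
proof -
  have "current G (\<lambda>x. \<Sum>i\<in>I. V i x) u = (\<Sum>e\<in>{e \<in> edges G. u \<in> ends G e}. \<Sum>i\<in>I.
      \<Sum>w\<in>ends G e. weight G e * (V i w - V i u))"
    unfolding current_def
    by (intro sum.cong refl, subst sum.swap)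
      (simp add: sum_distrib_left sum_subtractf right_diff_distrib)
  then show ?thesis unfolding current_def by (subst sum.swap)
qed

lemma current_minus: "current G (\<lambda>x. V x - W x) u = current G V u - current G W u"
  unfolding current_def sum_subtractf[symmetric]
  by (intro sum.cong refl) (simp add: algebra_simps)

text \<open>Maximum principle. At an internal vertex where the maximum \<open>m\<close> is attained,
  zero current is a vanishing sum of terms of one sign, so every neighbour attains \<open>m\<close>
  as well. The maximum thus spreads along edges until it meets a node, where the value is 0; the
  alternative \<open>m \<le> 0\<close> in the induction records that a node has been met.\<close>

lemma zero_boundary_nonpos:
  assumes z: "\<And>i. i \<in> node_labels G \<Longrightarrow> V (node G i) = 0"
    and h: "\<And>u. u \<in> internal_verts G \<Longrightarrow> current G V u = 0"
    and x: "x \<in> verts G"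
  shows "V x \<le> 0"
proof -
  define m where "m = Max (V ` verts G)"
  have le: "V y \<le> m" if "y \<in> verts G" for y
    using that finite_verts by (auto simp: m_def)
  have "m \<in> V ` verts G" unfolding m_def using x finite_verts by (intro Max_in) auto
  then obtain y where y: "y \<in> verts G" "V y = m" by auto
  have "components_have_nodes G (edges G)" using valid by (simp add: valid_network_def)
  then obtain i where i: "i \<in> node_labels G" "linked G (edges G) y (node G i)"
    using y by (auto simp: components_have_nodes_def)
  have "v \<in> verts G \<and> (V v = m \<or> m \<le> 0)" if "linked G (edges G) y v" for v
    using that
  proof (induction rule: linked_induct)
    case (step v w e)
    have w: "w \<in> verts G" using step(2,3) ends_verts by blast
    show ?case
    proof (cases "v \<in> internal_verts G \<and> V v = m")
      case True
      have "(\<Sum>e\<in>{e \<in> edges G. v \<in> ends G e}. \<Sum>w\<in>ends G e. weight G e * (V v - V w)) = 0"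
        (is "?s = 0")
      proof -
        have "?s = - current G V v"
          unfolding current_def sum_negf[symmetric]
          by (intro sum.cong refl) (simp add: algebra_simps)
        then show ?thesis using h[of v] True by simp
      qed
      moreover have nn: "weight G e * (V v - V w) \<ge> 0" if "e \<in> edges G" "w \<in> ends G e" for e w
        using le[of w] weight_pos[of e] True ends_verts[of e] that by auto
      ultimately have "(\<Sum>w\<in>ends G e. weight G e * (V v - V w)) = 0"
        using step(2,3) finite_edges
        by (subst (asm) sum_nonneg_eq_0_iff) (auto intro!: sum_nonneg)
      then have "weight G e * (V v - V w) = 0"
        using nn[OF step(2)] step(3) by (subst (asm) sum_nonneg_eq_0_iff) auto
      then show ?thesis using weight_pos[OF step(2)] True w by simp
    next
      case False
      then have "m \<le> 0" using step(4) z by (auto simp: internal_verts_def)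
      then show ?thesis using w by simp
    qed
  qed (use y in simp)
  then have "m \<le> 0" using i z by fastforce
  then show ?thesis using le[OF x] by simp
qed

lemma harmonic_unique:
  assumes "is_harmonic_extension G v V" "is_harmonic_extension G v W" "x \<in> verts G"
  shows "V x = W x"
proof -
  have "V x - W x \<le> 0"
    using assms by (intro zero_boundary_nonpos[of "\<lambda>x. V x - W x"])
      (auto simp: is_harmonic_extension_def current_minus)
  moreover have "W x - V x \<le> 0"
    using assms by (intro zero_boundary_nonpos[of "\<lambda>x. W x - V x"])
      (auto simp: is_harmonic_extension_def current_minus)
  ultimately show ?thesis by simp
qed

section \<open>The current of a marked grove sum\<close>

definition marked_sum :: "(nat set set \<Rightarrow> nat set \<Rightarrow> real) \<Rightarrow> 'v \<Rightarrow> real" where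
  "marked_sum \<phi> x = (\<Sum>H\<in>groves G. grove_weight G H * \<phi> (node_partition G H) (nodes_in G H x))"

lemma finite_grove: "K \<in> groves G \<Longrightarrow> finite K"
  using groves_subset finite_edges finite_subset by blast

lemma grove_remove_weight:
  "K \<in> groves G \<Longrightarrow> e \<in> K \<Longrightarrow> grove_weight G K = weight G e * grove_weight G (K - {e})"
  unfolding grove_weight_def by (intro prod.remove finite_grove)

lemma forest_no_loop:
  assumes "forest G K" "e \<in> K" "ends G e = {u, w}"
  shows "u \<noteq> w"
  using not_linked_removed[OF assms] by auto

lemma grove_insert:
  assumes "H \<in> groves G" "e \<in> edges G" "ends G e = {u, w}" "\<not> linked G H u w"
  shows "insert e H \<in> groves G"
  using assms forest_insert[of G H e u w] linked_mono[of G H _ _ "insert e H"]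
  unfolding groves_def components_have_nodes_def by blast

text \<open>Expanding the current gives pairs of a grove \<open>H\<close> and an edge
  \<open>e\<close> at \<open>u\<close>. If \<open>e\<close> has both ends in one tree of
  \<open>H\<close>, the marks at its ends agree and the pair contributes nothing; otherwise adding
  \<open>e\<close> gives a grove \<open>K\<close> of weight
  \<open>weight G e * grove_weight G H\<close>. Regrouping by \<open>K\<close> turns the current
  into a sum over the ways to cut \<open>K\<close> at an edge of \<open>u\<close>.\<close>

lemma current_marked_sum:
  "current G (marked_sum \<phi>) u = (\<Sum>K\<in>groves G. grove_weight G K *
    (\<Sum>e\<in>{e\<in>K. u \<in> ends G e \<and> K - {e} \<in> groves G}.
      \<phi> (node_partition G (K - {e})) (branch K u e) -
      \<phi> (node_partition G (K - {e})) (nodes_in G (K - {e}) u)))"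
proof -
  define E where "E = {e \<in> edges G. u \<in> ends G e}"
  define d where "d e H = (\<Sum>w\<in>ends G e. \<phi> (node_partition G H) (nodes_in G H w) -
    \<phi> (node_partition G H) (nodes_in G H u))" for e H
  define X where "X = {(e, H). e \<in> E \<and> H \<in> groves G \<and> \<not> linked G H u (opp_end G u e)}"
  define Y where "Y = (SIGMA K:groves G. {e\<in>K. u \<in> ends G e \<and> K - {e} \<in> groves G})"
  have E: "finite E" using finite_edges by (simp add: E_def)
  have "current G (marked_sum \<phi>) u =
    (\<Sum>e\<in>E. \<Sum>H\<in>groves G. weight G e * grove_weight G H * d e H)"
    unfolding current_def E_def marked_sum_def d_def sum_subtractf[symmetric]
      right_diff_distrib[symmetric] sum_distrib_left
    by (intro sum.cong refl, subst sum.swap) (simp add: mult.assoc)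
  also have "\<dots> = (\<Sum>(e, H)\<in>E \<times> groves G. weight G e * grove_weight G H * d e H)"
    using E finite_groves by (simp add: sum.cartesian_product)
  also have "\<dots> = (\<Sum>(e, H)\<in>X. weight G e * grove_weight G H * d e H)"
  proof (rule sum.mono_neutral_right)
    show "finite (E \<times> groves G)" using E finite_groves by simp
    show "X \<subseteq> E \<times> groves G" by (auto simp: X_def)
    show "\<forall>p\<in>E \<times> groves G - X. (case p of (e, H) \<Rightarrow> weight G e * grove_weight G H * d e H) = 0"
    proof (clarify)
      fix e H assume p: "e \<in> E" "H \<in> groves G" "(e, H) \<notin> X"
      then have l: "linked G H u (opp_end G u e)" by (auto simp: X_def)
      have "ends G e = {u, opp_end G u e}" using p ends_opp by (auto simp: E_def)
      then have "d e H = 0"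
        unfolding d_def using nodes_in_cong[OF l] by (intro sum.neutral) auto
      then show "weight G e * grove_weight G H * d e H = 0" by simp
    qed
  qed
  also have "\<dots> = (\<Sum>(K, e)\<in>Y. grove_weight G K * d e (K - {e}))"
  proof (rule sum.reindex_bij_witness[of _ "\<lambda>(K, e). (e, K - {e})" "\<lambda>(e, H). (insert e H, e)"])
    fix p assume "p \<in> X"
    then obtain e H where p: "p = (e, H)" "e \<in> E" "H \<in> groves G" "\<not> linked G H u (opp_end G u e)"
      by (auto simp: X_def)
    have ends: "e \<in> edges G" "ends G e = {u, opp_end G u e}"
      using p(2) ends_opp by (auto simp: E_def)
    then have "e \<notin> H" using p(4) linked_edge by metis
    then have H: "insert e H - {e} = H" by simp
    have I: "insert e H \<in> groves G" using grove_insert[OF p(3) ends p(4)] .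
    show "(case case p of (e, H) \<Rightarrow> (insert e H, e) of (K, e) \<Rightarrow> (e, K - {e})) = p"
      using p H by simp
    show "(case p of (e, H) \<Rightarrow> (insert e H, e)) \<in> Y" using p I H ends by (auto simp: Y_def)
    show "(case case p of (e, H) \<Rightarrow> (insert e H, e) of (K, e) \<Rightarrow> grove_weight G K * d e (K - {e})) =
      (case p of (e, H) \<Rightarrow> weight G e * grove_weight G H * d e H)"
      using p H grove_remove_weight[OF I, of e] by simp
  next
    fix p assume "p \<in> Y"
    then obtain K e where p: "p = (K, e)" "e \<in> K" "K \<in> groves G" "u \<in> ends G e" "K - {e} \<in> groves G"
      by (auto simp: Y_def)
    then have e: "e \<in> edges G" "forest G K" using groves_subset by (auto simp: groves_def)
    have "ends G e = {u, opp_end G u e}" using e(1) p(4) by (rule ends_opp)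
    note n = not_linked_removed[OF e(2) p(2) this]
    show "(case case p of (K, e) \<Rightarrow> (e, K - {e}) of (e, H) \<Rightarrow> (insert e H, e)) = p"
      using p by auto
    show "(case p of (K, e) \<Rightarrow> (e, K - {e})) \<in> X" using p e n by (auto simp: X_def E_def)
  qed
  also have "\<dots> = (\<Sum>K\<in>groves G. \<Sum>e\<in>{e\<in>K. u \<in> ends G e \<and> K - {e} \<in> groves G}.
      grove_weight G K * d e (K - {e}))"
    unfolding Y_def using finite_groves finite_grove by (subst sum.Sigma) auto
  also have "\<dots> = (\<Sum>K\<in>groves G. grove_weight G K *
    (\<Sum>e\<in>{e\<in>K. u \<in> ends G e \<and> K - {e} \<in> groves G}.
      \<phi> (node_partition G (K - {e})) (branch K u e) -
      \<phi> (node_partition G (K - {e})) (nodes_in G (K - {e}) u)))"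
    unfolding sum_distrib_left
  proof (intro sum.cong refl)
    fix K e assume K: "K \<in> groves G" and e: "e \<in> {e\<in>K. u \<in> ends G e \<and> K - {e} \<in> groves G}"
    have "e \<in> edges G" "u \<in> ends G e" using K e groves_subset by auto
    note ends = ends_opp[OF this]
    have "forest G K" using K by (simp add: groves_def)
    then have "u \<noteq> opp_end G u e" using forest_no_loop e ends by blast
    then show "grove_weight G K * d e (K - {e}) = grove_weight G K *
      (\<phi> (node_partition G (K - {e})) (branch K u e) -
       \<phi> (node_partition G (K - {e})) (nodes_in G (K - {e}) u))"
      unfolding d_def branch_def by (subst (1) ends) simp
  qed
  finally show ?thesis .
qed

text \<open>Each grove \<open>K\<close> contributes zero by itself. As \<open>u\<close> is not a
  node, the nodes of its tree are exactly those in the branches, and a cut leaves a grove exactly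
  when both sides keep a node, which is the index set of \<open>branch_sum_zero\<close>; the blocks
  of the other trees are its \<open>\<tau>\<close>.\<close>

lemma marked_sum_harmonic:
  assumes \<phi>: "admissible_mark \<phi>" and u: "u \<in> internal_verts G"
  shows "current G (marked_sum \<phi>) u = 0"
  unfolding current_marked_sum
proof (intro sum.neutral ballI)
  fix K assume K: "K \<in> groves G"
  then have fK: "forest G K" by (simp add: groves_def)
  define E where "E = {e \<in> K. u \<in> ends G e}"
  define U where "U = nodes_in G K u"
  have none: "{i \<in> node_labels G. node G i = u} = {}" using u by (auto simp: internal_verts_def)
  have U: "U = (\<Union>e\<in>E. branch K u e)"
    unfolding U_def E_def nodes_in_branches[OF fK] none by simp
  have e: "U - branch K u e = nodes_in G (K - {e}) u \<and>
    (K - {e} \<in> groves G \<longleftrightarrow> branch K u e \<noteq> {} \<and> U - branch K u e \<noteq> {}) \<and>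
    (branch K u e \<noteq> {} \<and> U - branch K u e \<noteq> {} \<longrightarrow>
      node_partition G (K - {e}) = (node_partition G K - {U}) \<union> {branch K u e, U - branch K u e})"
    if "e \<in> E" for e
  proof -
    have e: "e \<in> edges G" "u \<in> ends G e" "e \<in> K" using that K groves_subset by (auto simp: E_def)
    note ends = ends_opp[OF e(1,2)]
    have 1: "U - branch K u e = nodes_in G (K - {e}) u"
      using nodes_in_remove_Un[OF fK e(3) ends] nodes_in_remove_disjoint[OF fK e(3) ends]
      by (auto simp: U_def branch_def)
    show ?thesis
      using grove_remove_iff[OF fK e(3) ends K] node_partition_remove[OF fK e(3) ends]
      unfolding 1 unfolding U_def branch_def by blast
  qed
  have "(\<Sum>e\<in>{e\<in>K. u \<in> ends G e \<and> K - {e} \<in> groves G}.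
      \<phi> (node_partition G (K - {e})) (branch K u e) -
      \<phi> (node_partition G (K - {e})) (nodes_in G (K - {e}) u)) =
    (\<Sum>e\<in>{e\<in>E. branch K u e \<noteq> {} \<and> U - branch K u e \<noteq> {}}.
      \<phi> ((node_partition G K - {U}) \<union> {branch K u e, U - branch K u e}) (branch K u e) -
      \<phi> ((node_partition G K - {U}) \<union> {branch K u e, U - branch K u e}) (U - branch K u e))"
    using e by (intro sum.cong) (auto simp: E_def)
  also have "\<dots> = 0"
  proof (rule branch_sum_zero[OF \<phi>])
    show "finite E" using finite_grove[OF K] by (simp add: E_def)
    show "branch K u e \<inter> branch K u f = {}" if "e \<in> E" "f \<in> E" "e \<noteq> f" for e f
      using branch_disjoint[OF fK] that by (auto simp: E_def)
    show "finite U" by (simp add: U_def)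
    show "\<Union> (node_partition G K - {U}) \<inter> U = {}"
    proof (cases "U = {}")
      case False
      then have "U \<in> node_partition G K" unfolding U_def by (rule nodes_in_mem_partition)
      then show ?thesis
        using partition_on_node_partition[of G K] unfolding partition_on_def disjoint_def by blast
    qed simp
  qed (rule U)
  finally show "grove_weight G K * (\<Sum>e\<in>{e\<in>K. u \<in> ends G e \<and> K - {e} \<in> groves G}.
      \<phi> (node_partition G (K - {e})) (branch K u e) -
      \<phi> (node_partition G (K - {e})) (nodes_in G (K - {e}) u)) = 0" by simp
qed

section \<open>Harmonic measure and the response matrix\<close>

definition all_singletons :: "nat set set" where
  "all_singletons = (\<lambda>i. {i}) ` node_labels G"

definition partition_weight :: "nat set set \<Rightarrow> real" where
  "partition_weight \<tau> = (\<Sum>H\<in>{H\<in>groves G. node_partition G H = \<tau>}. grove_weight G H)"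

lemma grove_weight_pos: "K \<in> groves G \<Longrightarrow> grove_weight G K > 0"
  unfolding grove_weight_def using groves_subset weight_pos by (intro prod_pos) auto

lemma node_partition_singletonsI:
  assumes "\<And>i j. i \<in> node_labels G \<Longrightarrow> j \<in> node_labels G \<Longrightarrow> i \<noteq> j \<Longrightarrow>
    \<not> linked G H (node G i) (node G j)"
  shows "node_partition G H = all_singletons"
proof -
  have "nodes_in G H (node G i) = {i}" if "i \<in> node_labels G" for i
    using assms that by (auto simp: nodes_in_def)
  then show ?thesis unfolding node_partition_altdef all_singletons_def by simp
qed

text \<open>A minimal edge set all of whose components have nodes is a grove with singleton parts.\<close>

lemma ex_singleton_grove: "\<exists>H\<in>groves G. node_partition G H = all_singletons"
proof -
  define S where "S = {H. H \<subseteq> edges G \<and> components_have_nodes G H}"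
  have S: "edges G \<in> S" using valid by (simp add: S_def valid_network_def)
  then obtain H where H: "H \<in> S" "\<And>H'. H' \<in> S \<Longrightarrow> card H \<le> card H'"
    using ex_has_least_nat[of "\<lambda>H. H \<in> S" "edges G" card] by blast
  have fin: "finite H" using H finite_edges finite_subset by (auto simp: S_def)
  have min: "H - {e} \<notin> S" if "e \<in> H" for e
    using H(2)[of "H - {e}"] that fin by (metis card_Diff1_less linorder_not_le)
  have f: "forest G H"
    unfolding forest_iff
  proof (intro conjI ballI allI impI notI)
    fix e x y assume e: "e \<in> H" "ends G e = {x, y}" and l: "linked G (H - {e}) x y"
    have "linked G H a b \<longleftrightarrow> linked G (H - {e}) a b" for a b
    proof -
      have "insert e (H - {e}) = H" using e by auto
      then show ?thesis
        using linked_insert[OF e(2), of "H - {e}" a b] l linked_sym[OF l]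
          linked_trans[of G "H - {e}" a x y] linked_trans[of G "H - {e}" a y x]
          linked_trans[of G "H - {e}" a x b] linked_trans[of G "H - {e}" a y b] by auto
    qed
    then have "H - {e} \<in> S" using H(1) by (auto simp: S_def components_have_nodes_def)
    then show False using min e by blast
  qed (use H in \<open>auto simp: S_def\<close>)
  have g: "H \<in> groves G" using f H by (simp add: groves_def S_def)
  have "\<not> linked G H (node G i) (node G j)" if ij: "i \<in> node_labels G" "j \<in> node_labels G" "i \<noteq> j" for i j
  proof
    assume "linked G H (node G i) (node G j)"
    then have "j \<in> nodes_in G H (node G i)" using ij by (simp add: nodes_in_def)
    then obtain e where e: "e \<in> H" "node G i \<in> ends G e" "j \<in> branch H (node G i) e"
      using nodes_in_branches[OF f] ij node_inj by auto
    then have ends: "ends G e = {node G i, opp_end G (node G i) e}"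
      using ends_opp groves_subset[OF g] by blast
    \<comment> \<open>Cutting the edge at node \<open>i\<close> that leads towards \<open>j\<close>
      leaves a node on either side, so \<open>H\<close> would not be minimal.\<close>
    have "H - {e} \<in> groves G"
      using grove_remove_iff[OF f e(1) ends g] e(3) nodes_in_node_mem[OF ij(1)]
      by (auto simp: branch_def)
    then show False using min[OF e(1)] groves_subset by (auto simp: S_def groves_def)
  qed
  then show ?thesis using g node_partition_singletonsI by blast
qed

lemma singleton_weight_pos: "partition_weight all_singletons > 0"
  unfolding partition_weight_def using ex_singleton_grove finite_groves grove_weight_pos
  by (intro sum_pos) auto

definition singleton_mark :: "nat \<Rightarrow> nat set set \<Rightarrow> nat set \<Rightarrow> real" where
  "singleton_mark i \<tau> P = (if \<tau> = all_singletons \<and> P = {i} then 1 else 0)"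

lemma admissible_singleton_mark: "admissible_mark (singleton_mark i)"
proof -
  have "\<tau> \<union> {{i}, {j, k}} \<noteq> all_singletons" if "j \<noteq> k" for i j k \<tau>
  proof
    assume "\<tau> \<union> {{i}, {j, k}} = all_singletons"
    then have "{j, k} \<in> all_singletons" by blast
    then show False using that by (auto simp: all_singletons_def)
  qed
  then show ?thesis
    unfolding admissible_mark_def singleton_mark_def by (auto simp: all_singletons_def)
qed

text \<open>Among the groves with singleton parts, the proportion by weight in which
  \<open>x\<close> belongs to the tree of node \<open>i\<close>. As a function of \<open>x\<close>
  this is the potential with value 1 at node \<open>i\<close> and 0 at the other nodes.\<close>

definition harmonic_measure :: "nat \<Rightarrow> 'v \<Rightarrow> real" where
  "harmonic_measure i x = marked_sum (singleton_mark i) x / partition_weight all_singletons"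

lemma harmonic_measure_node:
  assumes "k \<in> node_labels G"
  shows "harmonic_measure i (node G k) = (if k = i then 1 else 0)"
proof -
  have "nodes_in G H (node G k) = {k}" if "node_partition G H = all_singletons" for H
  proof -
    have "{k} \<in> node_partition G H" using that assms by (simp add: all_singletons_def)
    then show ?thesis using node_partition_eqI by blast
  qed
  then have "marked_sum (singleton_mark i) (node G k) =
      (\<Sum>H\<in>groves G. if node_partition G H = all_singletons then
        (if k = i then grove_weight G H else 0) else 0)"
    unfolding marked_sum_def singleton_mark_def by (intro sum.cong) auto
  also have "\<dots> = (if k = i then partition_weight all_singletons else 0)"
    unfolding partition_weight_def using finite_groves by (cases "k = i") (simp_all add: sum.inter_filter cong: if_cong)
  finally show ?thesis using singleton_weight_pos by (simp add: harmonic_measure_def)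
qed

text \<open>Existence of harmonic extensions by an explicit formula, so that the choice in
  \<open>harmonic_extension\<close> is a genuine solution; by \<open>harmonic_unique\<close> it
  agrees with this one on all vertices.\<close>

lemma is_harmonic_extension_measure:
  "is_harmonic_extension G v (\<lambda>x. \<Sum>i\<in>node_labels G. v i * harmonic_measure i x)"
proof -
  have "current G (harmonic_measure i) u = 0" if "u \<in> internal_verts G" for i u
    using current_scale[of "1 / partition_weight all_singletons" "marked_sum (singleton_mark i)" u]
      marked_sum_harmonic[OF admissible_singleton_mark that, of i]
    by (simp add: harmonic_measure_def[abs_def])
  then show ?thesis
    unfolding is_harmonic_extension_def
    by (simp add: current_sum current_scale harmonic_measure_node if_distrib cong: if_cong)
qed

lemma response_matrix_eq:
  assumes "a \<in> node_labels G" "i \<in> node_labels G"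
  shows "response_matrix G a i = current G (harmonic_measure i) (node G a)"
proof -
  let ?v = "\<lambda>k. if k = i then 1 else (0::real)"
  have "\<exists>V. is_harmonic_extension G ?v V" 
    using exI[of "is_harmonic_extension G ?v", OF is_harmonic_extension_measure] .
  then have "is_harmonic_extension G ?v (harmonic_extension G ?v)"
    unfolding harmonic_extension_def by (rule someI_ex)
  moreover have "(\<lambda>x. \<Sum>k\<in>node_labels G. ?v k * harmonic_measure k x) = harmonic_measure i"
    using assms(2) by (auto simp: if_distrib[of "\<lambda>x. x * _"] cong: if_cong)
  then have "is_harmonic_extension G ?v (harmonic_measure i)"
    using is_harmonic_extension_measure[of ?v] by simp
  ultimately show ?thesis
    unfolding response_matrix_def response_map_def
    by (intro current_cong harmonic_unique node_verts assms)
qed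

text \<open>A function harmonic at the internal vertices is determined on all vertices by its values
  at the nodes, hence equals a combination of harmonic measures, whose currents at the nodes are the
  entries of the response matrix.\<close>

lemma current_node_harmonic:
  assumes h: "\<And>u. u \<in> internal_verts G \<Longrightarrow> current G F u = 0" and a: "a \<in> node_labels G"
  shows "current G F (node G a) = (\<Sum>i\<in>node_labels G. response_matrix G a i * F (node G i))"
proof -
  have "is_harmonic_extension G (\<lambda>i. F (node G i)) F"
    using h by (simp add: is_harmonic_extension_def)
  then have "current G F (node G a) = current G
      (\<lambda>x. \<Sum>i\<in>node_labels G. F (node G i) * harmonic_measure i x) (node G a)"
    using is_harmonic_extension_measure node_verts[OF a]
    by (intro current_cong harmonic_unique)
  then show ?thesis
    unfolding current_sum current_scale using a by (simp add: response_matrix_eq mult.commute)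
qed

end

section \<open>Signed sums over pairings\<close>

definition pairings :: "nat set \<Rightarrow> nat set set set" where
  "pairings A = {\<pi>. partition_on A \<pi> \<and> (\<forall>P\<in>\<pi>. card P = 2)}"

definition inside_sign :: "nat \<Rightarrow> nat set \<Rightarrow> real" where
  "inside_sign p Q = (if Min Q < p \<and> p < Max Q then -1 else 1)"

text \<open>For disjoint pairs this is -1 exactly if one point of \<open>P\<close> lies between the
  ends of \<open>Q\<close> and the other does not, that is, if the chords cross. Having one factor
  for each point of \<open>P\<close> allows signs to be regrouped by points instead of
  pairs.\<close>

definition cross_sign :: "nat set \<Rightarrow> nat set \<Rightarrow> real" where
  "cross_sign P Q = (\<Prod>p\<in>P. inside_sign p Q)"

text \<open>Comparing minima picks one order for each two blocks of a pairing, so each crossing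
  counts once and the value is -1 to the number of crossings.\<close>

definition pairing_sign :: "nat set set \<Rightarrow> real" where
  "pairing_sign \<pi> = (\<Prod>(P, Q)\<in>{(P, Q). P \<in> \<pi> \<and> Q \<in> \<pi> \<and> Min P < Min Q}. cross_sign P Q)"

lemma pairE:
  assumes "card (P::nat set) = 2"
  obtains a b where "a < b" "P = {a, b}" "Min P = a" "Max P = b"
proof -
  obtain a b where "P = {a, b}" "a \<noteq> b" using assms by (auto simp: card_2_iff)
  then show thesis using that[of a b] that[of b a]
    by (cases "a < b") (auto simp: insert_commute)
qed

lemma cross_sign_commute:
  assumes "card P = 2" "card Q = 2" "P \<inter> Q = {}"
  shows "cross_sign P Q = cross_sign Q P"
proof -
  obtain a b where P: "a < b" "P = {a, b}" "Min P = a" "Max P = b" using assms(1) by (rule pairE)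
  obtain c d where Q: "c < d" "Q = {c, d}" "Min Q = c" "Max Q = d" using assms(2) by (rule pairE)
  have "a \<noteq> c" "a \<noteq> d" "b \<noteq> c" "b \<noteq> d" using assms(3) P Q by auto
  then show ?thesis
    unfolding cross_sign_def inside_sign_def P(3,4) Q(3,4) unfolding P(2) Q(2)
    using P(1) Q(1) by auto
qed

lemma pairing_sign_insert:
  assumes fin: "finite \<pi>" and P: "card P = 2"
    and Q: "\<And>Q. Q \<in> \<pi> \<Longrightarrow> card Q = 2 \<and> P \<inter> Q = {}"
  shows "pairing_sign (insert P \<pi>) = (\<Prod>Q\<in>\<pi>. cross_sign Q P) * pairing_sign \<pi>"
proof -
  define I where "I \<rho> = {(P, Q). P \<in> \<rho> \<and> Q \<in> \<rho> \<and> Min P < Min (Q::nat set)}" for \<rho>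
  define h where "h Q = (if Min Q < Min P then (Q, P) else (P, Q))" for Q
  have PP: "P \<notin> \<pi>" using Q P by fastforce
  have ne: "P \<noteq> {}" "finite P" using P by (auto simp: card_2_iff)
  have M: "Min Q \<noteq> Min P" if "Q \<in> \<pi>" for Q
  proof -
    have "Q \<noteq> {}" "finite Q" using Q[OF that] by (auto simp: card_2_iff)
    then show ?thesis using Q[OF that] ne by (metis Min_in disjoint_iff)
  qed
  have I: "I (insert P \<pi>) = I \<pi> \<union> h ` \<pi>"
  proof -
    have "\<not> Min Q < Min P \<longleftrightarrow> Min P < Min Q" if "Q \<in> \<pi>" for Q using M[OF that] by auto
    then show ?thesis by (auto simp: I_def h_def image_iff)
  qed
  have "finite (I \<pi>)" using fin by (auto simp: I_def intro: finite_subset[of _ "\<pi> \<times> \<pi>"])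
  moreover have "I \<pi> \<inter> h ` \<pi> = {}" using PP by (auto simp: I_def h_def split: if_splits)
  ultimately have "pairing_sign (insert P \<pi>) =
      pairing_sign \<pi> * (\<Prod>(P, Q)\<in>h ` \<pi>. cross_sign P Q)"
    unfolding pairing_sign_def I_def[symmetric] I using fin by (intro prod.union_disjoint) auto
  also have "(\<Prod>(P, Q)\<in>h ` \<pi>. cross_sign P Q) = (\<Prod>Q\<in>\<pi>. case h Q of (P, Q) \<Rightarrow> cross_sign P Q)"
    using PP by (intro prod.reindex_cong[OF _ refl refl])
      (auto simp: inj_on_def h_def split: if_splits)
  also have "\<dots> = (\<Prod>Q\<in>\<pi>. cross_sign Q P)"
    using Q P cross_sign_commute[of P] by (intro prod.cong) (auto simp: h_def)
  finally show ?thesis by simp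
qed

text \<open>The zero diagonal blocks of the matrix are moved into the coefficient, so that the sums
  below can be written with the full response matrix.\<close>

definition tripartite_sign :: "(nat \<Rightarrow> nat) \<Rightarrow> nat set set \<Rightarrow> real" where
  "tripartite_sign col \<pi> = (if \<forall>P\<in>\<pi>. inj_on col P then pairing_sign \<pi> else 0)"

lemma tripartite_sign_empty [simp]: "tripartite_sign col {} = 1"
  by (simp add: tripartite_sign_def pairing_sign_def)

lemma tripartite_sign_insert:
  assumes "finite \<pi>" "card P = 2" "\<And>Q. Q \<in> \<pi> \<Longrightarrow> card Q = 2 \<and> P \<inter> Q = {}"
  shows "tripartite_sign col (insert P \<pi>) =
    of_bool (inj_on col P) * (\<Prod>Q\<in>\<pi>. cross_sign Q P) * tripartite_sign col \<pi>"
  using pairing_sign_insert[OF assms] by (simp add: tripartite_sign_def)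

text \<open>For sorted points the three products are the pairings of four points, the middle one
  being the crossing one. Four weakly increasing colors out of three have two equal neighbours; this
  kills one term and makes the other two cancel. Monotonicity is essential: if only \<open>a\<close>
  and \<open>j\<close> agreed, the two remaining terms would add up.\<close>

lemma four_point_relation:
  fixes col :: "nat \<Rightarrow> nat"
  assumes m: "col a \<le> col i" "col i \<le> col j" "col j \<le> col k" "col k \<le> 2"
  shows "of_bool (col a \<noteq> col i) * of_bool (col j \<noteq> col k)
     - of_bool (col a \<noteq> col j) * of_bool (col i \<noteq> col k)
     + of_bool (col a \<noteq> col k) * of_bool (col i \<noteq> col j) = (0::real)"
  using m by (cases "col a = col i"; cases "col i = col j"; cases "col j = col k") auto

text \<open>
  Exactly the pairings of four points that avoid monochromatic pairs contribute: two of them, one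
  crossing and one not, or none.
\<close>

lemma tripartite_sign_three_term:
  assumes a: "a < i" "a < j" "a < k" and d: "distinct [i, j, k]"
    and col: "mono_on {a, i, j, k} col" "\<And>x. x \<in> {a, i, j, k} \<Longrightarrow> col x \<le> 2"
    and \<rho>: "finite \<rho>" "\<And>Q. Q \<in> \<rho> \<Longrightarrow> card Q = 2 \<and> {a, i, j, k} \<inter> Q = {}"
  shows "tripartite_sign col (insert {a, i} (insert {j, k} \<rho>)) +
    tripartite_sign col (insert {a, j} (insert {i, k} \<rho>)) +
    tripartite_sign col (insert {a, k} (insert {i, j} \<rho>)) = 0"
proof -
  \<comment> \<open>Everything that does not depend on how the four points are paired: the sign of
    \<open>\<rho>\<close> and the position of each of the four points relative to each chord of
    \<open>\<rho>\<close>.\<close>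
  define c where "c = (\<Prod>Q\<in>\<rho>. \<Prod>p\<in>{a, i, j, k}. inside_sign p Q) * tripartite_sign col \<rho>"
  \<comment> \<open>The coefficient of the four points alone. As \<open>a\<close> is the least, a
    point lies inside the chord \<open>{a, x}\<close> exactly if it is smaller than
    \<open>x\<close>.\<close>
  define t where "t x y z = of_bool (col a \<noteq> col x) * of_bool (col y \<noteq> col z) *
    (if y < x then -1 else 1) * (if z < x then -1 else (1::real))" for x y z
  have one: "tripartite_sign col (insert {a, x} (insert {y, z} \<rho>)) = t x y z * c"
    if s: "{x, y, z} = {i, j, k}" "distinct [x, y, z]" for x y z
  proof -
    have sub: "{a, x, y, z} = {a, i, j, k}" using s by auto
    then have \<rho>': "Q \<in> \<rho> \<Longrightarrow> card Q = 2 \<and> {a, x, y, z} \<inter> Q = {}" for Q using \<rho>(2) by simp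
    have "\<forall>v\<in>{x, y, z}. a < v" unfolding s(1) using a by simp
    then have ax: "a < x" "a < y" "a < z" by simp_all
    have cp: "card {a, x} = 2" "card {y, z} = 2" using ax s(2) by auto
    have dis: "{a, x} \<inter> {y, z} = {}" using ax s(2) by auto
    have yz: "{y, z} \<notin> \<rho>" using \<rho>' by fastforce
    have 1: "tripartite_sign col (insert {y, z} \<rho>) =
        of_bool (inj_on col {y, z}) * (\<Prod>Q\<in>\<rho>. cross_sign Q {y, z}) * tripartite_sign col \<rho>"
      using \<rho>' cp by (intro tripartite_sign_insert \<rho>) auto
    have "tripartite_sign col (insert {a, x} (insert {y, z} \<rho>)) =
        of_bool (inj_on col {a, x}) * (\<Prod>Q\<in>insert {y, z} \<rho>. cross_sign Q {a, x}) *
        tripartite_sign col (insert {y, z} \<rho>)"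
      using \<rho>' cp dis \<rho>(1) by (intro tripartite_sign_insert) auto
    also have "(\<Prod>Q\<in>insert {y, z} \<rho>. cross_sign Q {a, x}) =
        cross_sign {y, z} {a, x} * (\<Prod>Q\<in>\<rho>. cross_sign Q {a, x})"
      using yz \<rho>(1) by simp
    finally have "tripartite_sign col (insert {a, x} (insert {y, z} \<rho>)) =
      of_bool (inj_on col {a, x}) * of_bool (inj_on col {y, z}) * cross_sign {y, z} {a, x} *
      ((\<Prod>Q\<in>\<rho>. cross_sign Q {a, x} * cross_sign Q {y, z}) * tripartite_sign col \<rho>)"
      unfolding 1 by (simp add: prod.distrib mult_ac)
    also have "(\<Prod>Q\<in>\<rho>. cross_sign Q {a, x} * cross_sign Q {y, z}) =
        (\<Prod>Q\<in>\<rho>. \<Prod>p\<in>{a, x, y, z}. inside_sign p Q)"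
    proof (rule prod.cong[OF refl])
      fix Q assume Q: "Q \<in> \<rho>"
      have "cross_sign Q {a, x} = cross_sign {a, x} Q" "cross_sign Q {y, z} = cross_sign {y, z} Q"
        using \<rho>'[OF Q] cp by (auto intro!: cross_sign_commute)
      then show "cross_sign Q {a, x} * cross_sign Q {y, z} = (\<Prod>p\<in>{a, x, y, z}. inside_sign p Q)"
        using ax s(2) by (simp add: cross_sign_def mult_ac)
    qed
    also have "\<dots> * tripartite_sign col \<rho> = c" unfolding c_def sub ..
    also have "of_bool (inj_on col {a, x}) * of_bool (inj_on col {y, z}) * cross_sign {y, z} {a, x} = t x y z"
      using ax s(2) by (auto simp: t_def cross_sign_def inside_sign_def)
    finally show ?thesis .
  qed
  have mono: "col x \<le> col y" if "x \<in> {a, i, j, k}" "y \<in> {a, i, j, k}" "x \<le> y" for x y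
    using col(1) that by (auto simp: mono_on_def)
  have sorted: "t x y z + t y x z + t z x y = 0"
    if s: "{x, y, z} \<subseteq> {i, j, k}" "x < y" "y < z" for x y z
  proof -
    have "x \<in> {i, j, k}" using s(1) by simp
    then have "a < x" using a by auto
    then have "of_bool (col a \<noteq> col x) * of_bool (col y \<noteq> col z)
     - of_bool (col a \<noteq> col y) * of_bool (col x \<noteq> col z)
     + of_bool (col a \<noteq> col z) * of_bool (col x \<noteq> col y) = (0::real)"
      using s mono[of a x] mono[of x y] mono[of y z] col(2)[of z]
      by (intro four_point_relation) auto
    then show ?thesis using s(2,3) by (simp add: t_def)
  qed
  have sym: "t x y z = t x z y" for x y z
    by (auto simp: t_def)
  consider "i < j" "j < k" | "i < k" "k < j" | "j < i" "i < k" | "j < k" "k < i"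
    | "k < i" "i < j" | "k < j" "j < i"
    using d by fastforce
  then have "t i j k + t j i k + t k i j = 0"
  proof cases
    case 1 then show ?thesis using sorted[of i j k] by simp
  next
    case 2 then show ?thesis using sorted[of i k j] sym by (simp add: ac_simps)
  next
    case 3 then show ?thesis using sorted[of j i k] sym by (simp add: ac_simps)
  next
    case 4 then show ?thesis using sorted[of j k i] sym by (simp add: ac_simps)
  next
    case 5 then show ?thesis using sorted[of k i j] sym by (simp add: ac_simps)
  next
    case 6 then show ?thesis using sorted[of k j i] sym by (simp add: ac_simps)
  qed
  then have "(t i j k + t j i k + t k i j) * c = 0" by simp
  then show ?thesis
    using one[of i j k] one[of j i k] one[of k i j] d
    by (simp add: insert_commute distrib_right)
qed

section \<open>Pairings and expansion along the first row\<close>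

lemma pairings_split:
  assumes A: "finite A" "a \<in> A"
  shows "bij_betw (\<lambda>(j, \<pi>). insert {a, j} \<pi>) (SIGMA j:A - {a}. pairings (A - {a, j})) (pairings A)"
proof (rule bij_betwI')
  fix p q
  assume "p \<in> (SIGMA j:A - {a}. pairings (A - {a, j}))" "q \<in> (SIGMA j:A - {a}. pairings (A - {a, j}))"
  then obtain i \<pi> j \<rho> where p: "p = (i, \<pi>)" "i \<in> A - {a}" "\<pi> \<in> pairings (A - {a, i})"
    and q: "q = (j, \<rho>)" "j \<in> A - {a}" "\<rho> \<in> pairings (A - {a, j})" by auto
  have np: "\<forall>Q\<in>\<pi>. a \<notin> Q" "\<forall>Q\<in>\<rho>. a \<notin> Q"
    using p q by (auto simp: pairings_def partition_on_def)
  show "(case p of (j, \<pi>) \<Rightarrow> insert {a, j} \<pi>) = (case q of (j, \<pi>) \<Rightarrow> insert {a, j} \<pi>) \<longleftrightarrow> p = q"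
  proof
    assume eq: "(case p of (j, \<pi>) \<Rightarrow> insert {a, j} \<pi>) = (case q of (j, \<pi>) \<Rightarrow> insert {a, j} \<pi>)"
    then have ins: "insert {a, i} \<pi> = insert {a, j} \<rho>" using p q by simp
    then have "{a, i} \<in> insert {a, j} \<rho>" by (metis insertI1)
    then have "{a, i} = {a, j}" using np by auto
    then have ij: "i = j" by (auto simp: doubleton_eq_iff)
    moreover have "{a, i} \<notin> \<pi>" "{a, i} \<notin> \<rho>" using np by auto
    then have "\<pi> = \<rho>" using ins ij by (metis insert_ident)
    ultimately show "p = q" using p q by simp
  qed simp
next
  fix p assume "p \<in> (SIGMA j:A - {a}. pairings (A - {a, j}))"
  then obtain j \<pi> where p: "p = (j, \<pi>)" "j \<in> A - {a}" "\<pi> \<in> pairings (A - {a, j})" by auto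
  have \<pi>: "\<Union>\<pi> = A - {a, j}" "disjoint \<pi>" "{} \<notin> \<pi>"
    using p by (auto simp: pairings_def partition_on_def)
  have "{a, j} \<inter> Q = {}" if "Q \<in> \<pi>" for Q using \<pi>(1) that by blast
  then have "disjoint (insert {a, j} \<pi>)" using \<pi>(2) by (auto simp: disjoint_def)
  moreover have "\<Union>(insert {a, j} \<pi>) = A" using \<pi>(1) A p by auto
  ultimately show "(case p of (j, \<pi>) \<Rightarrow> insert {a, j} \<pi>) \<in> pairings A"
    using p \<pi>(3) by (auto simp: pairings_def partition_on_def)
next
  fix \<pi> assume \<pi>: "\<pi> \<in> pairings A"
  then have "a \<in> \<Union>\<pi>" using A by (auto simp: pairings_def partition_on_def)
  then obtain P where P: "P \<in> \<pi>" "a \<in> P" by blast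
  then have "card P = 2" using \<pi> by (auto simp: pairings_def)
  then obtain j where j: "P = {a, j}" "j \<noteq> a" using P(2) by (auto simp: card_2_iff)
  have "partition_on A \<pi>" using \<pi> by (simp add: pairings_def)
  then have "partition_on (A - P) (\<pi> - {P})"
    using P(1) by (auto simp: partition_on_def disjoint_def)
  then have m: "(j, \<pi> - {P}) \<in> (SIGMA j:A - {a}. pairings (A - {a, j}))"
    using \<pi> P j by (auto simp: pairings_def partition_on_def)
  have "insert {a, j} (\<pi> - {P}) = \<pi>" using P j by auto
  then show "\<exists>p\<in>(SIGMA j:A - {a}. pairings (A - {a, j})). \<pi> = (case p of (j, \<pi>) \<Rightarrow> insert {a, j} \<pi>)"
    by (intro bexI[OF _ m]) simp
qed

lemma finite_pairings: "finite A \<Longrightarrow> finite (pairings A)"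
  by (rule finite_subset[of _ "Pow (Pow A)"]) (auto simp: pairings_def partition_on_def)

lemma pairings_finite: "finite A \<Longrightarrow> \<pi> \<in> pairings A \<Longrightarrow> finite \<pi>"
  by (auto simp: pairings_def partition_on_def intro: finite_UnionD)

text \<open>The sign is -1 to the number of elements of \<open>A\<close> strictly between
  \<open>a\<close> and \<open>j\<close>; for the least element \<open>a\<close> this is the usual
  sign in the expansion of a Pfaffian along its first row.\<close>

definition row_sign :: "(nat \<Rightarrow> nat) \<Rightarrow> nat set \<Rightarrow> nat \<Rightarrow> nat \<Rightarrow> real" where
  "row_sign col A a j = of_bool (col a \<noteq> col j) * (\<Prod>i\<in>A - {a, j}. inside_sign i {a, j})"

text \<open>A point between \<open>a\<close> and \<open>j\<close> contributes its factor through
  whichever pair contains it, so the sign of the crossings of \<open>{a, j}\<close> with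
  \<open>\<pi>\<close> depends only on \<open>A\<close>, \<open>a\<close> and
  \<open>j\<close>.\<close>

lemma tripartite_sign_first_pair:
  assumes A: "finite A" "a \<in> A" "j \<in> A - {a}" and \<pi>: "finite \<pi>" "disjoint \<pi>"
    "\<And>Q. Q \<in> \<pi> \<Longrightarrow> card Q = 2" "\<Union>\<pi> = A - {a, j}"
  shows "tripartite_sign col (insert {a, j} \<pi>) = row_sign col A a j * tripartite_sign col \<pi>"
proof -
  have "(\<Prod>Q\<in>\<pi>. cross_sign Q {a, j}) = (\<Prod>i\<in>\<Union>\<pi>. inside_sign i {a, j})"
    unfolding cross_sign_def using \<pi> A(1)
    by (subst prod.Union_disjoint) (auto simp: disjoint_def intro: card_ge_0_finite)
  moreover have "tripartite_sign col (insert {a, j} \<pi>) = of_bool (inj_on col {a, j}) *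
      (\<Prod>Q\<in>\<pi>. cross_sign Q {a, j}) * tripartite_sign col \<pi>"
    using \<pi> A by (intro tripartite_sign_insert) auto
  moreover have "inj_on col {a, j} \<longleftrightarrow> col a \<noteq> col j" using A by auto
  ultimately show ?thesis using \<pi>(4) by (simp add: row_sign_def)
qed

definition pairing_sum :: "(nat \<Rightarrow> nat) \<Rightarrow> (nat \<Rightarrow> nat \<Rightarrow> real) \<Rightarrow> nat set \<Rightarrow> real" where
  "pairing_sum col L A = (\<Sum>\<pi>\<in>pairings A. tripartite_sign col \<pi> * (\<Prod>P\<in>\<pi>. L (Min P) (Max P)))"

lemma pairing_sum_empty: "pairing_sum col L {} = 1"
proof -
  have "pairings {} = {{}}" by (auto simp: pairings_def partition_on_def)
  then show ?thesis by (simp add: pairing_sum_def)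
qed

text \<open>As \<open>a\<close> is least, it is the smaller end of its pair, and the entry used is
  \<open>L a j\<close>, from the row of \<open>a\<close>.\<close>

lemma pairing_sum_expand:
  assumes A: "finite A" "a \<in> A" "\<And>i. i \<in> A \<Longrightarrow> a \<le> i"
  shows "pairing_sum col L A = (\<Sum>j\<in>A - {a}. L a j * row_sign col A a j * pairing_sum col L (A - {a, j}))"
proof -
  let ?t = "\<lambda>\<pi>. tripartite_sign col \<pi> * (\<Prod>P\<in>\<pi>. L (Min P) (Max P))"
  have "pairing_sum col L A = (\<Sum>(j, \<pi>)\<in>(SIGMA j:A - {a}. pairings (A - {a, j})). ?t (insert {a, j} \<pi>))"
    unfolding pairing_sum_def
    by (subst sum.reindex_bij_betw[OF pairings_split[OF A(1,2)], symmetric])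
      (simp add: case_prod_beta)
  also have "\<dots> = (\<Sum>j\<in>A - {a}. \<Sum>\<pi>\<in>pairings (A - {a, j}). ?t (insert {a, j} \<pi>))"
    using A by (subst sum.Sigma) (auto intro: finite_pairings)
  also have "\<dots> = (\<Sum>j\<in>A - {a}. L a j * row_sign col A a j * pairing_sum col L (A - {a, j}))"
    unfolding pairing_sum_def sum_distrib_left
  proof (intro sum.cong refl)
    fix j \<pi> assume j: "j \<in> A - {a}" and \<pi>: "\<pi> \<in> pairings (A - {a, j})"
    have fin: "finite \<pi>" using \<pi> A by (intro pairings_finite[of "A - {a, j}"]) auto
    have p: "partition_on (A - {a, j}) \<pi>" "\<forall>P\<in>\<pi>. card P = 2" using \<pi> by (auto simp: pairings_def)
    have 1: "tripartite_sign col (insert {a, j} \<pi>) = row_sign col A a j * tripartite_sign col \<pi>"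
      using p fin by (intro tripartite_sign_first_pair[OF A(1,2) j]) (auto simp: partition_on_def)
    have "{a, j} \<notin> \<pi>" using p by (auto simp: partition_on_def)
    moreover have "a < j" using A(3)[of j] j by auto
    then have "Min {a, j} = a" "Max {a, j} = j" by auto
    ultimately have "(\<Prod>P\<in>insert {a, j} \<pi>. L (Min P) (Max P)) = L a j * (\<Prod>P\<in>\<pi>. L (Min P) (Max P))"
      using fin by simp
    then show "?t (insert {a, j} \<pi>) = L a j * row_sign col A a j * ?t \<pi>" using 1 by simp
  qed
  finally show ?thesis .
qed

section \<open>Signed grove sums\<close>

definition pairs_of :: "nat set set \<Rightarrow> nat set set" where
  "pairs_of \<tau> = {Q \<in> \<tau>. card Q = 2}"

text \<open>The nodes outside \<open>X\<close> are required to be isolated rather than ignored: the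
  recursion takes \<open>a\<close> and \<open>j\<close> out of \<open>A\<close>, and they stay in
  the network as singletons.\<close>

definition paired_on :: "nat set \<Rightarrow> nat set set \<Rightarrow> bool" where
  "paired_on X \<tau> \<longleftrightarrow> (\<forall>Q\<in>\<tau>. card Q = 2 \<and> Q \<subseteq> X \<or> card Q = 1 \<and> Q \<inter> X = {})"

text \<open>If \<open>\<tau>\<close> is a partition of the nodes, the condition also makes the node
  \<open>a\<close> a singleton, since \<open>a\<close> is outside \<open>A - {a, j}\<close>. Then
  \<open>insert a P\<close> is the pair \<open>{a, j}\<close> that appears when the two trees are
  joined, and the sign is already that of the completed pairing.\<close>

definition pairing_mark :: "(nat \<Rightarrow> nat) \<Rightarrow> nat set \<Rightarrow> nat \<Rightarrow> nat set set \<Rightarrow> nat set \<Rightarrow> real" where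
  "pairing_mark col A a \<tau> P =
    (if \<exists>j\<in>A - {a}. P = {j} \<and> paired_on (A - {a, j}) \<tau>
     then tripartite_sign col (insert (insert a P) (pairs_of \<tau>)) else 0)"

text \<open>The right-hand side is symmetric in \<open>i\<close>, \<open>j\<close>,
  \<open>k\<close>. Hence in the three-term relation for the mark the side conditions hold for all
  three terms or for none.\<close>

lemma paired_on_refine:
  assumes d: "distinct [i, j, k]" and \<tau>: "\<Union>\<tau> \<inter> {i, j, k} = {}"
  shows "i \<in> A - {a} \<and> paired_on (A - {a, i}) (\<tau> \<union> {{i}, {j, k}}) \<longleftrightarrow>
    {i, j, k} \<subseteq> A - {a} \<and> paired_on (A - {a, i, j, k}) \<tau>"
proof -
  have "(card Q = 2 \<and> Q \<subseteq> A - {a, i} \<or> card Q = 1 \<and> Q \<inter> (A - {a, i}) = {}) \<longleftrightarrow>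
    (card Q = 2 \<and> Q \<subseteq> A - {a, i, j, k} \<or> card Q = 1 \<and> Q \<inter> (A - {a, i, j, k}) = {})"
    if "Q \<in> \<tau>" for Q
  proof -
    have "i \<notin> Q" "j \<notin> Q" "k \<notin> Q" using \<tau> that by auto
    then show ?thesis by blast
  qed
  then have "paired_on (A - {a, i}) \<tau> \<longleftrightarrow> paired_on (A - {a, i, j, k}) \<tau>"
    by (simp add: paired_on_def)
  moreover have "paired_on (A - {a, i}) (\<tau> \<union> {{i}, {j, k}}) \<longleftrightarrow>
      {j, k} \<subseteq> A - {a, i} \<and> paired_on (A - {a, i}) \<tau>"
    using d by (auto simp: paired_on_def)
  moreover have "i \<in> A - {a} \<and> {j, k} \<subseteq> A - {a, i} \<longleftrightarrow> {i, j, k} \<subseteq> A - {a}"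
    using d by auto
  ultimately show ?thesis by blast
qed

text \<open>By \<open>paired_on_refine\<close> the three marks are switched on together, and then
  the sum is \<open>tripartite_sign_three_term\<close> with the pairs of \<open>\<tau>\<close> as
  surrounding pairing. That \<open>a\<close> is least in \<open>A\<close> places it before
  \<open>i\<close>, \<open>j\<close> and \<open>k\<close>.\<close>

lemma admissible_pairing_mark:
  assumes A: "finite A" "\<And>i. i \<in> A \<Longrightarrow> a \<le> i" "a \<in> A"
    and col: "mono_on A col" "\<And>i. i \<in> A \<Longrightarrow> col i \<le> 2"
  shows "admissible_mark (pairing_mark col A a)"
  unfolding admissible_mark_def
proof (intro conjI allI impI)
  fix \<tau> P assume "pairing_mark col A a \<tau> P \<noteq> 0"
  then obtain j where j: "P = {j}" "paired_on (A - {a, j}) \<tau>"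
    by (auto simp: pairing_mark_def split: if_splits)
  then show "card P = 1" "\<forall>Q\<in>\<tau>. card Q \<le> 2" by (auto simp: paired_on_def)
next
  fix \<tau> :: "nat set set" and i j k assume asm: "distinct [i, j, k] \<and> \<Union>\<tau> \<inter> {i, j, k} = {}"
  have one: "pairing_mark col A a (\<tau> \<union> {{x}, {y, z}}) {x} =
    (if {i, j, k} \<subseteq> A - {a} \<and> paired_on (A - {a, i, j, k}) \<tau>
     then tripartite_sign col (insert {a, x} (insert {y, z} (pairs_of \<tau>))) else 0)"
    if s: "{x, y, z} = {i, j, k}" "distinct [x, y, z]" for x y z
  proof -
    have "pairs_of (\<tau> \<union> {{x}, {y, z}}) = insert {y, z} (pairs_of \<tau>)"
      using s(2) by (auto simp: pairs_of_def)
    moreover have "(\<exists>j\<in>A - {a}. {x} = {j} \<and> paired_on (A - {a, j}) (\<tau> \<union> {{x}, {y, z}})) \<longleftrightarrow>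
        {x, y, z} \<subseteq> A - {a} \<and> paired_on (A - {a, x, y, z}) \<tau>"
      using paired_on_refine[OF s(2), of \<tau> A a] asm s(1) by auto
    moreover have "{a, x, y, z} = {a, i, j, k}" using s(1) by simp
    ultimately show ?thesis unfolding pairing_mark_def using s(1) by simp
  qed
  have d: "distinct [j, i, k]" "distinct [k, i, j]" and perm: "{j, i, k} = {i, j, k}" "{k, i, j} = {i, j, k}"
    using asm by auto
  have "tripartite_sign col (insert {a, i} (insert {j, k} (pairs_of \<tau>))) +
    tripartite_sign col (insert {a, j} (insert {i, k} (pairs_of \<tau>))) +
    tripartite_sign col (insert {a, k} (insert {i, j} (pairs_of \<tau>))) = 0"
    if C: "{i, j, k} \<subseteq> A - {a}" "paired_on (A - {a, i, j, k}) \<tau>"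
  proof (rule tripartite_sign_three_term)
    have le: "a \<le> i" "a \<le> j" "a \<le> k" using C(1) A(2) by auto
    moreover have "i \<noteq> a" "j \<noteq> a" "k \<noteq> a" using C(1) by auto
    ultimately show "a < i" "a < j" "a < k" by simp_all
    have sub: "{a, i, j, k} \<subseteq> A" using C(1) A(3) by auto
    then show "mono_on {a, i, j, k} col" using col(1) by (rule monotone_on_subset[rotated])
    show "col x \<le> 2" if "x \<in> {a, i, j, k}" for x using col(2) that sub by blast
    show "distinct [i, j, k]" using asm by simp
    have pq: "card Q = 2 \<and> Q \<subseteq> A - {a, i, j, k}" if "Q \<in> pairs_of \<tau>" for Q
    proof -
      have "Q \<in> \<tau>" "card Q = 2" using that by (simp_all add: pairs_of_def)
      moreover from this have "card Q \<noteq> 1" by simp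
      ultimately show ?thesis using C(2) unfolding paired_on_def by blast
    qed
    then have "pairs_of \<tau> \<subseteq> Pow A" by blast
    then show "finite (pairs_of \<tau>)" using A(1) finite_subset[of _ "Pow A"] by simp
    show "card Q = 2 \<and> {a, i, j, k} \<inter> Q = {}" if "Q \<in> pairs_of \<tau>" for Q
      using pq[OF that] by blast
  qed
  then show "pairing_mark col A a (\<tau> \<union> {{i}, {j, k}}) {i} +
    pairing_mark col A a (\<tau> \<union> {{j}, {i, k}}) {j} +
    pairing_mark col A a (\<tau> \<union> {{k}, {i, j}}) {k} = 0"
    unfolding one[of i j k, OF refl conjunct1[OF asm]] one[of j i k, OF perm(1) d(1)]
      one[of k i j, OF perm(2) d(2)] by simp
qed

section \<open>Recursion for the signed grove sums\<close>

context conductance_network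
begin

definition grove_pairing_sum :: "(nat \<Rightarrow> nat) \<Rightarrow> nat set \<Rightarrow> real" where
  "grove_pairing_sum col A = (\<Sum>K\<in>groves G. grove_weight G K *
    (if paired_on A (node_partition G K) then tripartite_sign col (pairs_of (node_partition G K)) else 0))"

lemma grove_pairing_sum_empty: "grove_pairing_sum col {} = partition_weight all_singletons"
proof -
  have "paired_on {} (node_partition G K) \<longleftrightarrow> node_partition G K = all_singletons" for K
  proof
    assume p: "paired_on {} (node_partition G K)"
    have "nodes_in G K (node G i) = {i}" if i: "i \<in> node_labels G" for i
    proof -
      have "nodes_in G K (node G i) \<in> node_partition G K" using i by (auto simp: node_partition_altdef)
      then have "card (nodes_in G K (node G i)) = 1" using p unfolding paired_on_def by fastforce
      then show ?thesis using nodes_in_node_mem[OF i, of K] by (auto simp: card_1_singleton_iff)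
    qed
    then show "node_partition G K = all_singletons"
      by (simp add: node_partition_altdef all_singletons_def)
  qed (auto simp: paired_on_def all_singletons_def)
  moreover have "pairs_of all_singletons = {}" by (auto simp: pairs_of_def all_singletons_def)
  ultimately have "grove_pairing_sum col {} = (\<Sum>K\<in>groves G. if node_partition G K = all_singletons
      then grove_weight G K else 0)"
    unfolding grove_pairing_sum_def by (intro sum.cong) auto
  then show ?thesis using finite_groves by (simp add: partition_weight_def sum.inter_filter)
qed

text \<open>For each grove \<open>K\<close>, look at the cuts at \<open>a\<close>. The half that
  contains \<open>a\<close> never has a non-zero mark, and the half cut off has one only if it holds
  a single node \<open>j\<close> and \<open>a\<close> is left alone, i.e. if the nodes in the tree
  of \<open>a\<close> were just \<open>a\<close> and \<open>j\<close>. Exactly one edge at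
  \<open>a\<close> leads to \<open>j\<close>, so each such grove is counted once, with the sign of
  its own pairing.\<close>

lemma current_pairing_mark:
  assumes A: "A \<subseteq> node_labels G" "a \<in> A"
  shows "current G (marked_sum (pairing_mark col A a)) (node G a) = grove_pairing_sum col A"
  unfolding current_marked_sum grove_pairing_sum_def
proof (intro sum.cong refl arg_cong[of _ _ "\<lambda>x. _ * x"])
  fix K assume K: "K \<in> groves G"
  then have fK: "forest G K" by (simp add: groves_def)
  define u where "u = node G a"
  define U where "U = nodes_in G K u"
  define E where "E = {e\<in>K. u \<in> ends G e \<and> K - {e} \<in> groves G}"
  define \<tau> where "\<tau> = node_partition G K - {U}"
  have aN: "a \<in> node_labels G" using A by auto
  have aU: "a \<in> U" "U \<in> node_partition G K"
    using nodes_in_node_mem[OF aN] nodes_in_mem_partition[of G K u] by (auto simp: U_def u_def)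
  then have part: "node_partition G K = insert U \<tau>" by (auto simp: \<tau>_def)
  have \<tau>U: "Q \<inter> U = {}" if "Q \<in> \<tau>" for Q
    using that aU partition_on_node_partition[of G K]
    unfolding \<tau>_def partition_on_def disjoint_def by blast
  have self: "{i \<in> node_labels G. node G i = u} = {a}"
    using aN node_inj by (auto simp: u_def)
  have Ub: "U = {a} \<union> (\<Union>e\<in>{e\<in>K. u \<in> ends G e}. branch K u e)"
    unfolding U_def nodes_in_branches[OF fK] self ..
  have e: "a \<notin> branch K u e" "e \<in> E \<longleftrightarrow> branch K u e \<noteq> {}"
    "branch K u e \<noteq> {} \<Longrightarrow> node_partition G (K - {e}) = \<tau> \<union> {branch K u e, U - branch K u e}"
    if e: "e \<in> K" "u \<in> ends G e" for e
  proof -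
    have ee: "e \<in> edges G" using e K groves_subset by auto
    note ends = ends_opp[OF ee e(2)]
    have 1: "nodes_in G (K - {e}) u = U - branch K u e"
      using nodes_in_remove_Un[OF fK e(1) ends] nodes_in_remove_disjoint[OF fK e(1) ends]
      by (auto simp: U_def branch_def)
    show 2: "a \<notin> branch K u e" using branch_not_self[OF fK e] by (auto simp: u_def)
    then have 3: "nodes_in G (K - {e}) u \<noteq> {}" using 1 aU by auto
    show "e \<in> E \<longleftrightarrow> branch K u e \<noteq> {}"
      using grove_remove_iff[OF fK e(1) ends K] 3 e by (simp add: branch_def E_def)
    show "node_partition G (K - {e}) = \<tau> \<union> {branch K u e, U - branch K u e}"
      if "branch K u e \<noteq> {}"
      using node_partition_remove[OF fK e(1) ends 3] that
      unfolding 1 unfolding branch_def \<tau>_def U_def .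
  qed
  have second: "pairing_mark col A a \<tau>' (nodes_in G (K - {e}) u) = 0" for \<tau>' e
  proof -
    have "a \<in> nodes_in G (K - {e}) u" using nodes_in_node_mem[OF aN] by (simp add: u_def)
    then show ?thesis by (auto simp: pairing_mark_def)
  qed
  have "(\<Sum>e\<in>E. pairing_mark col A a (node_partition G (K - {e})) (branch K u e)) =
    (if paired_on A (node_partition G K) then tripartite_sign col (pairs_of (node_partition G K)) else 0)"
  proof (cases "\<exists>j\<in>A - {a}. U = {a, j}")
    case True
    then obtain j where j: "j \<in> A - {a}" "U = {a, j}" by blast
    then have "j \<in> U" "j \<noteq> a" by auto
    then obtain e where ee: "e \<in> K" "u \<in> ends G e" "j \<in> branch K u e"
      by (subst (asm) Ub) blast
    have bsub: "branch K u f \<subseteq> {j}" if "f \<in> K" "u \<in> ends G f" for f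
    proof -
      have "branch K u f \<subseteq> U" using Ub that by auto
      then show ?thesis using e(1)[OF that] j(2) by auto
    qed
    have be: "branch K u e = {j}" using bsub[OF ee(1,2)] ee(3) by auto
    have "branch K u f = {}" if "f \<in> K" "u \<in> ends G f" "f \<noteq> e" for f
      using bsub[OF that(1,2)] branch_disjoint[OF fK that(1,2) ee(1,2) that(3)] be by auto
    then have "f = e" if "f \<in> E" for f
      using that e(2)[of f] by (auto simp: E_def)
    moreover have "e \<in> E" using e(2)[OF ee(1,2)] ee(3) by auto
    ultimately have "E = {e}" by blast
    moreover have "node_partition G (K - {e}) = \<tau> \<union> {{j}, {a}}"
    proof -
      have "branch K u e \<noteq> {}" using ee(3) by blast
      then have "node_partition G (K - {e}) = \<tau> \<union> {branch K u e, U - branch K u e}"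
        by (rule e(3)[OF ee(1,2)])
      moreover have "U - {j} = {a}" using j by auto
      ultimately show ?thesis unfolding be by simp
    qed
    moreover have "paired_on (A - {a, j}) (\<tau> \<union> {{j}, {a}}) \<longleftrightarrow> paired_on A (insert U \<tau>)"
    proof -
      have "(card Q = 2 \<and> Q \<subseteq> A - {a, j} \<or> card Q = 1 \<and> Q \<inter> (A - {a, j}) = {}) \<longleftrightarrow>
        (card Q = 2 \<and> Q \<subseteq> A \<or> card Q = 1 \<and> Q \<inter> A = {})" if "Q \<in> \<tau>" for Q
      proof -
        have "a \<notin> Q" "j \<notin> Q" using \<tau>U[OF that] j(2) by auto
        then show ?thesis by blast
      qed
      then show ?thesis using j A(2) by (auto simp: paired_on_def)
    qed
    moreover have "insert {a, j} (pairs_of (\<tau> \<union> {{j}, {a}})) = pairs_of (insert U \<tau>)"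
      using j by (auto simp: pairs_of_def)
    ultimately show ?thesis using be j by (auto simp: part pairing_mark_def simp del: Un_insert_right)
  next
    case False
    have "pairing_mark col A a (node_partition G (K - {e})) (branch K u e) = 0" if "e \<in> E" for e
    proof (rule ccontr)
      assume "pairing_mark col A a (node_partition G (K - {e})) (branch K u e) \<noteq> 0"
      then obtain j where j: "j \<in> A - {a}" "branch K u e = {j}"
        "paired_on (A - {a, j}) (node_partition G (K - {e}))"
        by (auto simp: pairing_mark_def split: if_splits)
      have eK: "e \<in> K" "u \<in> ends G e" using that by (auto simp: E_def)
      then have jU: "j \<in> U" using Ub j(2) by blast
      have "U - {j} \<in> node_partition G (K - {e})" using e(3)[OF eK] j(2) by simp
      then have "card (U - {j}) = 1"
        using j(3,1) aU(1) unfolding paired_on_def by fastforce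
      then obtain v where v: "U - {j} = {v}" by (rule card_1_singletonE)
      have "a \<in> U - {j}" using aU(1) j(1) by simp
      then have "U - {j} = {a}" unfolding v by simp
      then have "U = {a, j}" using jU by blast
      then show False using False j(1) by blast
    qed
    moreover have "\<not> paired_on A (node_partition G K)"
    proof
      assume "paired_on A (node_partition G K)"
      then have "card U = 2 \<and> U \<subseteq> A" using aU A(2) unfolding paired_on_def by blast
      then obtain j where "U = {a, j}" "j \<noteq> a" "j \<in> A" using aU(1) by (auto simp: card_2_iff)
      then show False using False by blast
    qed
    ultimately show ?thesis by simp
  qed
  then show "(\<Sum>e\<in>{e\<in>K. node G a \<in> ends G e \<and> K - {e} \<in> groves G}.
      pairing_mark col A a (node_partition G (K - {e})) (branch K (node G a) e) -
      pairing_mark col A a (node_partition G (K - {e})) (nodes_in G (K - {e}) (node G a))) =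
    (if paired_on A (node_partition G K) then tripartite_sign col (pairs_of (node_partition G K)) else 0)"
    unfolding u_def[symmetric] E_def[symmetric] second by simp
qed

lemma paired_on_pairs_Union:
  assumes "paired_on X (node_partition G K)" "X \<subseteq> node_labels G"
  shows "\<Union>(pairs_of (node_partition G K)) = X"
proof (intro equalityI subsetI)
  fix x assume "x \<in> \<Union>(pairs_of (node_partition G K))"
  then show "x \<in> X" using assms(1) by (auto simp: pairs_of_def paired_on_def)
next
  fix x assume x: "x \<in> X"
  then have "nodes_in G K (node G x) \<in> node_partition G K" "x \<in> nodes_in G K (node G x)"
    using assms(2) nodes_in_node_mem by (auto simp: node_partition_altdef)
  then show "x \<in> \<Union>(pairs_of (node_partition G K))"
    using assms(1) x unfolding pairs_of_def paired_on_def by blast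
qed

lemma disjoint_node_partition: "disjoint (node_partition G K)"
  using partition_on_node_partition[of G K] by (simp add: partition_on_def)

lemma finite_node_partition: "finite (node_partition G K)"
  by (simp add: node_partition_altdef)

text \<open>The tree of node \<open>j\<close> contains \<open>j\<close>, so a non-zero mark needs
  the block \<open>{j}\<close>, and the sign of the added pair splits off. The value 0 at
  \<open>a\<close> itself and outside \<open>A\<close> removes the diagonal entry and the unwanted
  columns from the expansion.\<close>

lemma pairing_mark_node:
  assumes A: "A \<subseteq> node_labels G" "a \<in> A" and j: "j \<in> node_labels G"
  shows "marked_sum (pairing_mark col A a) (node G j) =
    (if j \<in> A - {a} then row_sign col A a j * grove_pairing_sum col (A - {a, j}) else 0)"
proof (cases "j \<in> A - {a}")
  case False
  have "pairing_mark col A a \<tau> (nodes_in G H (node G j)) = 0" for H \<tau>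
    using nodes_in_node_mem[OF j, of H] False by (auto simp: pairing_mark_def)
  then have "marked_sum (pairing_mark col A a) (node G j) = 0"
    unfolding marked_sum_def by simp
  then show ?thesis unfolding if_not_P[OF False] .
next
  case True
  have fin: "finite A" using finite_subset[OF A(1) finite_node_labels] .
  have "pairing_mark col A a (node_partition G H) (nodes_in G H (node G j)) =
    row_sign col A a j * (if paired_on (A - {a, j}) (node_partition G H)
      then tripartite_sign col (pairs_of (node_partition G H)) else 0)" for H
  proof (cases "paired_on (A - {a, j}) (node_partition G H)")
    case p: True
    have "nodes_in G H (node G j) \<in> node_partition G H" "j \<in> nodes_in G H (node G j)"
      using j nodes_in_node_mem by (auto simp: node_partition_altdef)
    then have "card (nodes_in G H (node G j)) = 1" using p unfolding paired_on_def by blast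
    then have "nodes_in G H (node G j) = {j}"
      using nodes_in_node_mem[OF j, of H] by (auto simp: card_1_singleton_iff)
    then have "pairing_mark col A a (node_partition G H) (nodes_in G H (node G j)) =
        tripartite_sign col (insert {a, j} (pairs_of (node_partition G H)))"
      using True p by (auto simp: pairing_mark_def)
    also have "\<dots> = row_sign col A a j * tripartite_sign col (pairs_of (node_partition G H))"
    proof (rule tripartite_sign_first_pair[OF fin A(2) True])
      show "finite (pairs_of (node_partition G H))"
        using finite_node_partition by (simp add: pairs_of_def)
      show "disjoint (pairs_of (node_partition G H))"
        using disjoint_node_partition by (auto simp: pairs_of_def disjoint_def)
      show "\<Union>(pairs_of (node_partition G H)) = A - {a, j}"
        using p A(1) by (intro paired_on_pairs_Union) auto
    qed (simp add: pairs_of_def)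
    finally show ?thesis using p by simp
  next
    case False
    moreover have "\<not> (\<exists>k\<in>A - {a}. nodes_in G H (node G j) = {k} \<and> paired_on (A - {a, k}) (node_partition G H))"
      using False nodes_in_node_mem[OF j, of H] by auto
    ultimately show ?thesis by (auto simp: pairing_mark_def)
  qed
  then show ?thesis
    using True unfolding marked_sum_def grove_pairing_sum_def sum_distrib_left
    by (simp add: mult.left_commute)
qed

lemma grove_pairing_sum_expand:
  assumes A: "A \<subseteq> node_labels G" "a \<in> A" "\<And>i. i \<in> A \<Longrightarrow> a \<le> i"
    and col: "mono_on A col" "\<And>i. i \<in> A \<Longrightarrow> col i \<le> 2"
  shows "grove_pairing_sum col A = (\<Sum>j\<in>A - {a}.
    response_matrix G a j * row_sign col A a j * grove_pairing_sum col (A - {a, j}))"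
proof -
  let ?F = "marked_sum (pairing_mark col A a)"
  have fin: "finite A" using finite_subset[OF A(1) finite_node_labels] .
  have adm: "admissible_mark (pairing_mark col A a)"
    using admissible_pairing_mark[OF fin A(3,2) col] .
  have aN: "a \<in> node_labels G" using A by auto
  have "grove_pairing_sum col A = current G ?F (node G a)"
    using current_pairing_mark[OF A(1,2)] by simp
  also have "\<dots> = (\<Sum>j\<in>node_labels G. response_matrix G a j * ?F (node G j))"
    using marked_sum_harmonic[OF adm] aN by (rule current_node_harmonic)
  also have "\<dots> = (\<Sum>j\<in>A - {a}. response_matrix G a j * ?F (node G j))"
    using A(1) pairing_mark_node[OF A(1,2)] by (intro sum.mono_neutral_right) auto
  also have "\<dots> = (\<Sum>j\<in>A - {a}.
      response_matrix G a j * row_sign col A a j * grove_pairing_sum col (A - {a, j}))"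
    using A(1) pairing_mark_node[OF A(1,2)] by (intro sum.cong) auto
  finally show ?thesis .
qed

text \<open>Both sides satisfy the same expansion along the least element, so the constant factor is
  the one of the empty set. Passing to subsets keeps the colors weakly increasing.\<close>

lemma grove_pairing_sum_eq:
  assumes "A \<subseteq> node_labels G" "mono_on A col" "\<And>i. i \<in> A \<Longrightarrow> col i \<le> 2"
  shows "grove_pairing_sum col A =
    partition_weight all_singletons * pairing_sum col (response_matrix G) A"
  using assms
proof (induction "card A" arbitrary: A rule: less_induct)
  case less
  have fin: "finite A" using finite_subset[OF less.prems(1) finite_node_labels] .
  show ?case
  proof (cases "A = {}")
    case True
    then show ?thesis by (simp add: grove_pairing_sum_empty pairing_sum_empty)
  next
    case False
    define a where "a = Min A"
    have a: "a \<in> A" "\<And>i. i \<in> A \<Longrightarrow> a \<le> i" using fin False by (auto simp: a_def)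
    have IH: "grove_pairing_sum col (A - {a, j}) =
      partition_weight all_singletons * pairing_sum col (response_matrix G) (A - {a, j})" for j
    proof (rule less.hyps)
      show "card (A - {a, j}) < card A" using fin a(1) by (intro psubset_card_mono) auto
      show "mono_on (A - {a, j}) col" using less.prems(2) by (rule monotone_on_subset) auto
    qed (use less.prems in auto)
    have "grove_pairing_sum col A = (\<Sum>j\<in>A - {a}. response_matrix G a j * row_sign col A a j *
        (partition_weight all_singletons * pairing_sum col (response_matrix G) (A - {a, j})))"
      unfolding IH[symmetric] by (rule grove_pairing_sum_expand[OF less.prems(1) a less.prems(2,3)])
    also have "\<dots> = partition_weight all_singletons * (\<Sum>j\<in>A - {a}.
        response_matrix G a j * row_sign col A a j * pairing_sum col (response_matrix G) (A - {a, j}))"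
      by (simp add: sum_distrib_left mult_ac)
    finally show ?thesis using pairing_sum_expand[OF fin a] by simp
  qed
qed

end

section \<open>Disjoint connections in a planar network\<close>

lemma closure_inside_open_arc:
  fixes S :: "complex set"
  assumes "closed S" "path h" "h ` {0<..<1} \<subseteq> inside S"
  shows "pathstart h \<in> S \<union> inside S" "pathfinish h \<in> S \<union> inside S"
proof -
  have "h ` closure {0<..<1} \<subseteq> S \<union> inside S"
  proof (rule image_closure_subset)
    show "continuous_on (closure {0<..<1}) h" using assms(2) by (simp add: path_def)
    show "closed (S \<union> inside S)" 
      using assms(1) by (metis closed_Compl open_outside union_with_inside)
    show "h ` {0<..<1} \<subseteq> S \<union> inside S" using assms(3) by blast
  qed
  then show "pathstart h \<in> S \<union> inside S" "pathfinish h \<in> S \<union> inside S"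
    by (auto simp: pathstart_def pathfinish_def image_subset_iff)
qed

text \<open>Theta-curve argument. An arc \<open>g\<close> in \<open>S\<close> from
  \<open>\<gamma> 0\<close> to \<open>\<gamma> c\<close> cuts the inside of \<open>\<gamma>\<close>
  into two regions, one bordered by \<open>\<gamma>\<close> up to \<open>c\<close>, the other by
  \<open>\<gamma>\<close> from \<open>c\<close> on. The open part of an arc in \<open>T\<close> from
  \<open>\<gamma> b\<close> to \<open>\<gamma> d\<close> is connected and misses \<open>g\<close>,
  so it lies in one region; but \<open>\<gamma> b\<close> and \<open>\<gamma> d\<close> are on the
  borders of different regions.\<close>

lemma crossing_arcs_at_start:
  fixes \<gamma> :: "real \<Rightarrow> complex"
  assumes \<gamma>: "simple_path \<gamma>" "pathfinish \<gamma> = pathstart \<gamma>"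
    and t: "0 < b" "b < c" "c < d" "d < 1"
    and S: "path_connected S" "path_connected T" "S \<inter> T = {}"
    and sub: "S \<union> T \<subseteq> path_image \<gamma> \<union> inside (path_image \<gamma>)"
    and meet: "S \<inter> path_image \<gamma> = {\<gamma> 0, \<gamma> c}" "T \<inter> path_image \<gamma> = {\<gamma> b, \<gamma> d}"
  shows False
proof -
  have inj: "x = y \<or> x = 0 \<and> y = 1 \<or> x = 1 \<and> y = 0"
    if "\<gamma> x = \<gamma> y" "x \<in> {0..1}" "y \<in> {0..1}" for x y
    using \<gamma>(1) that unfolding simple_path_def loop_free_def by blast
  have ne: "\<gamma> 0 \<noteq> \<gamma> c" "\<gamma> b \<noteq> \<gamma> d" using inj[of 0 c] inj[of b d] t by auto
  have "\<gamma> 0 \<in> S" "\<gamma> c \<in> S" "\<gamma> b \<in> T" "\<gamma> d \<in> T" using meet by blast+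
  then obtain g h where g: "arc g" "path_image g \<subseteq> S" "pathstart g = \<gamma> 0" "pathfinish g = \<gamma> c"
    and h: "arc h" "path_image h \<subseteq> T" "pathstart h = \<gamma> b" "pathfinish h = \<gamma> d"
    using S ne unfolding path_connected_arcwise by metis
  define c1 where "c1 = subpath 0 c \<gamma>"
  \<comment> \<open>Run backwards from parameter 1, so that both halves of the curve start at
    \<open>\<gamma> 0 = \<gamma> 1\<close> and end at \<open>\<gamma> c\<close>.\<close>
  define c2 where "c2 = subpath 1 c \<gamma>"
  have c1: "simple_path c1" "pathstart c1 = \<gamma> 0" "pathfinish c1 = \<gamma> c" "path_image c1 = \<gamma> ` {0..c}"
    using \<gamma> t by (auto simp: c1_def path_image_subpath intro!: simple_path_subpath)
  have \<gamma>01: "\<gamma> 1 = \<gamma> 0" using \<gamma>(2) by (simp add: pathstart_def pathfinish_def)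
  have c2: "simple_path c2" "pathstart c2 = \<gamma> 0" "pathfinish c2 = \<gamma> c" "path_image c2 = \<gamma> ` {c..1}"
    using \<gamma>(1) \<gamma>01 t by (auto simp: c2_def path_image_subpath intro!: simple_path_subpath)
  have c12: "path_image c1 \<inter> path_image c2 = {\<gamma> 0, \<gamma> c}"
  proof
    show "path_image c1 \<inter> path_image c2 \<subseteq> {\<gamma> 0, \<gamma> c}"
    proof
      fix z assume "z \<in> path_image c1 \<inter> path_image c2"
      then obtain x y where "z = \<gamma> x" "z = \<gamma> y" "x \<in> {0..c}" "y \<in> {c..1}"
        unfolding c1(4) c2(4) by (metis IntE imageE)
      moreover from this have "x = y \<or> x = 0 \<and> y = 1 \<or> x = 1 \<and> y = 0" using t by (intro inj) auto
      ultimately show "z \<in> {\<gamma> 0, \<gamma> c}" using t by auto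
    qed
    have "\<gamma> 0 \<in> \<gamma> ` {c..1}" using \<gamma>01 t by (intro image_eqI[of _ _ 1]) auto
    then show "{\<gamma> 0, \<gamma> c} \<subseteq> path_image c1 \<inter> path_image c2" using c1(4) c2(4) t by auto
  qed
  have un: "path_image c1 \<union> path_image c2 = path_image \<gamma>"
  proof -
    have "{0..c} \<union> {c..1} = {0..1}" using t by auto
    then show ?thesis unfolding c1(4) c2(4) image_Un[symmetric] by (simp add: path_image_def)
  qed
  have gends: "{\<gamma> 0, \<gamma> c} \<subseteq> path_image g" 
    using pathstart_in_path_image[of g] pathfinish_in_path_image[of g] g(3,4) by simp
  have gm: "path_image g \<inter> path_image \<gamma> \<subseteq> {\<gamma> 0, \<gamma> c}" using g(2) meet(1) by blast
  \<comment> \<open>The midpoint is a point of \<open>g\<close> off the curve and shows that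
    \<open>g\<close> really enters the inside.\<close>
  have half: "g (1/2) \<noteq> \<gamma> 0" "g (1/2) \<noteq> \<gamma> c" "g (1/2) \<in> path_image g"
    using g arcD[OF g(1), of "1/2" 0] arcD[OF g(1), of "1/2" 1]
    by (auto simp: pathstart_def pathfinish_def path_image_def)
  obtain I: "inside (path_image c1 \<union> path_image g) \<inter> inside (path_image c2 \<union> path_image g) = {}"
    "inside (path_image c1 \<union> path_image g) \<union> inside (path_image c2 \<union> path_image g) \<union>
      (path_image g - {\<gamma> 0, \<gamma> c}) = inside (path_image c1 \<union> path_image c2)"
  proof (rule split_inside_simple_closed_curve[OF c1(1-3) c2(1-3) arc_imp_simple_path[OF g(1)] g(3,4) ne(1) c12])
    show "path_image c1 \<inter> path_image g = {\<gamma> 0, \<gamma> c}" "path_image c2 \<inter> path_image g = {\<gamma> 0, \<gamma> c}"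
      using gm gends c12 un by blast+
    have "g (1/2) \<in> inside (path_image \<gamma>)" using half gm sub g(2) by blast
    then show "path_image g \<inter> inside (path_image c1 \<union> path_image c2) \<noteq> {}"
      using half un by auto
  qed
  let ?I1 = "inside (path_image c1 \<union> path_image g)" and ?I2 = "inside (path_image c2 \<union> path_image g)"
  have cl: "closed (path_image c1 \<union> path_image g)" "closed (path_image c2 \<union> path_image g)"
    using c1(1) c2(1) g(1)
    by (simp_all add: closed_Un closed_path_image simple_path_imp_path arc_imp_path)
  define H where "H = h ` {0<..<1}"
  have hi: "h x \<noteq> \<gamma> b" "h x \<noteq> \<gamma> d" "h x \<in> path_image h" if "x \<in> {0<..<1}" for x
    using h arcD[OF h(1), of x 0] arcD[OF h(1), of x 1] that
    by (auto simp: pathstart_def pathfinish_def path_image_def)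
  have H0: "H \<subseteq> inside (path_image \<gamma>) - path_image g"
  proof
    fix z assume "z \<in> H"
    then have z: "z \<noteq> \<gamma> b" "z \<noteq> \<gamma> d" "z \<in> T" using hi h(2) by (auto simp: H_def)
    then show "z \<in> inside (path_image \<gamma>) - path_image g"
      using sub meet(2) S(3) g(2) by blast
  qed
  have I\<gamma>: "inside (path_image \<gamma>) = ?I1 \<union> ?I2 \<union> (path_image g - {\<gamma> 0, \<gamma> c})"
    using I(2) unfolding un by simp
  have H: "H \<subseteq> ?I1 \<union> ?I2" using H0 unfolding I\<gamma> by blast
  have "connected H"
    unfolding H_def using arc_imp_path[OF h(1)]
    by (intro connected_continuous_image) (auto simp: path_def intro: continuous_on_subset)
  then have "?I1 \<inter> H = {} \<or> ?I2 \<inter> H = {}"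
    using I(1) H by (intro connectedD open_inside cl) auto
  then have "H \<subseteq> ?I1 \<or> H \<subseteq> ?I2" using H by blast
  moreover have "?I1 \<inter> path_image \<gamma> = {}" "?I2 \<inter> path_image \<gamma> = {}"
    using inside_no_overlap[of "path_image \<gamma>"] unfolding I\<gamma> by blast+
  moreover have b\<gamma>: "\<gamma> b \<in> path_image \<gamma>" "\<gamma> d \<in> path_image \<gamma>" "\<gamma> b \<notin> path_image g" "\<gamma> d \<notin> path_image g"
    using meet S(3) g(2) by blast+
  moreover have "\<gamma> d \<notin> path_image c1"
  proof
    assume "\<gamma> d \<in> path_image c1"
    then obtain x where "\<gamma> d = \<gamma> x" "x \<in> {0..c}" using c1(4) by auto
    then show False using inj[of d x] t by auto
  qed
  moreover have "\<gamma> b \<notin> path_image c2"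
  proof
    assume "\<gamma> b \<in> path_image c2"
    then obtain x where "\<gamma> b = \<gamma> x" "x \<in> {c..1}" using c2(4) by auto
    then show False using inj[of b x] t by auto
  qed
  ultimately show False
    using closure_inside_open_arc(2)[OF cl(1) arc_imp_path[OF h(1)]]
      closure_inside_open_arc(1)[OF cl(2) arc_imp_path[OF h(1)]] h(3,4)
    unfolding H_def by auto
qed

text \<open>Shifting the start of the closed curve to \<open>\<gamma> a\<close> reduces to the case
  of parameter 0; the other parameters decrease by \<open>a\<close>, and no wrap-around
  occurs.\<close>

lemma crossing_arcs:
  fixes \<gamma> :: "real \<Rightarrow> complex"
  assumes \<gamma>: "simple_path \<gamma>" "pathfinish \<gamma> = pathstart \<gamma>"
    and t: "0 \<le> a" "a < b" "b < c" "c < d" "d < 1"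
    and S: "path_connected S" "path_connected T" "S \<inter> T = {}"
    and sub: "S \<union> T \<subseteq> path_image \<gamma> \<union> inside (path_image \<gamma>)"
    and meet: "S \<inter> path_image \<gamma> = {\<gamma> a, \<gamma> c}" "T \<inter> path_image \<gamma> = {\<gamma> b, \<gamma> d}"
  shows False
proof -
  define \<delta> where "\<delta> = shiftpath a \<gamma>"
  have im: "path_image \<delta> = path_image \<gamma>"
    unfolding \<delta>_def using \<gamma> t by (intro path_image_shiftpath) auto
  have \<delta>: "\<delta> 0 = \<gamma> a" "\<delta> (b - a) = \<gamma> b" "\<delta> (c - a) = \<gamma> c" "\<delta> (d - a) = \<gamma> d"
    using t by (auto simp: \<delta>_def shiftpath_def)
  show False
  proof (rule crossing_arcs_at_start[of \<delta> "b - a" "c - a" "d - a" S T])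
    show "simple_path \<delta>" unfolding \<delta>_def using \<gamma> t by (intro simple_path_shiftpath) auto
    show "pathfinish \<delta> = pathstart \<delta>"
      unfolding \<delta>_def using \<gamma> t by (intro closed_shiftpath) auto
  qed (use t S sub meet im \<delta> in auto)
qed

section \<open>Drawings of the trees of a grove\<close>

definition component_drawing ::
    "('v, 'e) network \<Rightarrow> ('v \<Rightarrow> complex) \<Rightarrow> ('e \<Rightarrow> real \<Rightarrow> complex) \<Rightarrow> 'e set \<Rightarrow> 'v \<Rightarrow> complex set" where
  "component_drawing G pos crv F x = pos ` {v. linked G F x v} \<union>
    (\<Union>e\<in>{e\<in>F. ends G e \<subseteq> {v. linked G F x v}}. path_image (crv e))"

lemma ends_nonempty:
  assumes "valid_network G" "e \<in> edges G"
  shows "ends G e \<noteq> {}"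
proof -
  have "card (ends G e) \<in> {1, 2}" using assms by (simp add: valid_network_def)
  then show ?thesis by auto
qed

lemma path_connected_component_drawing:
  assumes emb: "plane_embedding G pos crv" and F: "F \<subseteq> edges G"
    and sub: "\<And>e. e \<in> F \<Longrightarrow> ends G e \<noteq> {}"
  shows "path_connected (component_drawing G pos crv F x)" (is "path_connected ?D")
proof -
  have im: "path_image (crv e) \<subseteq> ?D" if "e \<in> F" "ends G e \<subseteq> {v. linked G F x v}" for e
    using that by (auto simp: component_drawing_def)
  have ep: "path (crv e)" "{pathstart (crv e), pathfinish (crv e)} = pos ` ends G e" if "e \<in> F" for e
    using emb F that by (auto simp: plane_embedding_def intro: simple_path_imp_path)
  have on: "path_component ?D p q" if "e \<in> F" "ends G e \<subseteq> {v. linked G F x v}"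
    "p \<in> path_image (crv e)" "q \<in> path_image (crv e)" for e p q
  proof -
    have "path_connected (path_image (crv e))" using ep that by (simp add: path_connected_path_image)
    then show ?thesis using that im path_component_of_subset
      unfolding path_connected_component by metis
  qed
  have v: "path_component ?D (pos x) (pos v)" if "linked G F x v" for v
    using that
  proof (induction rule: linked_induct)
    case refl
    show ?case by (auto simp: component_drawing_def intro!: path_component_refl)
  next
    case (step y z e)
    have "linked G F x z" using step(1) linked_edge[OF step(2,3)] by (rule linked_trans)
    then have "ends G e \<subseteq> {v. linked G F x v}" using step by simp
    moreover have "{pos y, pos z} \<subseteq> path_image (crv e)"
      using ep(2)[OF step(2)] step(3) by (metis image_empty image_insert pathstart_in_path_image
        pathfinish_in_path_image insert_subset empty_subsetI)
    ultimately have "path_component ?D (pos y) (pos z)" using step(2) by (intro on) auto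
    then show ?case using step(4) path_component_trans by blast
  qed
  have "path_component ?D (pos x) p" if p: "p \<in> ?D" for p
  proof (cases "p \<in> pos ` {v. linked G F x v}")
    case True
    then show ?thesis using v by auto
  next
    case False
    then obtain e where e: "e \<in> F" "ends G e \<subseteq> {v. linked G F x v}" "p \<in> path_image (crv e)"
      using p by (auto simp: component_drawing_def)
    obtain w where w: "w \<in> ends G e" "pos w = pathstart (crv e)" using ep(2)[OF e(1)] by (metis imageE insertI1)
    have "path_component ?D (pos w) p" using e w(2) by (intro on[OF e(1,2)]) auto
    then show ?thesis using v[of w] w(1) e(2) path_component_trans by blast
  qed
  then show ?thesis
    unfolding path_connected_component by (meson path_component_sym path_component_trans)
qed

lemma pos_mem_component_drawing:
  assumes emb: "plane_embedding G pos crv" and F: "F \<subseteq> edges G" and G: "valid_network G"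
    and x: "x \<in> verts G" and v: "v \<in> verts G" "pos v \<in> component_drawing G pos crv F x"
  shows "linked G F x v"
proof -
  have inj: "inj_on pos (verts G)" using emb by (simp add: plane_embedding_def)
  have "\<exists>w. linked G F x w \<and> pos v = pos w"
  proof (cases "pos v \<in> pos ` {v. linked G F x v}")
    case False
    then obtain e where e: "e \<in> F" "ends G e \<subseteq> {v. linked G F x v}" "pos v \<in> path_image (crv e)"
      using v by (auto simp: component_drawing_def)
    then have "pos v \<in> pos ` ends G e" using emb F v(1) unfolding plane_embedding_def by blast
    then show ?thesis using e(2) by blast
  qed auto
  then obtain w where w: "linked G F x w" "pos v = pos w" by blast
  then have "v = w" using inj v(1) linked_in_verts[OF G F w(1) x] by (auto dest: inj_onD)
  then show ?thesis using w by simp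
qed

lemma component_drawing_disjoint:
  assumes emb: "plane_embedding G pos crv" and F: "F \<subseteq> edges G" and G: "valid_network G"
    and xy: "x \<in> verts G" "y \<in> verts G" "\<not> linked G F x y"
  shows "component_drawing G pos crv F x \<inter> component_drawing G pos crv F y = {}"
proof (rule ccontr)
  assume "\<not> ?thesis"
  then obtain p where p: "p \<in> component_drawing G pos crv F x" "p \<in> component_drawing G pos crv F y" by blast
  have apart: "\<not> (linked G F x v \<and> linked G F y v)" for v
    using xy(3) linked_trans[of G F x v y] linked_sym[of G F y v] by blast
  have "p \<in> pos ` verts G"
  proof (rule ccontr)
    assume np: "p \<notin> pos ` verts G"
    have "p \<notin> pos ` {v. linked G F x v}" "p \<notin> pos ` {v. linked G F y v}"
      using np linked_in_verts[OF G F _ xy(1)] linked_in_verts[OF G F _ xy(2)] by blast+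
    then obtain e f where e: "e \<in> F" "ends G e \<subseteq> {v. linked G F x v}" "p \<in> path_image (crv e)"
      and f: "f \<in> F" "ends G f \<subseteq> {v. linked G F y v}" "p \<in> path_image (crv f)"
      using p by (auto simp: component_drawing_def)
    have "ends G e \<noteq> {}" using ends_nonempty[OF G] F e(1) by blast
    then have "e \<noteq> f" using e(2) f(2) apart by blast
    then have "p \<in> pos ` verts G" using emb F e f unfolding plane_embedding_def by blast
    then show False using np by simp
  qed
  then obtain v where "v \<in> verts G" "p = pos v" by blast
  then show False
    using p pos_mem_component_drawing[OF emb F G] xy apart by blast
qed

text \<open>The surrounding curve touches the graph only at nodes, so the drawing of the component
  of \<open>a\<close> meets it exactly at \<open>a\<close> and \<open>c\<close>, and that of
  \<open>b\<close> exactly at \<open>b\<close> and \<open>d\<close>. Disjoint path-connected sets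
  within the curve cannot meet it in alternating order.\<close>

lemma planar_no_crossing:
  assumes G: "valid_network G" and emb: "plane_embedding G pos crv"
    and cc: "nodes_counterclockwise G pos crv" and F: "F \<subseteq> edges G"
    and N: "{a, b, c, d} \<subseteq> node_labels G" "a < b" "b < c" "c < d"
    and ac: "nodes_in G F (node G a) = {a, c}" and bd: "nodes_in G F (node G b) = {b, d}"
  shows False
proof -
  obtain \<gamma> t where \<gamma>: "simple_path \<gamma>" "pathfinish \<gamma> = pathstart \<gamma>"
    and dr: "drawing G pos crv \<subseteq> path_image \<gamma> \<union> inside (path_image \<gamma>)"
      "path_image \<gamma> \<inter> drawing G pos crv = pos ` node G ` node_labels G"
    and t: "strict_mono_on (node_labels G) t"
      "\<forall>i\<in>node_labels G. t i \<in> {0..<1} \<and> \<gamma> (t i) = pos (node G i)"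
    using cc unfolding nodes_counterclockwise_def by blast
  have nv: "node G i \<in> verts G" if "i \<in> node_labels G" for i
    using G that by (auto simp: valid_network_def)
  define D where "D i = component_drawing G pos crv F (node G i)" for i
  have Dsub: "D i \<subseteq> drawing G pos crv" if "i \<in> node_labels G" for i
  proof -
    have "{v. linked G F (node G i) v} \<subseteq> verts G" using linked_in_verts[OF G F _ nv[OF that]] by blast
    then show ?thesis unfolding D_def component_drawing_def drawing_def using F by blast
  qed
  have Dpc: "path_connected (D i)" for i
    unfolding D_def using ends_nonempty[OF G] F
    by (intro path_connected_component_drawing[OF emb F]) blast
  have Dm: "D i \<inter> path_image \<gamma> = {\<gamma> (t i), \<gamma> (t j)}"
    if ij: "i \<in> node_labels G" "j \<in> node_labels G" "nodes_in G F (node G i) = {i, j}" for i j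
  proof
    show "D i \<inter> path_image \<gamma> \<subseteq> {\<gamma> (t i), \<gamma> (t j)}"
    proof
      fix z assume z: "z \<in> D i \<inter> path_image \<gamma>"
      then have "z \<in> pos ` node G ` node_labels G" using dr(2) Dsub[OF ij(1)] by blast
      then obtain k where k: "k \<in> node_labels G" "z = pos (node G k)" by blast
      then have "linked G F (node G i) (node G k)"
        using z unfolding D_def by (intro pos_mem_component_drawing[OF emb F G nv[OF ij(1)] nv]) auto
      then have "k \<in> {i, j}" using k(1) unfolding ij(3)[symmetric] by (simp add: nodes_in_def)
      then show "z \<in> {\<gamma> (t i), \<gamma> (t j)}" using k t(2) by auto
    qed
    have "linked G F (node G i) (node G k)" if "k \<in> {i, j}" for k
      using that unfolding ij(3)[symmetric] by (simp add: nodes_in_def)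
    then have "pos (node G k) \<in> D i" if "k \<in> {i, j}" for k
      using that by (auto simp: D_def component_drawing_def)
    moreover have "pos (node G k) \<in> path_image \<gamma>" if "k \<in> {i, j}" for k
      using dr(2) ij that by blast
    ultimately show "{\<gamma> (t i), \<gamma> (t j)} \<subseteq> D i \<inter> path_image \<gamma>" using t(2) ij by simp
  qed
  have "\<not> linked G F (node G a) (node G b)"
  proof
    assume "linked G F (node G a) (node G b)"
    then have "b \<in> nodes_in G F (node G a)" using N by (simp add: nodes_in_def)
    then show False using ac N by simp
  qed
  then have disj: "D a \<inter> D b = {}"
    unfolding D_def using N nv by (intro component_drawing_disjoint[OF emb F G]) auto
  show False
  proof (rule crossing_arcs[OF \<gamma>, of "t a" "t b" "t c" "t d" "D a" "D b"])
    show "0 \<le> t a" "t d < 1" using t(2) N by auto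
    show "t a < t b" "t b < t c" "t c < t d" using t(1) N by (auto simp: strict_mono_on_def)
    show "D a \<union> D b \<subseteq> path_image \<gamma> \<union> inside (path_image \<gamma>)" using Dsub N dr(1) by blast
    show "D a \<inter> path_image \<gamma> = {\<gamma> (t a), \<gamma> (t c)}" using N ac by (intro Dm) auto
    show "D b \<inter> path_image \<gamma> = {\<gamma> (t b), \<gamma> (t d)}" using N bd by (intro Dm) auto
  qed (use Dpc disj in auto)
qed

section \<open>The Pfaffian as a sum over pairings\<close>

text \<open>The value -1 marks an inversion of \<open>p\<close>. Inversions, unlike a decomposition
  into transpositions, can be sorted by blocks and compared with crossings.\<close>

definition pair_order :: "(nat \<Rightarrow> nat) \<Rightarrow> nat set \<Rightarrow> real" where
  "pair_order p P = (if p (Min P) < p (Max P) then 1 else -1)"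

definition two_subsets :: "nat set \<Rightarrow> nat set set" where
  "two_subsets S = {P. P \<subseteq> S \<and> card P = 2}"

lemma finite_two_subsets: "finite S \<Longrightarrow> finite (two_subsets S)"
  by (rule finite_subset[of _ "Pow S"]) (auto simp: two_subsets_def)

lemma pair_order_less: "a < b \<Longrightarrow> pair_order p {a, b} = (if p a < p b then 1 else -1)"
  by (simp add: pair_order_def)

text \<open>The composition inverts \<open>P\<close> exactly if one, but not both, of these happens:
  \<open>q\<close> inverts \<open>P\<close>, \<open>p\<close> inverts the image of \<open>P\<close>
  under \<open>q\<close>. And \<open>q\<close> permutes the two-element sets.\<close>

lemma prod_pair_order_compose:
  assumes S: "finite S" and p: "p permutes S" and q: "q permutes S"
  shows "(\<Prod>P\<in>two_subsets S. pair_order (p \<circ> q) P) =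
    (\<Prod>P\<in>two_subsets S. pair_order p P) * (\<Prod>P\<in>two_subsets S. pair_order q P)"
proof -
  have injq: "inj q" using q by (rule permutes_inj)
  have "(\<Prod>P\<in>two_subsets S. pair_order (p \<circ> q) P) =
      (\<Prod>P\<in>two_subsets S. pair_order p (q ` P) * pair_order q P)"
  proof (rule prod.cong[OF refl])
    fix P assume "P \<in> two_subsets S"
    then have "card P = 2" by (simp add: two_subsets_def)
    then obtain a b where ab: "a < b" "P = {a, b}" by (rule pairE)
    have "q a \<noteq> q b" "p (q a) \<noteq> p (q b)"
      using ab(1) injq permutes_inj[OF p] by (auto simp: inj_eq)
    then show "pair_order (p \<circ> q) P = pair_order p (q ` P) * pair_order q P"
      using ab(1) pair_order_less[of "q a" "q b" p] pair_order_less[of "q b" "q a" p]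
      unfolding ab(2) by (cases "q a < q b") (auto simp: pair_order_less insert_commute)
  qed
  also have "\<dots> = (\<Prod>P\<in>two_subsets S. pair_order p (q ` P)) * (\<Prod>P\<in>two_subsets S. pair_order q P)"
    by (rule prod.distrib)
  also have "(\<Prod>P\<in>two_subsets S. pair_order p (q ` P)) = (\<Prod>P\<in>two_subsets S. pair_order p P)"
  proof (rule prod.reindex_bij_betw)
    show "bij_betw ((`) q) (two_subsets S) (two_subsets S)"
    proof -
      have fin: "finite (two_subsets S)" using S by (rule finite_two_subsets)
      have sub: "(`) q ` two_subsets S \<subseteq> two_subsets S"
      proof
        fix Q assume "Q \<in> (`) q ` two_subsets S"
        then obtain P where P: "P \<subseteq> S" "card P = 2" "Q = q ` P" by (auto simp: two_subsets_def)
        have "card (q ` P) = card P" using injq by (intro card_image) (auto intro: inj_on_subset)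
        moreover have "q ` P \<subseteq> S" using P(1) permutes_image[OF q] by blast
        ultimately show "Q \<in> two_subsets S" using P by (simp add: two_subsets_def)
      qed
      have "inj_on ((`) q) (two_subsets S)"
        using injq by (auto simp: inj_on_def inj_image_eq_iff)
      then show ?thesis using endo_inj_surj[OF fin sub] by (simp add: bij_betw_def)
    qed
  qed
  finally show ?thesis .
qed

text \<open>The inverted pairs are \<open>{a, b}\<close> and, for each \<open>k\<close> of
  \<open>S\<close> strictly between, \<open>{a, k}\<close> and \<open>{k, b}\<close>: an odd
  number.\<close>

lemma prod_pair_order_transpose:
  assumes S: "finite S" "a \<in> S" "b \<in> S" and ab: "a < b"
  shows "(\<Prod>P\<in>two_subsets S. pair_order (Transposition.transpose a b) P) = -1"
proof -
  define M where "M = S \<inter> {a<..<b}"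
  define D where "D = insert {a, b} ((\<lambda>k. {a, k}) ` M \<union> (\<lambda>k. {k, b}) ` M)"
  have M: "finite M" using S by (simp add: M_def)
  have "(\<Prod>P\<in>two_subsets S. pair_order (Transposition.transpose a b) P) = (\<Prod>P\<in>D. pair_order (Transposition.transpose a b) P)"
  proof (rule prod.mono_neutral_right)
    show "finite (two_subsets S)" using S(1) by (rule finite_two_subsets)
    show "D \<subseteq> two_subsets S" using S ab by (auto simp: D_def M_def two_subsets_def)
    show "\<forall>P\<in>two_subsets S - D. pair_order (Transposition.transpose a b) P = 1"
    proof
      fix P assume P: "P \<in> two_subsets S - D"
      then have "card P = 2" by (simp add: two_subsets_def)
      then obtain x y where xy: "x < y" "P = {x, y}" by (rule pairE)
      have S': "x \<in> S" "y \<in> S" using P xy by (auto simp: two_subsets_def)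
      have "\<not> (x = a \<and> y = b)" "\<not> (x = a \<and> y < b)" "\<not> (y = b \<and> a < x)"
        using P xy S' by (auto simp: D_def M_def)
      then have "Transposition.transpose a b x < Transposition.transpose a b y"
        using xy(1) ab unfolding Transposition.transpose_def by (auto split: if_splits)
      then show "pair_order (Transposition.transpose a b) P = 1" unfolding xy(2) using xy(1) by (simp add: pair_order_less)
    qed
  qed
  also have "\<dots> = (\<Prod>P\<in>D. -1)"
  proof (rule prod.cong[OF refl])
    fix P assume "P \<in> D"
    then consider "P = {a, b}" | k where "k \<in> M" "P = {a, k}" | k where "k \<in> M" "P = {k, b}"
      by (auto simp: D_def)
    then show "pair_order (Transposition.transpose a b) P = -1"
      using ab by cases (auto simp: pair_order_less M_def Transposition.transpose_def)
  qed
  also have "\<dots> = (-1) ^ card D" by simp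
  also have "card D = Suc (card M + card M)"
  proof -
    have "{a, b} \<notin> (\<lambda>k. {a, k}) ` M \<union> (\<lambda>k. {k, b}) ` M"
      by (auto simp: M_def doubleton_eq_iff)
    then have "card D = Suc (card ((\<lambda>k. {a, k}) ` M \<union> (\<lambda>k. {k, b}) ` M))"
      using M by (simp add: D_def)
    also have "card ((\<lambda>k. {a, k}) ` M \<union> (\<lambda>k. {k, b}) ` M) =
        card ((\<lambda>k. {a, k}) ` M) + card ((\<lambda>k. {k, b}) ` M)"
      using M by (intro card_Un_disjoint) (auto simp: M_def doubleton_eq_iff)
    also have "card ((\<lambda>k. {a, k}) ` M) = card M"
      by (rule card_image) (auto simp: inj_on_def doubleton_eq_iff)
    also have "card ((\<lambda>k. {k, b}) ` M) = card M"
      by (rule card_image) (auto simp: inj_on_def doubleton_eq_iff)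
    finally show ?thesis .
  qed
  finally show ?thesis by (simp flip: mult_2)
qed

lemma sign_eq_prod_pair_order:
  assumes "finite S" "p permutes S"
  shows "of_int (sign p) = (\<Prod>P\<in>two_subsets S. pair_order p P)"
  using assms(2,1)
proof (induction rule: permutes_induct)
  case id
  have "pair_order (\<lambda>x. x) P = 1" if "P \<in> two_subsets S" for P
  proof -
    have "card P = 2" using that by (simp add: two_subsets_def)
    then show ?thesis by (elim pairE) (simp add: pair_order_def)
  qed
  then show ?case by simp
next
  case (swap a b p)
  have t: "(\<Prod>P\<in>two_subsets S. pair_order (Transposition.transpose a b) P) = -1"
  proof (cases "a < b")
    case True
    then show ?thesis using prod_pair_order_transpose assms(1) swap by blast
  next
    case False
    then show ?thesis
      using prod_pair_order_transpose[of S b a] assms(1) swap by (simp add: Transposition.transpose_commute)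
  qed
  have "Transposition.transpose a b permutes S" using swap by (intro permutes_swap_id)
  then have "(\<Prod>P\<in>two_subsets S. pair_order (Transposition.transpose a b \<circ> p) P) = - of_int (sign p)"
    using prod_pair_order_compose[OF assms(1) _ \<open>p permutes S\<close>] t swap by simp
  moreover have "sign (Transposition.transpose a b \<circ> p) = - sign p"
    using swap assms(1) by (subst sign_compose)
      (auto simp: sign_swap_id permutation_swap_id intro: permutation_permutes[THEN iffD2])
  ultimately show ?case by (simp only: of_int_minus)
qed

section \<open>Pfaffian permutations and pairings\<close>

definition pfaffian_perms :: "nat \<Rightarrow> (nat \<Rightarrow> nat) set" where
  "pfaffian_perms n = {p. p permutes {1..2 * n} \<and>
     (\<forall>i\<in>{1..n}. p (2 * i - 1) < p (2 * i)) \<and>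
     (\<forall>i\<in>{1..<n}. p (2 * i - 1) < p (2 * i + 1))}"

definition perm_pair :: "(nat \<Rightarrow> nat) \<Rightarrow> nat \<Rightarrow> nat set" where
  "perm_pair p i = {p (2 * i - 1), p (2 * i)}"

lemma pfaffian_perms_first_less:
  assumes p: "p \<in> pfaffian_perms n" and ij: "1 \<le> i" "i < j" "j \<le> n"
  shows "p (2 * i - 1) < p (2 * j - 1)"
  using ij(2,3)
proof (induction j)
  case (Suc j)
  then have "p (2 * j - 1) < p (2 * j + 1)" using p ij(1) by (auto simp: pfaffian_perms_def)
  moreover have "2 * Suc j - 1 = 2 * j + 1" by simp
  ultimately have step: "p (2 * j - 1) < p (2 * Suc j - 1)" by simp
  then show ?case
    using Suc by (cases "i = j") (auto intro: order.strict_trans[of _ "p (2 * j - 1)"])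
qed simp

lemma perm_pair_props:
  assumes p: "p \<in> pfaffian_perms n" and i: "i \<in> {1..n}"
  shows "p (2 * i - 1) < p (2 * i)" "Min (perm_pair p i) = p (2 * i - 1)"
    "Max (perm_pair p i) = p (2 * i)" "card (perm_pair p i) = 2"
proof -
  show less: "p (2 * i - 1) < p (2 * i)" using p i by (auto simp: pfaffian_perms_def)
  then show "Min (perm_pair p i) = p (2 * i - 1)" "Max (perm_pair p i) = p (2 * i)"
    "card (perm_pair p i) = 2" by (auto simp: perm_pair_def)
qed

lemma inj_on_perm_pair:
  assumes p: "p \<in> pfaffian_perms n"
  shows "inj_on (perm_pair p) {1..n}"
proof (rule linorder_inj_onI)
  fix i j assume ij: "i < j" "i \<in> {1..n}" "j \<in> {1..n}"
  then have "Min (perm_pair p i) < Min (perm_pair p j)"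
    using pfaffian_perms_first_less[OF p, of i j] perm_pair_props(2)[OF p] by simp
  then show "perm_pair p i \<noteq> perm_pair p j" by auto
qed auto

lemma doubled_range: "x \<in> {1..2 * n} \<longleftrightarrow> (\<exists>i\<in>{1..n}. x = 2 * i - 1 \<or> x = 2 * i)" for x n :: nat
proof
  assume x: "x \<in> {1..2 * n}"
  then have "(x + 1) div 2 \<in> {1..n}" by auto
  moreover have "x = 2 * ((x + 1) div 2) - 1 \<or> x = 2 * ((x + 1) div 2)"
    by (cases "even x") (auto elim!: evenE oddE)
  ultimately show "\<exists>i\<in>{1..n}. x = 2 * i - 1 \<or> x = 2 * i" by blast
qed auto

lemma Union_perm_pair: "\<Union>(perm_pair p ` {1..n}) = p ` {1..2 * n}"
proof (intro equalityI subsetI)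
  fix y assume "y \<in> p ` {1..2 * n}"
  then obtain x where x: "x \<in> {1..2 * n}" "y = p x" by blast
  then obtain i where "i \<in> {1..n}" "x = 2 * i - 1 \<or> x = 2 * i"
    using doubled_range[of x n] by blast
  then show "y \<in> \<Union>(perm_pair p ` {1..n})" using x(2) by (auto simp: perm_pair_def)
next
  fix y assume "y \<in> \<Union>(perm_pair p ` {1..n})"
  then obtain i where i: "i \<in> {1..n}" "y = p (2 * i - 1) \<or> y = p (2 * i)"
    by (auto simp: perm_pair_def)
  then have "2 * i - 1 \<in> {1..2 * n}" "2 * i \<in> {1..2 * n}" by auto
  then show "y \<in> p ` {1..2 * n}" using i(2) by blast
qed

lemma perm_pairing_mem:
  assumes p: "p \<in> pfaffian_perms n"
  shows "perm_pair p ` {1..n} \<in> pairings {1..2 * n}"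
proof -
  have perm: "p permutes {1..2 * n}" using p by (simp add: pfaffian_perms_def)
  have inj: "p x = p y \<longleftrightarrow> x = y" for x y using permutes_inj[OF perm] by (simp add: inj_eq)
  have "\<Union>(perm_pair p ` {1..n}) = {1..2 * n}"
    unfolding Union_perm_pair using permutes_image[OF perm] .
  moreover have "perm_pair p i \<inter> perm_pair p j = {}" if "i \<in> {1..n}" "j \<in> {1..n}" "i \<noteq> j" for i j
  proof -
    have "2 * i - 1 \<noteq> 2 * j - 1" "2 * i - 1 \<noteq> 2 * j" "2 * i \<noteq> 2 * j - 1" "2 * i \<noteq> 2 * j"
      using that by (auto; presburger)+
    then show ?thesis by (auto simp: perm_pair_def inj)
  qed
  then have "disjoint (perm_pair p ` {1..n})" unfolding disjoint_def by blast
  moreover have "{} \<notin> perm_pair p ` {1..n}" by (auto simp: perm_pair_def)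
  ultimately show ?thesis
    using perm_pair_props(4)[OF p] by (auto simp: pairings_def partition_on_def)
qed

text \<open>Block \<open>i\<close> has the smaller first entry, so that entry causes no inversion
  with block \<open>j\<close>. The second entry of block \<open>i\<close> gives a single inversion
  exactly if it falls between the two entries of block \<open>j\<close>, i.e. if the blocks cross;
  beyond both it gives two, whose signs cancel.\<close>

lemma block_pair_product:
  assumes p: "p \<in> pfaffian_perms n" and ij: "1 \<le> i" "i < j" "j \<le> n"
  shows "pair_order p {2 * i - 1, 2 * j - 1} * pair_order p {2 * i - 1, 2 * j} *
    (pair_order p {2 * i, 2 * j - 1} * pair_order p {2 * i, 2 * j}) =
    cross_sign (perm_pair p i) (perm_pair p j)"
proof -
  have perm: "p permutes {1..2 * n}" using p by (simp add: pfaffian_perms_def)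
  have inj: "p x = p y \<longleftrightarrow> x = y" for x y using permutes_inj[OF perm] by (simp add: inj_eq)
  have i: "i \<in> {1..n}" and j: "j \<in> {1..n}" using ij by auto
  have 1: "p (2 * i - 1) < p (2 * j - 1)" using pfaffian_perms_first_less[OF p ij] .
  note pi = perm_pair_props[OF p i] and pj = perm_pair_props[OF p j]
  have less: "2 * i - 1 < 2 * j - 1" "2 * i - 1 < 2 * j" "2 * i < 2 * j - 1" "2 * i < 2 * j"
    using ij by auto
  have ne: "p (2 * i) \<noteq> p (2 * j - 1)" "p (2 * i) \<noteq> p (2 * j)" unfolding inj using less by auto
  have "cross_sign (perm_pair p i) (perm_pair p j) =
      inside_sign (p (2 * i - 1)) (perm_pair p j) * inside_sign (p (2 * i)) (perm_pair p j)"
    unfolding cross_sign_def using pi(1) by (simp add: perm_pair_def)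
  also have "\<dots> = (if p (2 * j - 1) < p (2 * i) \<and> p (2 * i) < p (2 * j) then -1 else 1)"
    unfolding inside_sign_def pj(2,3) using 1 by simp
  finally show ?thesis
    unfolding less[THEN pair_order_less] using 1 pj(1) ne by auto
qed

lemma prod_two_by_two:
  fixes a b c d :: nat
  assumes "a < b" "b < c" "c < d"
  shows "(\<Prod>P\<in>{P. \<exists>x\<in>{a, b}. \<exists>y\<in>{c, d}. x < y \<and> P = {x, y}}. g P) =
    g {a, c} * g {a, d} * (g {b, c} * g {b, d} :: real)"
proof -
  have "{P. \<exists>x\<in>{a, b}. \<exists>y\<in>{c, d}. x < y \<and> P = {x, y}} = {{a, c}, {a, d}, {b, c}, {b, d}}"
    using assms by auto
  moreover have "{a, c} \<notin> {{a, d}, {b, c}, {b, d}}" "{a, d} \<notin> {{b, c}, {b, d}}" "{b, c} \<notin> {{b, d}}"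
    using assms by (auto simp: doubleton_eq_iff)
  ultimately show ?thesis by (simp add: mult.assoc)
qed

text \<open>Inversions and crossings have the same parity: sort the pairs of positions by the blocks
  in which they lie. Within a block \<open>p\<close> increases, and two different blocks contribute
  the four pairs of \<open>block_pair_product\<close>.\<close>

lemma prod_pair_order_blocks:
  assumes p: "p \<in> pfaffian_perms n"
  shows "(\<Prod>P\<in>two_subsets {1..2 * n}. pair_order p P) = pairing_sign (perm_pair p ` {1..n})"
proof -
  define h where "h P = ((Min P + 1) div 2, (Max P + 1) div 2)" for P :: "nat set"
  define T where "T = {(i, j). 1 \<le> i \<and> i \<le> j \<and> j \<le> n}"
  define T' where "T' = {(i, j). 1 \<le> i \<and> i < j \<and> j \<le> n}"
  have fT: "finite T" "finite T'"
    by (auto simp: T_def T'_def intro: finite_subset[of _ "{1..n} \<times> {1..n}"])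
  have fib: "P \<in> two_subsets {1..2 * n} \<and> h P = (i, j) \<longleftrightarrow>
    (\<exists>x\<in>{2 * i - 1, 2 * i}. \<exists>y\<in>{2 * j - 1, 2 * j}. x < y \<and> P = {x, y})"
    if ij: "(i, j) \<in> T" for i j P
  proof
    assume P: "P \<in> two_subsets {1..2 * n} \<and> h P = (i, j)"
    then have "card P = 2" by (simp add: two_subsets_def)
    then obtain x y where xy: "x < y" "P = {x, y}" "Min P = x" "Max P = y" by (rule pairE)
    have "(x + 1) div 2 = i" "(y + 1) div 2 = j" using P xy by (auto simp: h_def)
    then have "x = 2 * i - 1 \<or> x = 2 * i" "y = 2 * j - 1 \<or> y = 2 * j" by presburger+
    then show "\<exists>x\<in>{2 * i - 1, 2 * i}. \<exists>y\<in>{2 * j - 1, 2 * j}. x < y \<and> P = {x, y}" using xy by blast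
  next
    assume "\<exists>x\<in>{2 * i - 1, 2 * i}. \<exists>y\<in>{2 * j - 1, 2 * j}. x < y \<and> P = {x, y}"
    then obtain x y where xy: "x \<in> {2 * i - 1, 2 * i}" "y \<in> {2 * j - 1, 2 * j}" "x < y" "P = {x, y}"
      by blast
    moreover have "(x + 1) div 2 = i" "(y + 1) div 2 = j" using xy ij by (auto simp: T_def)
    ultimately show "P \<in> two_subsets {1..2 * n} \<and> h P = (i, j)"
      using ij by (auto simp: two_subsets_def h_def T_def)
  qed
  have "(\<Prod>P\<in>two_subsets {1..2 * n}. pair_order p P) =
      (\<Prod>t\<in>T. \<Prod>P\<in>{P \<in> two_subsets {1..2 * n}. h P = t}. pair_order p P)"
  proof (rule prod.group[symmetric])
    show "finite (two_subsets {1..2 * n})" by (simp add: finite_two_subsets)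
    show "h ` two_subsets {1..2 * n} \<subseteq> T"
    proof
      fix t assume "t \<in> h ` two_subsets {1..2 * n}"
      then obtain P where P: "P \<subseteq> {1..2 * n}" "card P = 2" "t = h P" by (auto simp: two_subsets_def)
      obtain x y where xy: "x < y" "P = {x, y}" "Min P = x" "Max P = y" using P(2) by (rule pairE)
      have "1 \<le> x" "y \<le> 2 * n" using P(1) xy(2) by auto
      then show "t \<in> T" unfolding P(3) h_def T_def using xy by auto
    qed
  qed (rule fT)
  also have "\<dots> = (\<Prod>t\<in>T'. \<Prod>P\<in>{P \<in> two_subsets {1..2 * n}. h P = t}. pair_order p P)"
  proof (rule prod.mono_neutral_right)
    show "T' \<subseteq> T" by (auto simp: T_def T'_def)
    show "\<forall>t\<in>T - T'. (\<Prod>P\<in>{P \<in> two_subsets {1..2 * n}. h P = t}. pair_order p P) = 1"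
    proof
      fix t assume t: "t \<in> T - T'"
      obtain i j where ij: "t = (i, j)" by (cases t)
      then have "1 \<le> i \<and> i \<le> j \<and> j \<le> n \<and> \<not> i < j"
        using t by (simp add: T_def T'_def) blast
      then have i: "t = (i, i)" "i \<in> {1..n}" "(i, i) \<in> T" using ij by (auto simp: T_def)
      have "{P \<in> two_subsets {1..2 * n}. h P = t} = {{2 * i - 1, 2 * i}}"
        unfolding i(1) fib[OF i(3)] using i(2) by auto
      moreover have "pair_order p {2 * i - 1, 2 * i} = 1"
        using i(2) perm_pair_props(1)[OF p i(2)] pair_order_less[of "2 * i - 1" "2 * i" p] by simp
      ultimately show "(\<Prod>P\<in>{P \<in> two_subsets {1..2 * n}. h P = t}. pair_order p P) = 1" by simp
    qed
  qed (rule fT)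
  also have "\<dots> = (\<Prod>(i, j)\<in>T'. cross_sign (perm_pair p i) (perm_pair p j))"
  proof (intro prod.cong refl)
    fix t assume "t \<in> T'"
    then obtain i j where ij: "t = (i, j)" "1 \<le> i" "i < j" "j \<le> n" by (auto simp: T'_def)
    then have T: "(i, j) \<in> T" by (auto simp: T_def)
    have "(\<Prod>P\<in>{P \<in> two_subsets {1..2 * n}. h P = t}. pair_order p P) =
      pair_order p {2 * i - 1, 2 * j - 1} * pair_order p {2 * i - 1, 2 * j} *
      (pair_order p {2 * i, 2 * j - 1} * pair_order p {2 * i, 2 * j})"
      unfolding ij(1) fib[OF T] using ij(2,3) by (intro prod_two_by_two) auto
    then show "(\<Prod>P\<in>{P \<in> two_subsets {1..2 * n}. h P = t}. pair_order p P) =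
      (case t of (i, j) \<Rightarrow> cross_sign (perm_pair p i) (perm_pair p j))"
      using block_pair_product[OF p ij(2-4)] ij(1) by simp
  qed
  also have "\<dots> = pairing_sign (perm_pair p ` {1..n})"
    unfolding pairing_sign_def
  proof (rule prod.reindex_cong[symmetric])
    show "inj_on (\<lambda>(i, j). (perm_pair p i, perm_pair p j)) T'"
    proof (rule inj_onI)
      fix s t assume st: "s \<in> T'" "t \<in> T'" and eq: "(case s of (i, j) \<Rightarrow> (perm_pair p i, perm_pair p j)) =
        (case t of (i, j) \<Rightarrow> (perm_pair p i, perm_pair p j))"
      obtain i j k l where ij: "s = (i, j)" "t = (k, l)" by (cases s, cases t)
      have r: "i \<in> {1..n}" "j \<in> {1..n}" "k \<in> {1..n}" "l \<in> {1..n}" using st ij by (auto simp: T'_def)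
      have "perm_pair p i = perm_pair p k" "perm_pair p j = perm_pair p l" using eq ij by auto
      then show "s = t" using inj_onD[OF inj_on_perm_pair[OF p]] r ij by blast
    qed
    have lt: "Min (perm_pair p i) < Min (perm_pair p j) \<longleftrightarrow> i < j" if "i \<in> {1..n}" "j \<in> {1..n}" for i j
      using pfaffian_perms_first_less[OF p, of i j] pfaffian_perms_first_less[OF p, of j i] that
        perm_pair_props(2)[OF p] by (cases i j rule: linorder_cases) simp_all
    show "{(P, Q). P \<in> perm_pair p ` {1..n} \<and> Q \<in> perm_pair p ` {1..n} \<and> Min P < Min Q} =
      (\<lambda>(i, j). (perm_pair p i, perm_pair p j)) ` T'"
    proof (intro equalityI subsetI)
      fix t assume "t \<in> {(P, Q). P \<in> perm_pair p ` {1..n} \<and> Q \<in> perm_pair p ` {1..n} \<and> Min P < Min Q}"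
      then obtain i j where ij: "i \<in> {1..n}" "j \<in> {1..n}" "t = (perm_pair p i, perm_pair p j)"
        "Min (perm_pair p i) < Min (perm_pair p j)" by auto
      then have "(i, j) \<in> T'" using lt by (auto simp: T'_def)
      then show "t \<in> (\<lambda>(i, j). (perm_pair p i, perm_pair p j)) ` T'" using ij(3) by force
    qed (use lt in \<open>auto simp: T'_def\<close>)
  qed auto
  finally show ?thesis .
qed

text \<open>The first entries are the minima of the blocks in increasing order, which the set of
  blocks determines; the second entries are then the maxima of the same blocks.\<close>

lemma inj_on_perm_pairing: "inj_on (\<lambda>p. perm_pair p ` {1..n}) (pfaffian_perms n)"
proof (rule inj_onI)
  fix p q assume p: "p \<in> pfaffian_perms n" and q: "q \<in> pfaffian_perms n"
    and eq: "perm_pair p ` {1..n} = perm_pair q ` {1..n}"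
  have firsts: "map (\<lambda>i. r (2 * i - 1)) [1..<Suc n] = sorted_list_of_set (Min ` perm_pair r ` {1..n})"
    if r: "r \<in> pfaffian_perms n" for r
  proof (rule strict_sorted_equal)
    show "sorted_wrt (<) (map (\<lambda>i. r (2 * i - 1)) [1..<Suc n])"
      unfolding sorted_wrt_map using pfaffian_perms_first_less[OF r]
      by (intro sorted_wrt_mono_rel[OF _ sorted_wrt_upt]) auto
    have "set (map (\<lambda>i. r (2 * i - 1)) [1..<Suc n]) = (\<lambda>i. r (2 * i - 1)) ` {1..n}"
      by auto
    also have "\<dots> = Min ` perm_pair r ` {1..n}"
      unfolding image_image using perm_pair_props(2)[OF r] by simp
    finally show "set (map (\<lambda>i. r (2 * i - 1)) [1..<Suc n]) =
        set (sorted_list_of_set (Min ` perm_pair r ` {1..n}))" by simp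
  qed simp
  have eqs: "map (\<lambda>i. p (2 * i - 1)) [1..<Suc n] = map (\<lambda>i. q (2 * i - 1)) [1..<Suc n]"
    unfolding firsts[OF p] firsts[OF q] eq ..
  have 1: "p (2 * i - 1) = q (2 * i - 1)" if "i \<in> {1..n}" for i
  proof -
    have "i \<in> set [1..<Suc n]" using that by auto
    then show ?thesis using eqs unfolding map_eq_conv by blast
  qed
  have 2: "p (2 * i) = q (2 * i)" if i: "i \<in> {1..n}" for i
  proof -
    have "disjoint (perm_pair p ` {1..n})"
      using perm_pairing_mem[OF p] by (simp add: pairings_def partition_on_def)
    moreover have "perm_pair p i \<in> perm_pair p ` {1..n}" using i by (rule imageI)
    moreover have "perm_pair q i \<in> perm_pair p ` {1..n}" unfolding eq using i by (rule imageI)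
    moreover have "perm_pair p i \<inter> perm_pair q i \<noteq> {}" using 1[OF i] by (auto simp: perm_pair_def)
    ultimately have "perm_pair p i = perm_pair q i" unfolding disjoint_def by blast
    then show ?thesis using perm_pair_props(3)[OF p i] perm_pair_props(3)[OF q i] by simp
  qed
  show "p = q"
  proof
    fix x
    show "p x = q x"
    proof (cases "x \<in> {1..2 * n}")
      case True
      then show ?thesis using 1 2 doubled_range[of x n] by auto
    next
      case False
      then show ?thesis using p q by (auto simp: pfaffian_perms_def permutes_def)
    qed
  qed
qed

lemma pairing_is_perm_pairing:
  assumes \<pi>: "\<pi> \<in> pairings {1..2 * n}"
  shows "\<exists>p\<in>pfaffian_perms n. perm_pair p ` {1..n} = \<pi>"
proof -
  have c2: "card P = 2" if "P \<in> \<pi>" for P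
    using \<pi> that by (auto simp: pairings_def)
  have U: "\<Union>\<pi> = {1..2 * n}" and dis: "disjoint \<pi>"
    using \<pi> by (auto simp: pairings_def partition_on_def)
  have fin: "finite \<pi>" using \<pi> by (intro pairings_finite[of "{1..2 * n}"]) auto
  have "card (\<Union>\<pi>) = (\<Sum>P\<in>\<pi>. card P)"
    using dis c2 by (intro card_Union_disjoint) (auto simp: disjoint_def disjnt_def pairwise_def intro: card_ge_0_finite)
  then have card: "card \<pi> = n" using U c2 by simp
  have MinP: "Min P \<in> P" if "P \<in> \<pi>" for P
    using c2[OF that] by (intro Min_in) (auto intro: card_ge_0_finite)
  have injM: "inj_on Min \<pi>"
  proof (rule inj_onI)
    fix P Q assume "P \<in> \<pi>" "Q \<in> \<pi>" "Min P = Min Q"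
    then show "P = Q" using MinP[of P] MinP[of Q] dis unfolding disjoint_def by auto
  qed
  define ms where "ms = sorted_list_of_set (Min ` \<pi>)"
  have ms: "set ms = Min ` \<pi>" "length ms = n" "sorted_wrt (<) ms"
    using fin card card_image[OF injM] by (auto simp: ms_def)
  define b where "b = inv_into \<pi> Min"
  have b: "b (Min P) = P" if "P \<in> \<pi>" for P using injM that by (simp add: b_def)
  \<comment> \<open>The blocks are taken by increasing minimum, each in increasing order. The list
    \<open>ms\<close> is indexed from 0: block \<open>i\<close> has the minimum
    \<open>ms ! (i - 1)\<close>, and \<open>x div 2\<close> for \<open>x = 2 * i - 1\<close> as well
    as \<open>(x - 1) div 2\<close> for \<open>x = 2 * i\<close> equal \<open>i - 1\<close>.\<close>
  define p where "p x = (if x \<in> {1..2 * n} then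
    (if odd x then ms ! (x div 2) else Max (b (ms ! ((x - 1) div 2)))) else x)" for x
  have blk: "b (ms ! (i - 1)) \<in> \<pi> \<and> Min (b (ms ! (i - 1))) = ms ! (i - 1) \<and>
      p (2 * i - 1) = Min (b (ms ! (i - 1))) \<and> p (2 * i) = Max (b (ms ! (i - 1)))"
    if i: "i \<in> {1..n}" for i
  proof -
    have "ms ! (i - 1) \<in> Min ` \<pi>" using i ms(1,2) by (metis One_nat_def Suc_pred atLeastAtMost_iff
      le_imp_less_Suc less_eq_Suc_le not_less_eq_eq nth_mem)
    then obtain P where P: "P \<in> \<pi>" "ms ! (i - 1) = Min P" by auto
    have r: "2 * i - 1 \<in> {1..2 * n}" "2 * i \<in> {1..2 * n}" "odd (2 * i - 1)" "even (2 * i)"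
      "(2 * i - 1) div 2 = i - 1" using i by auto
    then show ?thesis using P b[OF P(1)] by (simp add: p_def)
  qed
  have pp: "perm_pair p i = b (ms ! (i - 1))" if i: "i \<in> {1..n}" for i
  proof -
    have "card (b (ms ! (i - 1))) = 2" using blk[OF i] c2 by blast
    then obtain x y where "x < y" "b (ms ! (i - 1)) = {x, y}" "Min (b (ms ! (i - 1))) = x"
      "Max (b (ms ! (i - 1))) = y" by (rule pairE)
    then show ?thesis using blk[OF i] by (simp add: perm_pair_def)
  qed
  have im: "perm_pair p ` {1..n} = \<pi>"
  proof (intro equalityI subsetI)
    fix P assume "P \<in> perm_pair p ` {1..n}"
    then show "P \<in> \<pi>" using pp blk by auto
  next
    fix P assume P: "P \<in> \<pi>"
    then obtain k where k: "k < n" "ms ! k = Min P" using ms(1,2) by (metis image_eqI in_set_conv_nth)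
    then have "perm_pair p (Suc k) = P" using pp[of "Suc k"] b[OF P] by simp
    then show "P \<in> perm_pair p ` {1..n}" using k(1) by (intro image_eqI[of _ _ "Suc k"]) auto
  qed
  have img: "p ` {1..2 * n} = {1..2 * n}" using Union_perm_pair[of p n] U unfolding im by simp
  then have "bij_betw p {1..2 * n} {1..2 * n}"
    by (simp add: bij_betw_def eq_card_imp_inj_on)
  then have "p permutes {1..2 * n}" by (rule bij_imp_permutes) (auto simp: p_def)
  moreover have "p (2 * i - 1) < p (2 * i)" if i: "i \<in> {1..n}" for i
  proof -
    have "card (b (ms ! (i - 1))) = 2" using blk[OF i] c2 by blast
    then show ?thesis using blk[OF i] by (auto elim!: pairE)
  qed
  moreover have "p (2 * i - 1) < p (2 * i + 1)" if i: "i \<in> {1..<n}" for i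
  proof -
    have "p (2 * i - 1) = ms ! (i - 1)" using blk[of i] i by auto
    moreover have "p (2 * i + 1) = ms ! i" using blk[of "Suc i"] i by auto
    moreover have "ms ! (i - 1) < ms ! i"
      using sorted_wrt_nth_less[OF ms(3), of "i - 1" i] i ms(2) by auto
    ultimately show ?thesis by simp
  qed
  ultimately show ?thesis using im by (auto simp: pfaffian_perms_def)
qed

lemma pfaffian_eq_sum_pairings:
  "pfaffian n M = (\<Sum>\<pi>\<in>pairings {1..2 * n}. pairing_sign \<pi> * (\<Prod>P\<in>\<pi>. M (Min P) (Max P)))"
proof -
  have bij: "bij_betw (\<lambda>p. perm_pair p ` {1..n}) (pfaffian_perms n) (pairings {1..2 * n})"
    unfolding bij_betw_def
    using inj_on_perm_pairing perm_pairing_mem pairing_is_perm_pairing by blast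
  have "pfaffian n M = (\<Sum>p\<in>pfaffian_perms n. pairing_sign (perm_pair p ` {1..n}) *
      (\<Prod>P\<in>perm_pair p ` {1..n}. M (Min P) (Max P)))"
    unfolding pfaffian_def pfaffian_perms_def[symmetric]
  proof (rule sum.cong[OF refl])
    fix p assume p: "p \<in> pfaffian_perms n"
    then have "p permutes {1..2 * n}" by (simp add: pfaffian_perms_def)
    then have "of_int (sign p) = pairing_sign (perm_pair p ` {1..n})"
      using sign_eq_prod_pair_order[of "{1..2 * n}" p] prod_pair_order_blocks[OF p] by simp
    moreover have "(\<Prod>P\<in>perm_pair p ` {1..n}. M (Min P) (Max P)) =
        (\<Prod>i\<in>{1..n}. M (p (2 * i - 1)) (p (2 * i)))"
      using perm_pair_props(2,3)[OF p]
      by (subst prod.reindex[OF inj_on_perm_pair[OF p]]) simp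
    ultimately show "of_int (sign p) * (\<Prod>i\<in>{1..n}. M (p (2 * i - 1)) (p (2 * i))) =
      pairing_sign (perm_pair p ` {1..n}) * (\<Prod>P\<in>perm_pair p ` {1..n}. M (Min P) (Max P))"
      by simp
  qed
  also have "\<dots> = (\<Sum>\<pi>\<in>pairings {1..2 * n}. pairing_sign \<pi> * (\<Prod>P\<in>\<pi>. M (Min P) (Max P)))"
    by (rule sum.reindex_bij_betw[OF bij])
  finally show ?thesis .
qed

section \<open>The tripartite pairing\<close>

lemma pairing_partner:
  assumes \<pi>: "\<pi> \<in> pairings A"
  shows "\<exists>t. (\<forall>x\<in>A. {x, t x} \<in> \<pi> \<and> t x \<in> A \<and> t x \<noteq> x \<and> t (t x) = x) \<and>
    \<pi> = (\<lambda>x. {x, t x}) ` A"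
proof -
  have U: "\<Union>\<pi> = A" and dis: "disjoint \<pi>" and ne: "{} \<notin> \<pi>" and c2: "\<And>P. P \<in> \<pi> \<Longrightarrow> card P = 2"
    using \<pi> by (auto simp: pairings_def partition_on_def)
  have ex: "\<exists>y. {x, y} \<in> \<pi> \<and> y \<noteq> x" if x: "x \<in> A" for x
  proof -
    obtain P where P: "P \<in> \<pi>" "x \<in> P" using U x by blast
    then obtain u v where "P = {u, v}" "u \<noteq> v" using c2[of P] by (auto simp: card_2_iff)
    then show ?thesis using P by (metis insertE insert_commute singletonD)
  qed
  define t where "t x = (SOME y. {x, y} \<in> \<pi> \<and> y \<noteq> x)" for x
  have t: "{x, t x} \<in> \<pi>" "t x \<noteq> x" if "x \<in> A" for x
    using someI_ex[OF ex[OF that]] by (auto simp: t_def)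
  have tA: "t x \<in> A" if "x \<in> A" for x using t(1)[OF that] U by auto
  have same: "P = Q" if "P \<in> \<pi>" "Q \<in> \<pi>" "x \<in> P" "x \<in> Q" for P Q x
    using dis that unfolding disjoint_def by blast
  have tt: "t (t x) = x" if "x \<in> A" for x
  proof -
    have "{x, t x} = {t x, t (t x)}"
      using t(1)[OF that] t(1)[OF tA[OF that]] by (rule same[of _ _ "t x"]) auto
    then show ?thesis using t(2)[OF that] by (auto simp: doubleton_eq_iff)
  qed
  have "\<pi> = (\<lambda>x. {x, t x}) ` A"
  proof (intro equalityI subsetI)
    fix P assume P: "P \<in> \<pi>"
    then have "P \<noteq> {}" using ne by auto
    then obtain x where x: "x \<in> P" by blast
    then have "x \<in> A" using P U by blast
    then show "P \<in> (\<lambda>x. {x, t x}) ` A" using same[OF P t(1) x] by blast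
  qed (use t in auto)
  then show ?thesis using t tA tt by blast
qed

lemma crossingI:
  assumes "P \<in> \<pi>" "Q \<in> \<pi>" "P \<noteq> Q" "w \<in> P" "x \<in> Q" "y \<in> P" "z \<in> Q" "w < x" "x < y" "y < z"
  shows "crossing \<pi>"
  unfolding crossing_def using assms(3-)
  by (intro bexI[OF _ assms(1)] bexI[OF _ assms(2)]) blast

text \<open>Here \<open>a\<close>, \<open>c\<close>, \<open>d\<close> are the numbers of red-green,
  red-blue and green-blue pairs. The pairs form three nested families: one around the boundary
  between red and green, with constant sum \<open>2 * a + 2 * c + 1\<close>, one around the boundary
  between green and blue, with sum \<open>4 * a + 2 * c + 2 * d + 1\<close>, and an outer one
  joining the first \<open>c\<close> red nodes to the last \<open>c\<close> blue ones.\<close>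

definition tripartite_mate :: "nat \<Rightarrow> nat \<Rightarrow> nat \<Rightarrow> nat \<Rightarrow> nat" where
  "tripartite_mate a c d x =
    (if x \<le> c \<or> 2 * a + c + 2 * d < x then 2 * a + 2 * c + 2 * d + 1 - x
     else if x \<le> 2 * a + c then 2 * a + 2 * c + 1 - x
     else 4 * a + 2 * c + 2 * d + 1 - x)"

context
  fixes a c d n :: nat and R Gr B :: "nat set"
  assumes n: "2 * n = 2 * a + 2 * c + 2 * d" and R: "R = {1..a + c}" and Gr: "Gr = {a + c<..2 * a + c + d}"
    and B: "B = {2 * a + c + d<..2 * n}"
begin

text \<open>Replaces the truncated subtractions by equations between sums, so that each case below
  is linear arithmetic.\<close>

lemma tripartite_mate_iff:
  assumes "x \<in> {1..2 * n}"
  shows "tripartite_mate a c d x = y \<longleftrightarrow>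
    (x \<le> c \<or> 2 * a + c + 2 * d < x) \<and> x + y = 2 * n + 1 \<or>
    c < x \<and> x \<le> 2 * a + c \<and> x + y = 2 * a + 2 * c + 1 \<or>
    2 * a + c < x \<and> x \<le> 2 * a + c + 2 * d \<and> x + y = 4 * a + 2 * c + 2 * d + 1"
proof -
  have x: "1 \<le> x" "x \<le> 2 * a + 2 * c + 2 * d" using assms n by auto
  consider "x \<le> c \<or> 2 * a + c + 2 * d < x" | "c < x" "x \<le> 2 * a + c"
    | "2 * a + c < x" "x \<le> 2 * a + c + 2 * d" by linarith
  then show ?thesis
  proof cases
    case 1
    then have m: "tripartite_mate a c d x = 2 * n + 1 - x" by (simp add: tripartite_mate_def n)
    have "\<not> (c < x \<and> x \<le> 2 * a + c)" "\<not> (2 * a + c < x \<and> x \<le> 2 * a + c + 2 * d)"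
      using 1 by linarith+
    moreover have "2 * n + 1 - x = y \<longleftrightarrow> x + y = 2 * n + 1" using x unfolding n by (intro iffI) linarith+
    ultimately show ?thesis using 1 unfolding m by blast
  next
    case 2
    then have m: "tripartite_mate a c d x = 2 * a + 2 * c + 1 - x" by (simp add: tripartite_mate_def)
    have "\<not> x \<le> c" "\<not> 2 * a + c + 2 * d < x" "\<not> 2 * a + c < x" using 2 by linarith+
    moreover have "2 * a + 2 * c + 1 - x = y \<longleftrightarrow> x + y = 2 * a + 2 * c + 1" using 2 by (intro iffI) linarith+
    ultimately show ?thesis using 2 unfolding m by blast
  next
    case 3
    then have m: "tripartite_mate a c d x = 4 * a + 2 * c + 2 * d + 1 - x" by (simp add: tripartite_mate_def)
    have "\<not> x \<le> c" "\<not> 2 * a + c + 2 * d < x" "\<not> x \<le> 2 * a + c" using 3 by linarith+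
    moreover have "4 * a + 2 * c + 2 * d + 1 - x = y \<longleftrightarrow> x + y = 4 * a + 2 * c + 2 * d + 1"
      using 3 by (intro iffI) linarith+
    ultimately show ?thesis using 3 unfolding m by blast
  qed
qed

lemma tripartite_mate_props:
  assumes x: "x \<in> {1..2 * n}"
  shows "tripartite_mate a c d x \<in> {1..2 * n}" "tripartite_mate a c d x \<noteq> x"
    "tripartite_mate a c d (tripartite_mate a c d x) = x"
proof -
  define y where "y = tripartite_mate a c d x"
  have y: "(x \<le> c \<or> 2 * a + c + 2 * d < x) \<and> x + y = 2 * n + 1 \<or>
    c < x \<and> x \<le> 2 * a + c \<and> x + y = 2 * a + 2 * c + 1 \<or>
    2 * a + c < x \<and> x \<le> 2 * a + c + 2 * d \<and> x + y = 4 * a + 2 * c + 2 * d + 1"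
    using tripartite_mate_iff[OF x, of y] y_def by blast
  have x1: "1 \<le> x" "x \<le> 2 * n" using x by auto
  have "1 \<le> y" using y x1 unfolding n by (elim disjE conjE) linarith+
  moreover have "y \<le> 2 * n" using y x1 unfolding n by (elim disjE conjE) linarith+
  ultimately show y2: "tripartite_mate a c d x \<in> {1..2 * n}" by (simp add: y_def)
  show "tripartite_mate a c d x \<noteq> x" 
  proof
    assume "tripartite_mate a c d x = x"
    \<comment> \<open>All three sums are odd.\<close>
    then have "2 * x = 2 * n + 1 \<or> 2 * x = 2 * a + 2 * c + 1 \<or> 2 * x = 4 * a + 2 * c + 2 * d + 1"
      using y unfolding y_def[symmetric] by auto
    then show False by (elim disjE) arith+
  qed
  have "(y \<le> c \<or> 2 * a + c + 2 * d < y) \<and> y + x = 2 * n + 1 \<or>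
    c < y \<and> y \<le> 2 * a + c \<and> y + x = 2 * a + 2 * c + 1 \<or>
    2 * a + c < y \<and> y \<le> 2 * a + c + 2 * d \<and> y + x = 4 * a + 2 * c + 2 * d + 1"
    (is "?A \<or> ?B \<or> ?C")
    using y
  proof (elim disjE conjE)
    assume "x \<le> c" "x + y = 2 * n + 1"
    then have "2 * a + c + 2 * d < y" "y + x = 2 * n + 1" unfolding n by linarith+
    then show ?thesis by blast
  next
    assume "2 * a + c + 2 * d < x" "x + y = 2 * n + 1"
    then have "y \<le> c" "y + x = 2 * n + 1" using x1 unfolding n by linarith+
    then show ?thesis by blast
  next
    assume "c < x" "x \<le> 2 * a + c" "x + y = 2 * a + 2 * c + 1"
    then have "c < y" "y \<le> 2 * a + c" "y + x = 2 * a + 2 * c + 1" by linarith+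
    then show ?thesis by blast
  next
    assume "2 * a + c < x" "x \<le> 2 * a + c + 2 * d" "x + y = 4 * a + 2 * c + 2 * d + 1"
    then have "2 * a + c < y" "y \<le> 2 * a + c + 2 * d" "y + x = 4 * a + 2 * c + 2 * d + 1" by linarith+
    then show ?thesis by blast
  qed
  then show "tripartite_mate a c d (tripartite_mate a c d x) = x"
    using tripartite_mate_iff[OF y2, of x] unfolding y_def by blast
qed

lemma tripartite_mate_colors:
  assumes x: "x \<in> {1..2 * n}" and C: "C \<in> {R, Gr, B}" "x \<in> C"
  shows "tripartite_mate a c d x \<notin> C"
proof
  define y where "y = tripartite_mate a c d x"
  have y: "(x \<le> c \<or> 2 * a + c + 2 * d < x) \<and> x + y = 2 * n + 1 \<or>
    c < x \<and> x \<le> 2 * a + c \<and> x + y = 2 * a + 2 * c + 1 \<or>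
    2 * a + c < x \<and> x \<le> 2 * a + c + 2 * d \<and> x + y = 4 * a + 2 * c + 2 * d + 1"
    using tripartite_mate_iff[OF x, of y] y_def by blast
  assume "tripartite_mate a c d x \<in> C"
  then have "y \<in> C" by (simp add: y_def)
  then have "x \<le> a + c \<and> y \<le> a + c \<or> a + c < x \<and> x \<le> 2 * a + c + d \<and> a + c < y \<and> y \<le> 2 * a + c + d \<or>
    2 * a + c + d < x \<and> 2 * a + c + d < y"
    using C unfolding R Gr B by auto
  moreover have "1 \<le> x" "x \<le> 2 * n" "1 \<le> y" "y \<le> 2 * n"
    using x tripartite_mate_props(1)[OF x] by (auto simp: y_def)
  ultimately show False using y unfolding n by (elim disjE conjE) linarith+
qed

text \<open>In a crossing, \<open>x\<close>, \<open>y\<close>, the mate of \<open>x\<close> and the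
  mate of \<open>y\<close> would come in this increasing order, which the inequality
  forbids.\<close>

lemma tripartite_mate_noncrossing:
  assumes x: "x \<in> {1..2 * n}" "x < y" "y < tripartite_mate a c d x"
  shows "tripartite_mate a c d y < tripartite_mate a c d x"
proof -
  define u v where "u = tripartite_mate a c d x" and "v = tripartite_mate a c d y"
  have u: "(x \<le> c \<or> 2 * a + c + 2 * d < x) \<and> x + u = 2 * n + 1 \<or>
    c < x \<and> x \<le> 2 * a + c \<and> x + u = 2 * a + 2 * c + 1 \<or>
    2 * a + c < x \<and> x \<le> 2 * a + c + 2 * d \<and> x + u = 4 * a + 2 * c + 2 * d + 1"
    using tripartite_mate_iff[OF x(1), of u] u_def by blast
  have yN: "y \<in> {1..2 * n}" using x tripartite_mate_props(1)[OF x(1)] by auto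
  have "(y \<le> c \<or> 2 * a + c + 2 * d < y) \<and> y + v = 2 * n + 1 \<or>
    c < y \<and> y \<le> 2 * a + c \<and> y + v = 2 * a + 2 * c + 1 \<or>
    2 * a + c < y \<and> y \<le> 2 * a + c + 2 * d \<and> y + v = 4 * a + 2 * c + 2 * d + 1"
    using tripartite_mate_iff[OF yN, of v] v_def by blast
  moreover have "x < y" "y < u" using x by (auto simp: u_def)
  ultimately show ?thesis using u unfolding u_def[symmetric] v_def[symmetric] n
    by (elim disjE conjE) linarith+
qed

lemma is_tripartite_pairing_mate:
  "is_tripartite_pairing n R Gr B ((\<lambda>x. {x, tripartite_mate a c d x}) ` {1..2 * n})"
  (is "is_tripartite_pairing n R Gr B (?P ` _)")
proof -
  let ?m = "tripartite_mate a c d"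
  note m = tripartite_mate_props
  have P: "P = {x, ?m x}" if "P \<in> ?P ` {1..2 * n}" "x \<in> P" for P x
    using that m(3) by auto
  have mem: "x \<in> {1..2 * n}" if "P \<in> ?P ` {1..2 * n}" "x \<in> P" for P x
    using that m(1) by auto
  have "partition_on {1..2 * n} (?P ` {1..2 * n})"
  proof (rule partition_onI)
    show "\<Union>(?P ` {1..2 * n}) = {1..2 * n}" using m(1) by auto
    show "disjnt p q" if pq: "p \<in> ?P ` {1..2 * n}" "q \<in> ?P ` {1..2 * n}" "p \<noteq> q" for p q
      unfolding disjnt_def
    proof (rule ccontr)
      assume "p \<inter> q \<noteq> {}"
      then obtain x where "x \<in> p" "x \<in> q" by blast
      then show False using P[OF pq(1)] P[OF pq(2)] pq(3) by metis
    qed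
  qed auto
  moreover have "\<not> crossing (?P ` {1..2 * n})"
  proof
    assume "crossing (?P ` {1..2 * n})"
    then obtain P Q w x y z where PQ: "P \<in> ?P ` {1..2 * n}" "Q \<in> ?P ` {1..2 * n}"
      and lt: "w < x" "x < y" "y < z" and in_PQ: "w \<in> P" "y \<in> P" "x \<in> Q" "z \<in> Q"
      unfolding crossing_def by blast
    have "y = ?m w" using P[OF PQ(1) in_PQ(1)] in_PQ(2) lt by auto
    moreover have "z = ?m x" using P[OF PQ(2) in_PQ(3)] in_PQ(4) lt by auto
    ultimately show False
      using tripartite_mate_noncrossing[of w x] mem[OF PQ(1) in_PQ(1)] mem[OF PQ(1) in_PQ(2)] lt
      by auto
  qed
  moreover have "card P = 2" if "P \<in> ?P ` {1..2 * n}" for P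
  proof -
    obtain x where "x \<in> {1..2 * n}" "P = {x, ?m x}" using \<open>P \<in> ?P ` {1..2 * n}\<close> by blast
    then show ?thesis using m(2)[of x] by simp
  qed
  moreover have "i = j" if "P \<in> ?P ` {1..2 * n}" "C \<in> {R, Gr, B}" "i \<in> P" "j \<in> P" "i \<in> C" "j \<in> C"
    for P C i j
  proof -
    have "j = i \<or> j = ?m i" using P[OF that(1,3)] that(4) by auto
    then show ?thesis using tripartite_mate_colors[OF mem[OF that(1,3)] that(2,5)] that(6) by auto
  qed
  ultimately show ?thesis unfolding is_tripartite_pairing_def by blast
qed

text \<open>A pair \<open>{x, t x}\<close> shuts off the interval between its ends, so
  \<open>t\<close> maps that interval to itself. For a red-green or green-blue pair only these two
  colors occur inside, hence equally often, and this fixes the sum of the ends. For a red-blue pair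
  the same count is made outside the interval, where no green node lies. It remains to see which red
  nodes have green partners: color counts give their number, and they form a final segment of the
  red nodes.\<close>

lemma is_tripartite_pairing_unique:
  assumes \<pi>: "is_tripartite_pairing n R Gr B \<pi>"
  shows "\<pi> = (\<lambda>x. {x, tripartite_mate a c d x}) ` {1..2 * n}"
proof -
  have pin: "\<pi> \<in> pairings {1..2 * n}" using \<pi> by (simp add: is_tripartite_pairing_def pairings_def)
  obtain t where t0: "\<forall>x\<in>{1..2 * n}. {x, t x} \<in> \<pi> \<and> t x \<in> {1..2 * n} \<and> t x \<noteq> x \<and> t (t x) = x"
    and \<pi>_eq: "\<pi> = (\<lambda>x. {x, t x}) ` {1..2 * n}"
    using pairing_partner[OF pin] by (elim exE conjE) (rule that)
  have t: "{x, t x} \<in> \<pi>" "t x \<in> {1..2 * n}" "t x \<noteq> x" "t (t x) = x" if "x \<in> {1..2 * n}" for x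
    using t0 that by blast+
  have nc: "x < t z \<and> t z < t x" if x: "x \<in> {1..2 * n}" "x < z" "z < t x" for x z
  proof (rule ccontr)
    assume neg: "\<not> (x < t z \<and> t z < t x)"
    have z: "z \<in> {1..2 * n}" using x t(2)[OF x(1)] by auto
    note P = t(1)[OF z] t(1)[OF x(1)]
    have "t z \<noteq> x" "t z \<noteq> t x" using t(4)[OF z] t(4)[OF x(1)] x by auto
    then have ne: "{z, t z} \<noteq> {x, t x}" using x by (auto simp: doubleton_eq_iff)
    consider "t z < x" | "t x < t z" using neg \<open>t z \<noteq> x\<close> \<open>t z \<noteq> t x\<close> by linarith
    then have "crossing \<pi>"
    proof cases
      case 1
      then show ?thesis using x by (intro crossingI[OF P ne, of "t z" x z "t x"]) auto
    next
      case 2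
      then show ?thesis using x by (intro crossingI[OF P(2,1) ne[symmetric], of x z "t x" "t z"]) auto
    qed
    then show False using \<pi> by (simp add: is_tripartite_pairing_def)
  qed
  have col: "t x \<notin> C" if "x \<in> {1..2 * n}" "C \<in> {R, Gr, B}" "x \<in> C" for x C
  proof
    assume "t x \<in> C"
    moreover have "\<forall>P\<in>\<pi>. \<forall>C\<in>{R, Gr, B}. \<forall>i\<in>P. \<forall>j\<in>P. i \<in> C \<and> j \<in> C \<longrightarrow> i = j"
      using \<pi> by (simp add: is_tripartite_pairing_def)
    ultimately have "x = t x"
      using t(1)[OF that(1)] that(2,3) by (meson insertI1 insertI2)
    then show False using t(3)[OF that(1)] by simp
  qed
  have inj: "inj_on t S" if "S \<subseteq> {1..2 * n}" for S
    using t(4) that by (intro inj_on_inverseI[of _ t]) auto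
  have swap: "card {x \<in> S. t x \<in> T} = card {x \<in> T. t x \<in> S}"
    if "S \<subseteq> {1..2 * n}" "T \<subseteq> {1..2 * n}" for S T
  proof (rule bij_betw_same_card)
    show "bij_betw t {x \<in> S. t x \<in> T} {x \<in> T. t x \<in> S}"
      unfolding bij_betw_def
    proof
      show "inj_on t {x \<in> S. t x \<in> T}" using that by (intro inj) auto
      show "t ` {x \<in> S. t x \<in> T} = {x \<in> T. t x \<in> S}"
      proof (intro equalityI subsetI)
        fix y assume "y \<in> t ` {x \<in> S. t x \<in> T}"
        then show "y \<in> {x \<in> T. t x \<in> S}" using t(4) that(1) by auto
      next
        fix y assume "y \<in> {x \<in> T. t x \<in> S}"
        then show "y \<in> t ` {x \<in> S. t x \<in> T}"
          using t(4) that(2) by (intro image_eqI[of _ _ "t y"]) auto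
      qed
    qed
  qed
  have swap_all: "card S = card T"
    if "S \<subseteq> {1..2 * n}" "T \<subseteq> {1..2 * n}" "\<And>z. z \<in> S \<Longrightarrow> t z \<in> T" "\<And>z. z \<in> T \<Longrightarrow> t z \<in> S" for S T
  proof -
    have "{x \<in> S. t x \<in> T} = S" "{x \<in> T. t x \<in> S} = T" using that(3,4) by blast+
    then show ?thesis using swap[OF that(1,2)] by simp
  qed
  have sub: "R \<subseteq> {1..2 * n}" "Gr \<subseteq> {1..2 * n}" "B \<subseteq> {1..2 * n}"
    unfolding R Gr B n by auto
  have cover: "x \<in> R \<or> x \<in> Gr \<or> x \<in> B" if "x \<in> {1..2 * n}" for x
    using that unfolding R Gr B n by auto
  have tR: "t x \<in> Gr \<or> t x \<in> B" if "x \<in> R" for x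
    using cover[of "t x"] col[of x R] t(2)[of x] sub(1) that by auto
  have tG: "t x \<in> R \<or> t x \<in> B" if "x \<in> Gr" for x
    using cover[of "t x"] col[of x Gr] t(2)[of x] sub(2) that by auto
  have tB: "t x \<in> R \<or> t x \<in> Gr" if "x \<in> B" for x
    using cover[of "t x"] col[of x B] t(2)[of x] sub(3) that by auto
  have between: "card (S \<inter> {x<..<t x}) = card (T \<inter> {x<..<t x})"
    if x: "x \<in> {1..2 * n}" and S: "S \<subseteq> {1..2 * n}" "T \<subseteq> {1..2 * n}"
      and ST: "\<And>z. z \<in> S \<inter> {x<..<t x} \<Longrightarrow> t z \<in> T" "\<And>z. z \<in> T \<inter> {x<..<t x} \<Longrightarrow> t z \<in> S" for x S T
  proof -
    have n': "t z \<in> {x<..<t x}" if "z \<in> {x<..<t x}" for z using nc[OF x] that by auto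
    show ?thesis
    proof (rule swap_all)
      show "S \<inter> {x<..<t x} \<subseteq> {1..2 * n}" "T \<inter> {x<..<t x} \<subseteq> {1..2 * n}"
        by (rule le_infI1[OF S(1)], rule le_infI1[OF S(2)])
      show "t z \<in> T \<inter> {x<..<t x}" if "z \<in> S \<inter> {x<..<t x}" for z
        using ST(1)[OF that] n'[of z] that by blast
      show "t z \<in> S \<inter> {x<..<t x}" if "z \<in> T \<inter> {x<..<t x}" for z
        using ST(2)[OF that] n'[of z] that by blast
    qed
  qed
  have RG: "x + t x = 2 * a + 2 * c + 1" if x: "x \<in> R" "t x \<in> Gr" for x
  proof -
    have xN: "x \<in> {1..2 * n}" by (rule subsetD[OF sub(1) x(1)])
    have i: "t z \<in> {x<..<t x}" if "z \<in> {x<..<t x}" for z using nc[OF xN, of z] that by auto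
    have "card (R \<inter> {x<..<t x}) = card (Gr \<inter> {x<..<t x})"
    proof (rule between[OF xN sub(1,2)])
      show "t z \<in> Gr" if "z \<in> R \<inter> {x<..<t x}" for z
        using tR[of z] i[of z] that x(2) unfolding Gr B by auto
      show "t z \<in> R" if "z \<in> Gr \<inter> {x<..<t x}" for z
        using tG[of z] i[of z] that x(2) unfolding Gr B by auto
    qed
    \<comment> \<open>Equal cardinalities mean \<open>a + c - x = t x - 1 - (a + c)\<close>.\<close>
    moreover have "R \<inter> {x<..<t x} = {x<..a + c}" "Gr \<inter> {x<..<t x} = {a + c<..<t x}"
      using x unfolding R Gr by auto
    ultimately show ?thesis using x unfolding R Gr by auto
  qed
  have GB: "x + t x = 4 * a + 2 * c + 2 * d + 1" if x: "x \<in> Gr" "t x \<in> B" for x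
  proof -
    have xN: "x \<in> {1..2 * n}" by (rule subsetD[OF sub(2) x(1)])
    have i: "t z \<in> {x<..<t x}" if "z \<in> {x<..<t x}" for z using nc[OF xN, of z] that by auto
    have "card (Gr \<inter> {x<..<t x}) = card (B \<inter> {x<..<t x})"
    proof (rule between[OF xN sub(2,3)])
      show "t z \<in> B" if "z \<in> Gr \<inter> {x<..<t x}" for z
        using tG[of z] i[of z] that x(1) unfolding Gr R by auto
      show "t z \<in> Gr" if "z \<in> B \<inter> {x<..<t x}" for z
        using tB[of z] i[of z] that x(1) unfolding Gr R by auto
    qed
    moreover have "Gr \<inter> {x<..<t x} = {x<..2 * a + c + d}" "B \<inter> {x<..<t x} = {2 * a + c + d<..<t x}"
      using x unfolding Gr B by auto
    ultimately show ?thesis using x unfolding Gr B by auto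
  qed
  have RB: "x + t x = 2 * n + 1" if x: "x \<in> R" "t x \<in> B" for x
  proof -
    have xN: "x \<in> {1..2 * n}" and txN: "t x \<in> {1..2 * n}"
      by (rule subsetD[OF sub(1) x(1)], rule subsetD[OF sub(3) x(2)])
    have out: "t z \<notin> {x..t x}" if z: "z \<in> {1..2 * n}" "z \<notin> {x..t x}" for z
    proof
      assume "t z \<in> {x..t x}"
      moreover have "t z \<noteq> x" "t z \<noteq> t x"
        using z t(4)[OF z(1)] t(4)[OF xN] xN x by (auto simp: R B)
      ultimately have "x < t z" "t z < t x" by auto
      then have "x < t (t z) \<and> t (t z) < t x" by (rule nc[OF xN])
      then show False using z t(4)[OF z(1)] by auto
    qed
    have "card (R - {x..t x}) = card (B - {x..t x})"
    proof (rule swap_all)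
      show "R - {x..t x} \<subseteq> {1..2 * n}" "B - {x..t x} \<subseteq> {1..2 * n}" using sub(1,3) by blast+
      show "t z \<in> B - {x..t x}" if z: "z \<in> R - {x..t x}" for z
      proof -
        have "z \<in> {1..2 * n}" using z sub(1) by blast
        then have "t z \<notin> {x..t x}" using z by (intro out) auto
        moreover have "t z \<notin> Gr"
        proof
          assume "t z \<in> Gr"
          then have "x \<le> t z" "t z \<le> t x" using x unfolding Gr R B by auto
          then show False using calculation by simp
        qed
        ultimately show ?thesis using tR[of z] z by blast
      qed
      show "t z \<in> R - {x..t x}" if z: "z \<in> B - {x..t x}" for z
      proof -
        have "z \<in> {1..2 * n}" using z sub(3) by blast
        then have "t z \<notin> {x..t x}" using z by (intro out) auto
        moreover have "t z \<notin> Gr"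
        proof
          assume "t z \<in> Gr"
          then have "x \<le> t z" "t z \<le> t x" using x unfolding Gr R B by auto
          then show False using calculation by simp
        qed
        ultimately show ?thesis using tB[of z] z by blast
      qed
    qed
    \<comment> \<open>As many red nodes before \<open>x\<close> as blue nodes after
      \<open>t x\<close>: \<open>x - 1 = 2 * n - t x\<close>.\<close>
    moreover have "R - {x..t x} = {1..<x}" "B - {x..t x} = {t x<..2 * n}"
      using x unfolding R B by auto
    ultimately show ?thesis using xN txN by auto
  qed
  define X where "X = {x \<in> R. t x \<in> Gr}"
  have cX: "card X = a"
  proof -
    have split: "card S = card {x \<in> S. t x \<in> T} + card {x \<in> S. t x \<in> U}"
      if "finite S" "T \<inter> U = {}" "\<And>x. x \<in> S \<Longrightarrow> t x \<in> T \<or> t x \<in> U" for S T U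
    proof -
      have "S = {x \<in> S. t x \<in> T} \<union> {x \<in> S. t x \<in> U}" using that by auto
      moreover have "card ({x \<in> S. t x \<in> T} \<union> {x \<in> S. t x \<in> U}) =
          card {x \<in> S. t x \<in> T} + card {x \<in> S. t x \<in> U}"
        using that by (intro card_Un_disjoint) auto
      ultimately show ?thesis by simp
    qed
    \<comment> \<open>Three unknowns, the numbers of pairs of each color combination, and three
      color counts; the solution has \<open>a\<close> red-green pairs.\<close>
    have "card R = card X + card {x \<in> R. t x \<in> B}"
      unfolding X_def using tR by (intro split) (auto simp: R Gr B)
    moreover have "card Gr = card {x \<in> Gr. t x \<in> R} + card {x \<in> Gr. t x \<in> B}"
      using tG by (intro split) (auto simp: R Gr B)
    moreover have "card B = card {x \<in> B. t x \<in> R} + card {x \<in> B. t x \<in> Gr}"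
      using tB by (intro split) (auto simp: R Gr B)
    moreover have "card {x \<in> Gr. t x \<in> R} = card X" "card {x \<in> B. t x \<in> R} = card {x \<in> R. t x \<in> B}"
      "card {x \<in> B. t x \<in> Gr} = card {x \<in> Gr. t x \<in> B}"
      unfolding X_def using sub by (auto intro!: swap)
    moreover have "card R = a + c" "card Gr = a + d" "card B = c + d" unfolding R Gr B n by auto
    ultimately show ?thesis by linarith
  qed
  have X: "X = {c<..a + c}"
  proof (rule card_subset_eq[symmetric])
    show "finite X" unfolding X_def R by auto
    show "card {c<..a + c} = card X" using cX by simp
    show "{c<..a + c} \<subseteq> X"
    proof
      fix y assume y: "y \<in> {c<..a + c}"
      show "y \<in> X"
      proof (rule ccontr)
        assume "y \<notin> X"
        \<comment> \<open>If \<open>x\<close> has a green partner, a later red node \<open>z\<close>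
          is enclosed by this pair, so its partner is below \<open>t x\<close> and cannot be
          blue.\<close>
        have up: "z \<in> X" if z: "x \<in> X" "x < z" "z \<le> a + c" for x z
        proof -
          have x: "x \<in> R" "t x \<in> Gr" "x \<in> {1..2 * n}" using z(1) sub by (auto simp: X_def)
          have "z < t x" using x(2) z(3) by (auto simp: Gr)
          then have "t z < t x" using nc[OF x(3) z(2)] by simp
          moreover have "z \<in> R" using z by (auto simp: R)
          ultimately show ?thesis using tR[of z] x(2) by (auto simp: X_def Gr B)
        qed
        \<comment> \<open>If \<open>y\<close> is missing from \<open>X\<close>, upward closure
          confines \<open>X\<close> to the points above \<open>y\<close>, too few for
          \<open>a\<close> elements because \<open>c < y\<close>.\<close>
        have "X \<subseteq> {y<..a + c}"
        proof
          fix x assume x: "x \<in> X"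
          then have "x \<le> a + c" by (auto simp: X_def R)
          moreover have "y < x"
          proof (rule ccontr)
            assume "\<not> y < x"
            then have "x < y" using x \<open>y \<notin> X\<close> by (cases "x = y") auto
            then show False using up[OF x] y \<open>y \<notin> X\<close> by auto
          qed
          ultimately show "x \<in> {y<..a + c}" by simp
        qed
        then have "card X \<le> card {y<..a + c}" by (intro card_mono) auto
        then show False using cX y by auto
      qed
    qed
  qed
  have GR: "x \<le> 2 * a + c \<longleftrightarrow> t x \<in> R" if x: "x \<in> Gr" for x
  proof
    assume "t x \<in> R"
    then have "t x \<in> X" using t(2,4)[of x] x sub by (auto simp: X_def)
    moreover have "t x + x = 2 * a + 2 * c + 1" using RG[of "t x"] \<open>t x \<in> R\<close> t(2,4)[of x] x sub by auto
    ultimately show "x \<le> 2 * a + c" unfolding X by auto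
  next
    assume "x \<le> 2 * a + c"
    define y where "y = 2 * a + 2 * c + 1 - x"
    have "y \<in> X" unfolding X y_def using \<open>x \<le> 2 * a + c\<close> x by (auto simp: Gr)
    then have y: "y \<in> R" "t y \<in> Gr" by (auto simp: X_def)
    have "y + x = 2 * a + 2 * c + 1" using \<open>x \<le> 2 * a + c\<close> by (simp add: y_def)
    then have "t y = x" using RG[OF y] by linarith
    moreover have "t (t y) = y" using sub(1) y(1) by (intro t(4)) blast
    ultimately show "t x \<in> R" using y(1) by simp
  qed
  have "t x = tripartite_mate a c d x" if x: "x \<in> {1..2 * n}" for x
  proof -
    note tx = t(2,4)[OF x] and mate = tripartite_mate_iff[OF x, of "t x", THEN iffD2, symmetric]
    consider "x \<in> R" "t x \<in> Gr" | "x \<in> R" "t x \<in> B" | "x \<in> Gr" "t x \<in> R" | "x \<in> Gr" "t x \<in> B"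
      | "x \<in> B" "t x \<in> R" | "x \<in> B" "t x \<in> Gr"
      using cover[OF x] tR[of x] tG[of x] tB[of x] by fast
    then show ?thesis
    proof cases
      case 1
      then have "x \<in> X" by (simp add: X_def)
      then have "c < x" "x \<le> 2 * a + c" unfolding X by auto
      then show ?thesis using RG[OF 1] by (intro mate) simp
    next
      case 2
      then have "x \<notin> X" by (auto simp: X_def Gr B)
      then have "x \<le> c" using 2(1) unfolding X by (auto simp: R)
      then show ?thesis using RB[OF 2] by (intro mate) simp
    next
      case 3
      then have "x \<le> 2 * a + c" using GR by blast
      moreover have "c < x" using 3(1) by (simp add: Gr)
      moreover have "x + t x = 2 * a + 2 * c + 1" using RG[OF 3(2)] 3(1) tx(2) by simp
      ultimately show ?thesis by (intro mate) simp
    next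
      case 4
      then have "2 * a + c < x" using GR[OF 4(1)] by (auto simp: R B)
      moreover have "x \<le> 2 * a + c + 2 * d" using 4(1) by (simp add: Gr)
      ultimately show ?thesis using GB[OF 4] by (intro mate) simp
    next
      case 5
      have "t x \<notin> X" using 5(1) tx(2) by (auto simp: X_def Gr B)
      then have "t x \<le> c" using 5(2) unfolding X by (auto simp: R)
      moreover have s: "x + t x = 2 * n + 1" using RB[OF 5(2)] 5(1) tx(2) by simp
      ultimately have "2 * a + c + 2 * d < x" unfolding n by linarith
      then show ?thesis using s by (intro mate) simp
    next
      case 6
      have "\<not> t x \<le> 2 * a + c" using GR[OF 6(2)] 6(1) tx(2) by (auto simp: R B)
      moreover have s: "x + t x = 4 * a + 2 * c + 2 * d + 1" using GB[OF 6(2)] 6(1) tx(2) by simp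
      ultimately have "x \<le> 2 * a + c + 2 * d" by linarith
      moreover have "2 * a + c < x" using 6(1) by (simp add: B)
      ultimately show ?thesis using s by (intro mate) simp
    qed
  qed
  then show ?thesis unfolding \<pi>_eq by (intro image_cong) auto
qed

lemma is_tripartite_pairing_iff:
  "is_tripartite_pairing n R Gr B \<pi> \<longleftrightarrow> \<pi> = tripartite_pairing n R Gr B"
proof -
  have "tripartite_pairing n R Gr B = (\<lambda>x. {x, tripartite_mate a c d x}) ` {1..2 * n}"
    unfolding tripartite_pairing_def
    using is_tripartite_pairing_mate is_tripartite_pairing_unique by (rule the_equality)
  then show ?thesis using is_tripartite_pairing_mate is_tripartite_pairing_unique by metis
qed

end

section \<open>The ratio of grove probabilities\<close>

lemma initial_segment_eq:
  fixes S :: "nat set"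
  assumes "finite S" "\<And>x. x \<in> S \<Longrightarrow> 1 \<le> x" "\<And>x y. x \<in> S \<Longrightarrow> 1 \<le> y \<Longrightarrow> y < x \<Longrightarrow> y \<in> S"
  shows "S = {1..card S}"
proof (cases "S = {}")
  case False
  have "S = {1..Max S}"
  proof (intro equalityI subsetI)
    fix y assume "y \<in> {1..Max S}"
    then show "y \<in> S"
      using assms(3)[OF Max_in[OF assms(1) False], of y] Max_in[OF assms(1) False]
      by (cases "y = Max S") auto
  qed (use assms(1,2) in auto)
  moreover from this have "card S = Max S" by (metis card_atLeastAtMost diff_Suc_1)
  ultimately show ?thesis by simp
qed simp

lemma color_class_intervals:
  fixes R Gr B :: "nat set"
  assumes U: "R \<union> Gr \<union> B = {1..m}"
    and disj: "R \<inter> Gr = {}" "R \<inter> B = {}" "Gr \<inter> B = {}"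
    and ord: "\<forall>i\<in>R. \<forall>j\<in>Gr. i < j" "\<forall>i\<in>R. \<forall>j\<in>B. i < j" "\<forall>i\<in>Gr. \<forall>j\<in>B. i < j"
  shows "R = {1..card R}" "Gr = {card R<..card R + card Gr}" "B = {card R + card Gr<..m}"
    "m = card R + card Gr + card B"
proof -
  have fin: "finite R" "finite Gr" "finite B"
    using U by (metis finite_Un finite_atLeastAtMost)+
  have mem: "y \<in> R \<or> y \<in> Gr \<or> y \<in> B" if "1 \<le> y" "y \<le> m" for y
  proof -
    have "y \<in> R \<union> Gr \<union> B" unfolding U using that by simp
    then show ?thesis by blast
  qed
  have bd: "1 \<le> y \<and> y \<le> m" if "y \<in> R \<or> y \<in> Gr \<or> y \<in> B" for y
  proof -
    have "y \<in> R \<union> Gr \<union> B" using that by blast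
    then show ?thesis unfolding U by simp
  qed
  show R: "R = {1..card R}"
  proof (rule initial_segment_eq[OF fin(1)])
    fix x y assume x: "x \<in> R" "1 \<le> y" "y < x"
    then have "y \<notin> Gr" "y \<notin> B" using ord by (meson order.asym)+
    then show "y \<in> R" using mem[of y] bd[of x] x by auto
  qed (use bd in blast)
  have cRG: "card (R \<union> Gr) = card R + card Gr" using fin disj by (simp add: card_Un_disjoint)
  have RG: "R \<union> Gr = {1..card R + card Gr}"
    unfolding cRG[symmetric]
  proof (rule initial_segment_eq)
    show "finite (R \<union> Gr)" using fin by simp
    show "1 \<le> x" if "x \<in> R \<union> Gr" for x using that bd by blast
    fix x y assume x: "x \<in> R \<union> Gr" "1 \<le> y" "y < x"
    then have "y \<notin> B" using ord(2,3) by (meson UnE order.asym)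
    moreover have "y \<le> m" using bd[of x] x by auto
    ultimately show "y \<in> R \<union> Gr" using mem[OF x(2)] by blast
  qed
  have "Gr = (R \<union> Gr) - R" using disj by blast
  also have "\<dots> = {1..card R + card Gr} - {1..card R}" 
    unfolding RG by (rule arg_cong[OF R])
  also have "\<dots> = {card R<..card R + card Gr}" by auto
  finally show "Gr = {card R<..card R + card Gr}" .
  have "B = {1..m} - (R \<union> Gr)" using U disj by blast
  also have "\<dots> = {card R + card Gr<..m}" unfolding RG by auto
  finally show "B = {card R + card Gr<..m}" .
  have "card ((R \<union> Gr) \<union> B) = card (R \<union> Gr) + card B"
    using fin disj by (intro card_Un_disjoint) auto
  then show "m = card R + card Gr + card B" unfolding U cRG by simp
qed

definition color_index :: "nat set \<Rightarrow> nat set \<Rightarrow> nat \<Rightarrow> nat" where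
  "color_index R Gr i = (if i \<in> R then 0 else if i \<in> Gr then 1 else 2)"

text \<open>With \<open>Min P < Min Q\<close>, a factor -1 means that the larger point of
  \<open>P\<close> lies between the ends of \<open>Q\<close>, and this is a crossing.\<close>

lemma pairing_sign_noncrossing:
  assumes \<pi>: "\<pi> \<in> pairings A" and nc: "\<not> crossing \<pi>"
  shows "pairing_sign \<pi> = 1"
  unfolding pairing_sign_def
proof (rule prod.neutral, clarify)
  fix P Q assume PQ: "P \<in> \<pi>" "Q \<in> \<pi>" and less: "Min P < Min Q"
  have "card P = 2" "card Q = 2" using PQ \<pi> by (auto simp: pairings_def)
  then obtain a b c d where P: "a < b" "P = {a, b}" "Min P = a" "Max P = b"
    and Q: "c < d" "Q = {c, d}" "Min Q = c" "Max Q = d" by (metis pairE)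
  have "P \<noteq> Q" using less by auto
  then have "\<not> (c < b \<and> b < d)"
    using crossingI[OF PQ, of a c b d] P Q less nc by auto
  then show "cross_sign P Q = 1"
    using P(1) less unfolding cross_sign_def inside_sign_def Q(3,4) unfolding P(2,3) Q(3) by auto
qed

lemma planar_noncrossing:
  assumes G: "valid_network G" and emb: "plane_embedding G pos crv"
    and cc: "nodes_counterclockwise G pos crv" and K: "K \<in> groves G"
    and c2: "\<And>P. P \<in> node_partition G K \<Longrightarrow> card P = 2"
  shows "\<not> crossing (node_partition G K)"
proof
  assume "crossing (node_partition G K)"
  then obtain P Q a b c d where PQ: "P \<in> node_partition G K" "Q \<in> node_partition G K"
    and lt: "a < b" "b < c" "c < d" and m: "a \<in> P" "c \<in> P" "b \<in> Q" "d \<in> Q"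
    unfolding crossing_def by blast
  have two: "S = {x, y}" if "card S = 2" "x \<in> S" "y \<in> S" "x < y" for S and x y :: nat
    using that by (auto simp: card_2_iff)
  have "P = {a, c}" "Q = {b, d}" 
    using two[OF c2[OF PQ(1)] m(1,2)] two[OF c2[OF PQ(2)] m(3,4)] lt by simp_all
  then have "nodes_in G K (node G a) = {a, c}" "nodes_in G K (node G b) = {b, d}"
    using node_partition_eqI[OF PQ(1) m(1)] node_partition_eqI[OF PQ(2) m(3)] by simp_all
  moreover have "P \<subseteq> node_labels G" "Q \<subseteq> node_labels G"
    using PQ by (auto simp: node_partition_altdef nodes_in_def)
  then have "{a, b, c, d} \<subseteq> node_labels G" using m by blast
  moreover have "K \<subseteq> edges G" using K by (simp add: groves_def forest_def)
  ultimately show False using planar_no_crossing[OF G emb cc _ _ lt] by blast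
qed

theorem theorem3p1:
  fixes G :: "('v, 'e) network"
    and pos :: "'v \<Rightarrow> complex" and crv :: "'e \<Rightarrow> real \<Rightarrow> complex"
    and n :: nat and R Gr B :: "nat set"
  assumes "valid_network G"
    and "num_nodes G = 2 * n"
    and "plane_embedding G pos crv"
    and "nodes_on_outer_face G pos crv"
    and "nodes_counterclockwise G pos crv"
    and "R \<union> Gr \<union> B = {1..2 * n}"
    and "R \<inter> Gr = {}" and "R \<inter> B = {}" and "Gr \<inter> B = {}"
    and "\<forall>i\<in>R. \<forall>j\<in>Gr. i < j" and "\<forall>i\<in>R. \<forall>j\<in>B. i < j" and "\<forall>i\<in>Gr. \<forall>j\<in>B. i < j"
    and "card R \<le> card Gr + card B"
    and "card Gr \<le> card R + card B"
    and "card B \<le> card R + card Gr"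
  shows "grove_prob G (tripartite_pairing n R Gr B) / grove_prob G (singletons (2 * n)) =
         pfaffian n (tripartite_matrix (response_matrix G) R Gr B)"
proof -
  interpret conductance_network G by unfold_locales (rule assms(1))
  define N where "N = {1..2 * n}"
  have labels: "node_labels G = N" using assms(2) by (simp add: node_labels_def N_def)
  note I = color_class_intervals[OF assms(6-12)]
  \<comment> \<open>A pair without a blue node is red-green, so there are \<open>n - card B\<close>
    of them; likewise for the other two. The triangle inequalities make these truncated differences
    genuine.\<close>
  define a where "a = n - card B"
  define c where "c = n - card Gr"
  define d where "d = n - card R"
  have acd: "card R = a + c" "card Gr = a + d" "card B = c + d"
    using I(4) assms(13-15) unfolding a_def c_def d_def by linarith+
  have R: "R = {1..a + c}" using I(1) unfolding acd .
  have s: "a + c + (a + d) = 2 * a + c + d" by simp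
  have Gr: "Gr = {a + c<..2 * a + c + d}" using I(2) unfolding acd s .
  have B: "B = {2 * a + c + d<..2 * n}" using I(3) unfolding acd s .
  have n2: "2 * n = 2 * a + 2 * c + 2 * d" using I(4) unfolding acd by simp
  note \<sigma>_iff = is_tripartite_pairing_iff[OF n2 R Gr B]
  define \<sigma> where "\<sigma> = tripartite_pairing n R Gr B"
  define col where "col = color_index R Gr"
  define L where "L = response_matrix G"
  have cover: "x \<in> R \<or> x \<in> Gr \<or> x \<in> B" if "x \<in> N" for x
    using that assms(6) unfolding N_def by blast
  have col_le: "col i \<le> 2" for i by (simp add: col_def color_index_def)
  have "col x \<le> col y" if "x \<in> N" "y \<in> N" "x \<le> y" for x y
    using that unfolding col_def color_index_def R Gr N_def by auto
  then have mono: "mono_on N col" by (auto simp: mono_on_def)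
  have colR: "x \<in> R \<Longrightarrow> col x = 0" and colGr: "x \<in> Gr \<Longrightarrow> col x = 1" and colB: "x \<in> B \<Longrightarrow> col x = 2" for x
    using assms(7-9) by (auto simp: col_def color_index_def)
  have col_iff: "x \<in> R \<longleftrightarrow> col x = 0" "x \<in> Gr \<longleftrightarrow> col x = 1" "x \<in> B \<longleftrightarrow> col x = 2" if "x \<in> N" for x
    using cover[OF that] colR[of x] colGr[of x] colB[of x] by auto
  have col_eq: "col x = col y \<longleftrightarrow> (\<exists>C\<in>{R, Gr, B}. x \<in> C \<and> y \<in> C)" if "x \<in> N" "y \<in> N" for x y
  proof
    show "\<exists>C\<in>{R, Gr, B}. x \<in> C \<and> y \<in> C" if "col x = col y"
      using cover[OF \<open>x \<in> N\<close>] cover[OF \<open>y \<in> N\<close>] that by (elim disjE) (simp_all add: colR colGr colB)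
    show "col x = col y" if "\<exists>C\<in>{R, Gr, B}. x \<in> C \<and> y \<in> C"
      using that by (auto simp: colR colGr colB)
  qed
  have pair: "\<exists>x y. x < y \<and> x \<in> N \<and> y \<in> N \<and> P = {x, y} \<and> Min P = x \<and> Max P = y"
    if \<pi>: "\<pi> \<in> pairings N" "P \<in> \<pi>" for \<pi> P
  proof -
    have "card P = 2" "P \<subseteq> N" using \<pi> by (auto simp: pairings_def partition_on_def)
    then show ?thesis by (elim pairE) auto
  qed
  \<comment> \<open>Only entries above the diagonal occur, since \<open>Min P < Max P\<close>; there
    the color order excludes the negated blocks, and the zero blocks reproduce the condition that no
    pair is monochromatic.\<close>
  have "pfaffian n (tripartite_matrix L R Gr B) = pairing_sum col L N"
    unfolding pfaffian_eq_sum_pairings pairing_sum_def N_def[symmetric]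
  proof (rule sum.cong[OF refl])
    fix \<pi> assume \<pi>: "\<pi> \<in> pairings N"
    have M: "tripartite_matrix L R Gr B (Min P) (Max P) = of_bool (inj_on col P) * L (Min P) (Max P)"
      if "P \<in> \<pi>" for P
    proof -
      obtain x y where xy: "x < y" "x \<in> N" "y \<in> N" "P = {x, y}" "Min P = x" "Max P = y"
        using pair[OF \<pi> \<open>P \<in> \<pi>\<close>] by blast
      have "tripartite_matrix L R Gr B x y = of_bool (col x \<noteq> col y) * L x y"
      proof -
        have less: "\<not> (x \<in> Gr \<and> y \<in> R)" "\<not> (x \<in> B \<and> y \<in> R)" "\<not> (x \<in> B \<and> y \<in> Gr)"
          using xy(1) assms(10-12) by (meson order.asym)+
        have "x \<in> R \<and> y \<in> Gr \<or> x \<in> R \<and> y \<in> B \<or> x \<in> Gr \<and> y \<in> B \<longleftrightarrow> col x \<noteq> col y"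
          using cover[OF xy(2)] cover[OF xy(3)] less
          by (elim disjE) (simp_all add: col_iff[OF xy(2)] col_iff[OF xy(3)])
        then show ?thesis using less unfolding tripartite_matrix_def by auto
      qed
      moreover have "inj_on col P \<longleftrightarrow> col x \<noteq> col y" using xy(1) unfolding xy(4) by auto
      ultimately show ?thesis unfolding xy(5,6) by simp
    qed
    have fin: "finite \<pi>" using \<pi> by (rule pairings_finite[rotated]) (simp add: N_def)
    show "pairing_sign \<pi> * (\<Prod>P\<in>\<pi>. tripartite_matrix L R Gr B (Min P) (Max P)) =
      tripartite_sign col \<pi> * (\<Prod>P\<in>\<pi>. L (Min P) (Max P))"
    proof (cases "\<forall>P\<in>\<pi>. inj_on col P")
      case True
      then show ?thesis using M by (simp add: tripartite_sign_def)
    next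
      case False
      then obtain P where "P \<in> \<pi>" "\<not> inj_on col P" by blast
      then have "(\<Prod>P\<in>\<pi>. tripartite_matrix L R Gr B (Min P) (Max P)) = 0"
        using M[of P] fin by (intro prod_zero) auto
      then show ?thesis using False by (auto simp: tripartite_sign_def)
    qed
  qed
  moreover have "grove_pairing_sum col N = partition_weight all_singletons * pairing_sum col L N"
    unfolding L_def by (rule grove_pairing_sum_eq[OF _ mono col_le]) (simp add: labels)
  \<comment> \<open>Here planarity enters. A grove that pairs all nodes induces a non-crossing
    pairing, whose sign is 1; the color condition leaves only \<open>\<sigma>\<close>.\<close>
  moreover have "grove_pairing_sum col N = partition_weight \<sigma>"
  proof -
    have "(if paired_on N (node_partition G K) then tripartite_sign col (pairs_of (node_partition G K)) else 0) =
        of_bool (node_partition G K = \<sigma>)" if K: "K \<in> groves G" for K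
    proof -
      define \<tau> where "\<tau> = node_partition G K"
      have part: "partition_on N \<tau>"
        using partition_on_node_partition[of G K] by (simp add: \<tau>_def labels)
      have paired: "paired_on N \<tau> \<longleftrightarrow> (\<forall>P\<in>\<tau>. card P = 2)"
      proof -
        have "(card P = 2 \<and> P \<subseteq> N \<or> card P = 1 \<and> P \<inter> N = {}) \<longleftrightarrow> card P = 2" if "P \<in> \<tau>" for P
        proof -
          have "P \<subseteq> N" "P \<noteq> {}" using that part by (auto simp: partition_on_def)
          then show ?thesis by (simp add: Int_absorb2)
        qed
        then show ?thesis by (simp add: paired_on_def)
      qed
      show ?thesis
      proof (cases "\<forall>P\<in>\<tau>. card P = 2")
        case False
        moreover have "\<forall>P\<in>\<sigma>. card P = 2"
          using \<sigma>_iff[of \<sigma>] by (simp add: \<sigma>_def is_tripartite_pairing_def)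
        ultimately show ?thesis using paired unfolding \<tau>_def[symmetric] by auto
      next
        case True
        have nc: "\<not> crossing \<tau>"
          using planar_noncrossing[OF assms(1,3,5) K] True by (simp add: \<tau>_def)
        have \<tau>: "\<tau> \<in> pairings N" using part True by (simp add: pairings_def)
        have "(\<forall>P\<in>\<tau>. inj_on col P) \<longleftrightarrow>
          (\<forall>P\<in>\<tau>. \<forall>C\<in>{R, Gr, B}. \<forall>i\<in>P. \<forall>j\<in>P. i \<in> C \<and> j \<in> C \<longrightarrow> i = j)"
        proof (rule ball_cong[OF refl])
          fix P assume "P \<in> \<tau>"
          then have "P \<subseteq> N" using part by (auto simp: partition_on_def)
          then have same: "col i = col j \<longleftrightarrow> (\<exists>C\<in>{R, Gr, B}. i \<in> C \<and> j \<in> C)" if "i \<in> P" "j \<in> P" for i j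
            using that by (intro col_eq) auto
          show "inj_on col P \<longleftrightarrow> (\<forall>C\<in>{R, Gr, B}. \<forall>i\<in>P. \<forall>j\<in>P. i \<in> C \<and> j \<in> C \<longrightarrow> i = j)"
          proof
            assume inj: "inj_on col P"
            show "\<forall>C\<in>{R, Gr, B}. \<forall>i\<in>P. \<forall>j\<in>P. i \<in> C \<and> j \<in> C \<longrightarrow> i = j"
            proof (intro ballI impI)
              fix C i j assume C: "C \<in> {R, Gr, B}" "i \<in> P" "j \<in> P" "i \<in> C \<and> j \<in> C"
              then have "col i = col j" using same[OF C(2,3)] by blast
              then show "i = j" by (rule inj_onD[OF inj _ C(2,3)])
            qed
          next
            assume all: "\<forall>C\<in>{R, Gr, B}. \<forall>i\<in>P. \<forall>j\<in>P. i \<in> C \<and> j \<in> C \<longrightarrow> i = j"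
            show "inj_on col P"
            proof (rule inj_onI)
              fix i j assume ij: "i \<in> P" "j \<in> P" "col i = col j"
              have "\<exists>C\<in>{R, Gr, B}. i \<in> C \<and> j \<in> C" using same[OF ij(1,2)] ij(3) by (rule iffD1)
              then obtain C where C: "C \<in> {R, Gr, B}" "i \<in> C \<and> j \<in> C" by (rule bexE)
              then show "i = j" using all ij(1,2) by blast
            qed
          qed
        qed
        then have "(\<forall>P\<in>\<tau>. inj_on col P) \<longleftrightarrow> is_tripartite_pairing n R Gr B \<tau>"
          unfolding is_tripartite_pairing_def N_def[symmetric] using part True nc by simp
        then have "(\<forall>P\<in>\<tau>. inj_on col P) \<longleftrightarrow> \<tau> = \<sigma>" using \<sigma>_iff by (simp add: \<sigma>_def)
        moreover have "pairs_of \<tau> = \<tau>" using True by (auto simp: pairs_of_def)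
        ultimately show ?thesis
          using paired True pairing_sign_noncrossing[OF \<tau> nc]
          unfolding \<tau>_def[symmetric] tripartite_sign_def by auto
      qed
    qed
    then have "grove_pairing_sum col N =
        (\<Sum>K\<in>groves G. if node_partition G K = \<sigma> then grove_weight G K else 0)"
      unfolding grove_pairing_sum_def by (intro sum.cong) auto
    then show ?thesis using finite_groves by (simp add: partition_weight_def sum.inter_filter)
  qed
  moreover have "singletons (2 * n) = all_singletons"
    by (simp add: singletons_def all_singletons_def labels N_def)
  moreover have "(\<Sum>F\<in>groves G. grove_weight G F) > 0"
    using ex_singleton_grove finite_groves grove_weight_pos by (intro sum_pos) auto
  ultimately show ?thesis
    using singleton_weight_pos
    unfolding grove_prob_def partition_weight_def[symmetric] \<sigma>_def[symmetric] L_def[symmetric]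
    by simp
qed

end
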